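(* Fix $K>0$ and $\varepsilon>0$. For every $x\in B$, the law $\delta_xP_t^B$ at time $t$ of the solution of $dh=K(1-h^2)\,dt+\sqrt2\,i\,\varepsilon\,h\circ dW$, $h(0)=x$, converges in distribution (as a probability measure on $\overline{B}$) to $\mu_{K,\varepsilon}$ as $t\to+\infty$.
   Context: $B=\{z\in\mathbb{C}:|z|<1\}$, $\partial B=\{|z|=1\}$, $\overline{B}=\{|z|\le1\}$. $W$ is a one-dimensional real Brownian motion; $\circ$ is the Stratonovich product. For $x\in\overline{B}$, $h^x$ is the unique global solution with $h^x(0)=x$; it stays in $B$ if $x\in B$ and in $\partial B$ if $x\in\partial B$. For $A\in\{B,\partial B\}$, $P_t^Af(x)=\mathbb{E}(f(h^x(t)))$ for bounded Borel $f$ on $A$, and $\delta_xP_t^A$ is the law of $h^x(t)$. $\mu_{K,\varepsilon}$ denotes the unique invariant probability measure of $(P_t^{\partial B})_{t\ge0}$ on $\partial B$ (that is, $\int P_t^{\partial B}f\,d\mu=\int f\,d\mu$ for all $t\ge 0$ and bounded Borel $f$), regarded also as a measure on $\overline{B}$ by $F\mapsto\mu_{K,\varepsilon}(F\cap\partial B)$. *)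

theory Defs
  imports "HOL-Probability.Probability" "HOL-Probability.Stopping_Time"
begin

text \<open>
  Processes are functions of type \<open>real \<Rightarrow> 'a \<Rightarrow> 'b\<close>, and only times \<open>t \<ge> 0\<close> matter.  Filtrations are
  indexed by all reals so that the library notions \<^const>\<open>filtration\<close> and \<^const>\<open>stopping_time\<close> apply;
  every filtration indexed by \<open>t \<ge> 0\<close> extends by \<open>F t = F 0\<close> for \<open>t < 0\<close>.
\<close>

definition filtered_prob_space :: "'a measure \<Rightarrow> (real \<Rightarrow> 'a measure) \<Rightarrow> bool" where
  "filtered_prob_space M F \<longleftrightarrow>
     prob_space M \<and> filtration (space M) F \<and> (\<forall>t. subalgebra M (F t))"

definition continuous_adapted ::
  "'a measure \<Rightarrow> (real \<Rightarrow> 'a measure) \<Rightarrow> (real \<Rightarrow> 'a \<Rightarrow> 'b::topological_space) \<Rightarrow> bool" where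
  "continuous_adapted M F X \<longleftrightarrow>
     (\<forall>t\<ge>0. X t \<in> borel_measurable (F t)) \<and>
     (AE \<omega> in M. continuous_on {0..} (\<lambda>t. X t \<omega>))"

definition brownian_motion ::
  "'a measure \<Rightarrow> (real \<Rightarrow> 'a measure) \<Rightarrow> (real \<Rightarrow> 'a \<Rightarrow> real) \<Rightarrow> bool" where
  "brownian_motion M F W \<longleftrightarrow>
     continuous_adapted M F W \<and>
     (AE \<omega> in M. W 0 \<omega> = 0) \<and>
     (\<forall>s t. 0 \<le> s \<and> s < t \<longrightarrow>
        distributed M lborel (\<lambda>\<omega>. W t \<omega> - W s \<omega>) (normal_density 0 (sqrt (t - s))) \<and>
        prob_space.indep_set M (sets (F s))
          (sets (vimage_algebra (space M) (\<lambda>\<omega>. W t \<omega> - W s \<omega>) borel)))"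


subsection \<open>Continuous semimartingales\<close>

definition martingale ::
  "'a measure \<Rightarrow> (real \<Rightarrow> 'a measure) \<Rightarrow> (real \<Rightarrow> 'a \<Rightarrow> real) \<Rightarrow> bool" where
  "martingale M F X \<longleftrightarrow>
     (\<forall>t\<ge>0. X t \<in> borel_measurable (F t) \<and> integrable M (X t)) \<and>
     (\<forall>s t. 0 \<le> s \<and> s \<le> t \<longrightarrow> (AE \<omega> in M. real_cond_exp M (F s) (X t) \<omega> = X s \<omega>))"

text \<open>
  The localizing times are finite, which is no restriction: replace \<open>T n\<close> by \<open>min (T n) n\<close>.
\<close>

definition continuous_local_martingale ::
  "'a measure \<Rightarrow> (real \<Rightarrow> 'a measure) \<Rightarrow> (real \<Rightarrow> 'a \<Rightarrow> real) \<Rightarrow> bool" where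
  "continuous_local_martingale M F X \<longleftrightarrow>
     continuous_adapted M F X \<and>
     (\<exists>T :: nat \<Rightarrow> 'a \<Rightarrow> real.
        (\<forall>n. stopping_time F (T n) \<and> (\<forall>\<omega>\<in>space M. 0 \<le> T n \<omega>)) \<and>
        (AE \<omega> in M. incseq (\<lambda>n. T n \<omega>) \<and> filterlim (\<lambda>n. T n \<omega>) at_top sequentially) \<and>
        (\<forall>n. martingale M F (\<lambda>t \<omega>. X (min t (T n \<omega>)) \<omega> - X 0 \<omega>)))"

text \<open>The points \<open>p 0, \<dots>, p n\<close> subdivide the interval from \<open>0\<close> to \<open>t\<close>.\<close>

definition subdivision :: "real \<Rightarrow> nat \<Rightarrow> (nat \<Rightarrow> real) \<Rightarrow> bool" where
  "subdivision t n p \<longleftrightarrow> p 0 = 0 \<and> p n = t \<and> (\<forall>i<n. p i \<le> p (Suc i))"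

definition continuous_finite_variation ::
  "'a measure \<Rightarrow> (real \<Rightarrow> 'a measure) \<Rightarrow> (real \<Rightarrow> 'a \<Rightarrow> real) \<Rightarrow> bool" where
  "continuous_finite_variation M F A \<longleftrightarrow>
     continuous_adapted M F A \<and>
     (AE \<omega> in M. \<forall>t\<ge>0. \<exists>C. \<forall>n p. subdivision t n p \<longrightarrow>
        (\<Sum>i<n. \<bar>A (p (Suc i)) \<omega> - A (p i) \<omega>\<bar>) \<le> C)"

definition real_semimartingale ::
  "'a measure \<Rightarrow> (real \<Rightarrow> 'a measure) \<Rightarrow> (real \<Rightarrow> 'a \<Rightarrow> real) \<Rightarrow> bool" where
  "real_semimartingale M F X \<longleftrightarrow>
     continuous_adapted M F X \<and>
     (\<exists>N A. continuous_local_martingale M F N \<and> continuous_finite_variation M F A \<and>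
        (AE \<omega> in M. \<forall>t\<ge>0. X t \<omega> = N t \<omega> + A t \<omega>))"

definition complex_semimartingale ::
  "'a measure \<Rightarrow> (real \<Rightarrow> 'a measure) \<Rightarrow> (real \<Rightarrow> 'a \<Rightarrow> complex) \<Rightarrow> bool" where
  "complex_semimartingale M F X \<longleftrightarrow>
     real_semimartingale M F (\<lambda>t \<omega>. Re (X t \<omega>)) \<and> real_semimartingale M F (\<lambda>t \<omega>. Im (X t \<omega>))"


subsection \<open>Stratonovich integrals and equations\<close>

definition tendsto_in_prob ::
  "'a measure \<Rightarrow> (nat \<Rightarrow> 'a \<Rightarrow> 'b::metric_space) \<Rightarrow> ('a \<Rightarrow> 'b) \<Rightarrow> bool" where
  "tendsto_in_prob M X Y \<longleftrightarrow>
     (\<forall>e>0. (\<lambda>n. measure M {\<omega>\<in>space M. e \<le> dist (X n \<omega>) (Y \<omega>)}) \<longlonglongrightarrow> 0)"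

text \<open>
  \<open>I\<close> is (a version of) the integral of \<open>Y \<circ> dW\<close> from \<open>0\<close> to \<open>t\<close>: the limit in probability of the
  symmetric Riemann sums as the mesh of the subdivision tends to \<open>0\<close>.  For continuous semimartingales
  the limit exists, and it equals the Ito integral of \<open>Y\<close> plus half the quadratic covariation of
  \<open>Y\<close> and \<open>W\<close>.
\<close>

definition stratonovich_integral ::
  "'a measure \<Rightarrow> (real \<Rightarrow> 'a measure) \<Rightarrow> (real \<Rightarrow> 'a \<Rightarrow> real) \<Rightarrow> (real \<Rightarrow> 'a \<Rightarrow> complex) \<Rightarrow>
   real \<Rightarrow> ('a \<Rightarrow> complex) \<Rightarrow> bool" where
  "stratonovich_integral M F W Y t I \<longleftrightarrow>
     complex_semimartingale M F Y \<and>
     I \<in> borel_measurable M \<and>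
     (\<forall>n p. (\<forall>k. subdivision t (n k) (p k)) \<and>
            (\<forall>d>0. \<forall>\<^sub>F k in sequentially. \<forall>i<n k. p k (Suc i) - p k i < d) \<longrightarrow>
        tendsto_in_prob M
          (\<lambda>k \<omega>. \<Sum>i<n k. (Y (p k i) \<omega> + Y (p k (Suc i)) \<omega>) / 2 *
                    complex_of_real (W (p k (Suc i)) \<omega> - W (p k i) \<omega>)) I)"

text \<open>\<open>X\<close> is a global solution of \<open>dX = b(X) dt + \<sigma>(X) \<circ> dW\<close> with \<open>X 0 = x\<close>.\<close>

definition stratonovich_solution ::
  "'a measure \<Rightarrow> (real \<Rightarrow> 'a measure) \<Rightarrow> (real \<Rightarrow> 'a \<Rightarrow> real) \<Rightarrow>
   (complex \<Rightarrow> complex) \<Rightarrow> (complex \<Rightarrow> complex) \<Rightarrow> complex \<Rightarrow> (real \<Rightarrow> 'a \<Rightarrow> complex) \<Rightarrow> bool" where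
  "stratonovich_solution M F W b \<sigma> x X \<longleftrightarrow>
     complex_semimartingale M F X \<and>
     (AE \<omega> in M. X 0 \<omega> = x) \<and>
     (\<forall>t\<ge>0. \<exists>I. stratonovich_integral M F W (\<lambda>s \<omega>. \<sigma> (X s \<omega>)) t I \<and>
        (AE \<omega> in M. X t \<omega> = x + integral {0..t} (\<lambda>s. b (X s \<omega>)) + I \<omega>))"


subsection \<open>Transition semigroup, laws, invariant measures and weak convergence\<close>

text \<open>
  \<open>h x\<close> is the process started at \<open>x\<close>.  Bounded Borel functions on a Borel set \<open>A\<close> are represented by
  bounded Borel functions on the whole plane, of which only the values on \<open>A\<close> matter when \<open>h x\<close> stays
  in \<open>A\<close> almost surely.
\<close>

definition transition_op ::
  "'a measure \<Rightarrow> (complex \<Rightarrow> real \<Rightarrow> 'a \<Rightarrow> complex) \<Rightarrow> real \<Rightarrow> (complex \<Rightarrow> real) \<Rightarrow> complex \<Rightarrow> real" where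
  "transition_op M h t f x = (\<integral>\<omega>. f (h x t \<omega>) \<partial>M)"

definition transition_law ::
  "'a measure \<Rightarrow> (complex \<Rightarrow> real \<Rightarrow> 'a \<Rightarrow> complex) \<Rightarrow> complex set \<Rightarrow> real \<Rightarrow> complex \<Rightarrow> complex measure" where
  "transition_law M h A t x = restrict_space (distr M borel (h x t)) A"

definition invariant_prob_measure ::
  "'a measure \<Rightarrow> (complex \<Rightarrow> real \<Rightarrow> 'a \<Rightarrow> complex) \<Rightarrow> complex set \<Rightarrow> complex measure \<Rightarrow> bool" where
  "invariant_prob_measure M h A \<mu> \<longleftrightarrow>
     prob_space \<mu> \<and> sets \<mu> = sets (restrict_space borel A) \<and>
     (\<forall>t\<ge>0. \<forall>f. f \<in> borel_measurable borel \<and> bounded (range f) \<longrightarrow>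
        (\<integral>x. transition_op M h t f x \<partial>\<mu>) = (\<integral>x. f x \<partial>\<mu>))"

text \<open>The measure on \<open>S\<close> given by \<open>G \<mapsto> \<nu> (G \<inter> space \<nu>)\<close>.\<close>

definition regard_on :: "complex set \<Rightarrow> complex measure \<Rightarrow> complex measure" where
  "regard_on S \<nu> = distr \<nu> (restrict_space borel S) (\<lambda>z. z)"

definition converges_in_distribution_on ::
  "'b::metric_space set \<Rightarrow> ('i \<Rightarrow> 'b measure) \<Rightarrow> 'b measure \<Rightarrow> 'i filter \<Rightarrow> bool" where
  "converges_in_distribution_on S \<nu> \<mu> G \<longleftrightarrow>
     (\<forall>\<^sub>F i in G. prob_space (\<nu> i) \<and> sets (\<nu> i) = sets (restrict_space borel S)) \<and>
     prob_space \<mu> \<and> sets \<mu> = sets (restrict_space borel S) \<and>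
     (\<forall>f :: 'b \<Rightarrow> real. continuous_on S f \<and> bounded (f ` S) \<longrightarrow>
        ((\<lambda>i. \<integral>x. f x \<partial>\<nu> i) \<longlongrightarrow> (\<integral>x. f x \<partial>\<mu>)) G)"

end

theory Submission
  imports Defs
begin

text \<open>
  Multiplying \<open>h\<close> by \<open>exp (- i c W)\<close> with \<open>c = sqrt 2 * \<epsilon>\<close> turns the equation into a random ordinary
  differential equation.  Hence \<open>1 - \<bar>h t\<bar>\<^sup>2 = (1 - \<bar>x\<bar>\<^sup>2) exp (- 2 K \<integral>\<^sub>0\<^sup>t Re h)\<close>, and the moments
  \<open>a\<^sub>n = E (G h\<^sup>n)\<close>, with a weight \<open>G\<close> known at an earlier time, solve
  \<open>a\<^sub>n' = - \<epsilon>\<^sup>2 n\<^sup>2 a\<^sub>n + K n (a\<^sub>n\<^sub>-\<^sub>1 - a\<^sub>n\<^sub>+\<^sub>1)\<close>.  For two solutions with the same \<open>a\<^sub>0\<close> the energy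
  \<open>\<Sum>n. \<bar>d\<^sub>n\<bar>\<^sup>2 / n\<close> of the difference decays like \<open>exp (- 2 \<epsilon>\<^sup>2 t)\<close>, because the transport part is
  antisymmetric for it; so the moments from any starting point approach those of \<open>\<mu>\<close>.  The
  stationary equations give \<open>\<integral> Re z \<partial>\<mu> > 0\<close>, whence a small power of \<open>1 - \<bar>h t\<bar>\<^sup>2\<close> tends to \<open>0\<close> in mean.
  Near the circle a continuous function is approximated by the real part of a holomorphic polynomial.

  To integrate the noise out with nothing but Riemann sums, the midpoint error on a grid is written
  as a Levy area on a finer grid.  It is small because transforms of semimartingales by bounded
  adapted weights are bounded in probability.
\<close>

text \<open>The moments of \<open>h^n\<close> are holomorphic and do not determine a law on the
  closed disc: the Dirac mass at 0 and the uniform law on the circle share all of them. Their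
  convergence is therefore useful only together with |h| -> 1. That is not evident pathwise, because
  Re h has no sign; it is positive only on stationary average. Up to normalization let q = (1 -
  |h|^2)^p; the mean of q has derivative - 2 K p E(Re h * q), which correlates Re h with its own
  past. Replacing q by its value a time \<tau> earlier turns it into an admissible weight
  \<open>G\<close>, Re h then has time \<tau> to approach its stationary mean, and the price exp(2 K
  p \<tau>) - 1 is small for small p. Hence the weights and the small power. In the energy the
  weights 1/n cancel the factor n of the transport term. Equal \<open>a 0\<close> removes the
  boundary term at 0, and the one at a cutoff N tends to 0 because bounded solutions are O(1/n)
  after unit time. Squared increments of \<open>W\<close> sum to a bounded but not small quantity,
  so every error that is quadratic in increments must carry a further small factor.\<close>

text \<open>Only the exceptional set has to be measurable, not the set where \<open>P\<close> holds.
  So \<open>P\<close> may quantify over all times of an interval or speak of continuity of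
  paths.\<close>

definition (in prob_space) whp :: "real \<Rightarrow> ('a \<Rightarrow> bool) \<Rightarrow> bool" where
  "whp r P \<longleftrightarrow> (\<exists>A\<in>sets M. measure M A \<le> r \<and> (\<forall>\<omega>\<in>space M - A. P \<omega>))"

section \<open>Statements that hold outside an event of small probability\<close>

context prob_space
begin

lemma whpI: "A \<in> sets M \<Longrightarrow> measure M A \<le> r \<Longrightarrow> (\<And>\<omega>. \<omega> \<in> space M \<Longrightarrow> \<omega> \<notin> A \<Longrightarrow> P \<omega>) \<Longrightarrow> whp r P"
  unfolding whp_def by blast

lemma whp_mono:
  assumes "whp r P" "r \<le> r'" "\<And>\<omega>. \<omega> \<in> space M \<Longrightarrow> P \<omega> \<Longrightarrow> Q \<omega>"
  shows "whp r' Q"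
  using assms unfolding whp_def by (meson DiffD1 order_trans)

lemma whp_conj:
  assumes "whp r P" "whp s Q"
  shows "whp (r + s) (\<lambda>\<omega>. P \<omega> \<and> Q \<omega>)"
proof -
  obtain A B where "A \<in> sets M" "measure M A \<le> r" "\<forall>\<omega>\<in>space M - A. P \<omega>"
    "B \<in> sets M" "measure M B \<le> s" "\<forall>\<omega>\<in>space M - B. Q \<omega>"
    using assms unfolding whp_def by blast
  then show ?thesis
    by (intro whpI[of "A \<union> B"]) (auto intro: order_trans[OF measure_Un_le])
qed

lemma whp_conj':
  assumes "whp r P" "whp s Q" "r + s \<le> q"
  shows "whp q (\<lambda>\<omega>. P \<omega> \<and> Q \<omega>)"
  using whp_mono[OF whp_conj[OF assms(1,2)] assms(3)] by simp

lemma whp_Ball_finite: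
  assumes "finite I" "\<And>i. i \<in> I \<Longrightarrow> whp (r i) (P i)"
  shows "whp (\<Sum>i\<in>I. r i) (\<lambda>\<omega>. \<forall>i\<in>I. P i \<omega>)"
  using assms
proof (induction I)
  case empty
  then show ?case by (intro whpI[of "{}"]) auto
next
  case (insert i I)
  then have "whp (r i) (P i)" "whp (sum r I) (\<lambda>\<omega>. \<forall>i\<in>I. P i \<omega>)" by blast+
  from whp_conj[OF this] show ?case
    using insert.hyps by simp
qed

lemma AE_imp_whp:
  assumes "AE \<omega> in M. P \<omega>" "0 \<le> r"
  shows "whp r P"
proof -
  obtain N where "N \<in> null_sets M" "{\<omega>\<in>space M. \<not> P \<omega>} \<subseteq> N"
    using assms(1) unfolding eventually_ae_filter by blast
  then show ?thesis using assms(2)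
    by (intro whpI[of N]) (auto simp: null_setsD2 measure_eq_0_null_sets)
qed

lemma whp_imp_AE:
  assumes "\<And>r. r > 0 \<Longrightarrow> whp r P"
  shows "AE \<omega> in M. P \<omega>"
proof -
  have "\<exists>A\<in>sets M. measure M A \<le> 1 / real (Suc n) \<and> (\<forall>\<omega>\<in>space M - A. P \<omega>)" for n
    using assms[of "1 / real (Suc n)"] unfolding whp_def by simp
  then obtain A where A: "\<And>n. A n \<in> sets M" "\<And>n. measure M (A n) \<le> 1 / real (Suc n)"
    "\<And>n. \<forall>\<omega>\<in>space M - A n. P \<omega>"
    by metis
  have "measure M (\<Inter>n. A n) \<le> 1 / real (Suc n)" for n
    using A(1) by (intro order_trans[OF finite_measure_mono A(2)[of n]]) auto
  then have "measure M (\<Inter>n. A n) \<le> 0"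
    by (intro LIMSEQ_le_const[OF LIMSEQ_inverse_real_of_nat]) (auto simp: inverse_eq_divide)
  then have "(\<Inter>n. A n) \<in> null_sets M"
    using A(1) by (intro null_setsI) (auto simp: emeasure_eq_measure measure_le_0_iff)
  then show ?thesis
    using A(3) by (intro AE_I'[of "\<Inter>n. A n"]) auto
qed

lemma whp_imp_AE_le:
  fixes f :: "'a \<Rightarrow> real"
  assumes "\<And>e r. e > 0 \<Longrightarrow> r > 0 \<Longrightarrow> whp r (\<lambda>\<omega>. f \<omega> \<le> e)"
  shows "AE \<omega> in M. f \<omega> \<le> 0"
proof -
  have "AE \<omega> in M. \<forall>n. f \<omega> \<le> inverse (real (Suc n))"
    unfolding AE_all_countable by (intro allI whp_imp_AE assms) auto
  then show ?thesis
  proof eventually_elim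
    case (elim \<omega>)
    then show ?case by (intro LIMSEQ_le_const[OF LIMSEQ_inverse_real_of_nat]) auto
  qed
qed

lemma whp_Markov:
  assumes f: "integrable M f" and nn: "AE \<omega> in M. 0 \<le> f \<omega>" and "C > 0" "(\<integral>\<omega>. f \<omega> \<partial>M) / C \<le> r"
  shows "whp r (\<lambda>\<omega>. f \<omega> < C)"
proof (rule whpI)
  show "{\<omega>\<in>space M. f \<omega> \<ge> C} \<in> sets M" using f by measurable
  show "measure M {\<omega>\<in>space M. f \<omega> \<ge> C} \<le> r"
    using integral_Markov_inequality_measure[OF f sets.top nn \<open>C > 0\<close>] assms(4) by simp
qed auto

text \<open>Continuity of the measure from above, applied to the complements. It exchanges a random
  index for a deterministic one at the cost of a small event.\<close>

lemma whp_eventually: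
  fixes P :: "nat \<Rightarrow> 'a \<Rightarrow> bool"
  assumes meas: "\<And>n. {\<omega>\<in>space M. P n \<omega>} \<in> sets M"
    and mono: "\<And>m n \<omega>. \<omega> \<in> space M \<Longrightarrow> m \<le> n \<Longrightarrow> P m \<omega> \<Longrightarrow> P n \<omega>"
    and ev: "AE \<omega> in M. \<exists>n. P n \<omega>" and "r > 0"
  shows "\<exists>n. whp r (P n)"
proof -
  define A where "A n = space M - {\<omega>\<in>space M. P n \<omega>}" for n
  have A: "range A \<subseteq> sets M" "decseq A"
    using meas mono by (auto simp: A_def decseq_def)
  have "(\<Inter>n. A n) = {\<omega>\<in>space M. \<not> (\<exists>n. P n \<omega>)}"
    by (auto simp: A_def)
  moreover have "\<Inter>(range A) \<in> sets M" using A by auto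
  ultimately have "measure M (\<Inter>n. A n) = 0"
    using ev AE_iff_measurable[of "\<Inter>(range A)" M "\<lambda>\<omega>. \<exists>n. P n \<omega>"] by (auto simp: measure_def)
  with finite_Lim_measure_decseq[OF A] have "(\<lambda>n. measure M (A n)) \<longlonglongrightarrow> 0" by simp
  then have "eventually (\<lambda>n. measure M (A n) < r) sequentially"
    using \<open>r > 0\<close> by (rule order_tendstoD)
  then obtain n where "measure M (A n) < r" by (auto simp: eventually_sequentially)
  then show ?thesis
    using A by (intro exI[of _ n] whpI[of "A n"]) (auto simp: A_def)
qed

end

subsection \<open>Martingale transforms\<close>

text \<open>Burkholder's special function for the weak-type (1,1) inequality with constant 2;
  \<open>x\<close> is the martingale and \<open>y\<close> its transform. The two formulas agree on
  |x| + |y| = 1, where \<open>y^2 - x^2\<close> factors as |y| - |x| = 1 - 2|x|.\<close>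

definition weak_type_fun :: "real \<Rightarrow> real \<Rightarrow> real" where
  "weak_type_fun x y = (if \<bar>x\<bar> + \<bar>y\<bar> < 1 then y\<^sup>2 - x\<^sup>2 else 1 - 2 * \<bar>x\<bar>)"

lemma weak_type_fun_le: "weak_type_fun x y \<le> 1 - 2 * \<bar>x\<bar>"
proof -
  have "y\<^sup>2 \<le> (1 - \<bar>x\<bar>)\<^sup>2" if "\<bar>x\<bar> + \<bar>y\<bar> < 1"
    using that by (intro power2_le_iff_abs_le[THEN iffD2]) auto
  then show ?thesis
    by (auto simp: weak_type_fun_def power2_eq_square algebra_simps)
qed

text \<open>The minorant whose mean is the two sides of the weak-type inequality: the probability of
  |y| at least 1, less twice the mean of |x|.\<close>

lemma weak_type_fun_ge: "(if 1 \<le> \<bar>y\<bar> then 1 else 0) - 2 * \<bar>x\<bar> \<le> weak_type_fun x y"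
proof -
  have "x\<^sup>2 \<le> \<bar>x\<bar>" if "\<bar>x\<bar> + \<bar>y\<bar> < 1"
    using that mult_left_mono[of "\<bar>x\<bar>" 1 "\<bar>x\<bar>"] by (simp add: power2_eq_square)
  then show ?thesis
    using zero_le_power2[of y] by (auto simp: weak_type_fun_def split: if_splits) (smt (verit) zero_le_power2)+
qed

text \<open>The step that leaves the diamond |x| + |y| < 1. The sign condition on
  \<open>x + h\<close> costs nothing, since everything is invariant under reflecting
  \<open>x\<close> and \<open>h\<close> together.\<close>

lemma weak_type_fun_step_aux:
  fixes x y h k :: real
  assumes "\<bar>x\<bar> + \<bar>y\<bar> < 1" "1 \<le> \<bar>x + h\<bar> + \<bar>y + k\<bar>" "\<bar>k\<bar> \<le> \<bar>h\<bar>" "0 \<le> x + h"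
  shows "1 - 2 * \<bar>x + h\<bar> \<le> y\<^sup>2 - x\<^sup>2 - 2 * x * h + 2 * y * k"
proof (cases "x + h \<le> 1")
  case True
  have "(1 - (x + h))\<^sup>2 \<le> (y + k)\<^sup>2"
    using assms True by (intro power2_le_iff_abs_le[THEN iffD2] abs_le_square_iff[THEN iffD1]) auto
  moreover have "k\<^sup>2 \<le> h\<^sup>2" using assms by (simp add: abs_le_square_iff)
  ultimately show ?thesis using assms by (simp add: power2_eq_square algebra_simps)
next
  case False
  have h: "h > 0" using assms False by linarith
  have "- (\<bar>y\<bar> * h) \<le> y * k"
    using assms h mult_mono[of "\<bar>y\<bar>" "\<bar>y\<bar>" "\<bar>k\<bar>" h] by (simp add: abs_le_iff abs_mult[symmetric])
  \<comment> \<open>The product expands to 2 h (1 - x - |y|) + y^2 - (1 - x)^2, and its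
    nonnegativity is the claim with \<open>y * k\<close> replaced by its lower bound. Both factors
    are nonnegative because h > 1 - x > |y|.\<close>
  moreover have "0 \<le> (1 - x - \<bar>y\<bar>) * (2 * h - (1 - x) - \<bar>y\<bar>)"
    using assms False by (intro mult_nonneg_nonneg) (auto simp: abs_if split: if_splits)
  moreover have "\<bar>y\<bar> * \<bar>y\<bar> = y * y" by simp
  ultimately show ?thesis using assms by (simp add: power2_eq_square algebra_simps)
qed

text \<open>A tangent bound valid for steps with |k| at most |h|: the coefficients of
  \<open>h\<close> and \<open>k\<close> are the partial derivatives inside the diamond and the
  slopes of 1 - 2|x| outside. For martingale increments the linear terms have mean 0, which makes
  the function a supermartingale along the transform.\<close>

lemma weak_type_fun_step:
  fixes x y h k :: real
  assumes k: "\<bar>k\<bar> \<le> \<bar>h\<bar>"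
  shows "weak_type_fun (x + h) (y + k) \<le> weak_type_fun x y
      + (if \<bar>x\<bar> + \<bar>y\<bar> < 1 then - 2 * x else - 2 * sgn x) * h
      + (if \<bar>x\<bar> + \<bar>y\<bar> < 1 then 2 * y else 0) * k"
proof (cases "\<bar>x\<bar> + \<bar>y\<bar> < 1")
  case inside: True
  show ?thesis
  proof (cases "\<bar>x + h\<bar> + \<bar>y + k\<bar> < 1")
    case True
    have "k\<^sup>2 \<le> h\<^sup>2" using assms by (simp add: abs_le_square_iff)
    then show ?thesis
      using inside True by (simp add: weak_type_fun_def power2_eq_square algebra_simps)
  next
    case False
    have "1 - 2 * \<bar>x + h\<bar> \<le> y\<^sup>2 - x\<^sup>2 - 2 * x * h + 2 * y * k"
    proof (cases "0 \<le> x + h")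
      case True
      then show ?thesis using weak_type_fun_step_aux[of x y h k] inside False k by simp
    next
      case neg: False
      then show ?thesis using weak_type_fun_step_aux[of "-x" y "-h" k] inside False k by simp
    qed
    then show ?thesis using inside False by (simp add: weak_type_fun_def)
  qed
next
  case False
  \<comment> \<open>Outside the diamond only concavity of 1 - 2|x| is used; the new point may lie
    anywhere, since that expression is an upper bound everywhere.\<close>
  have "sgn x * (x + h) \<le> \<bar>x + h\<bar>" by (auto simp: sgn_if abs_if)
  then have "1 - 2 * \<bar>x + h\<bar> \<le> 1 - 2 * \<bar>x\<bar> - 2 * sgn x * h"
    by (simp add: algebra_simps abs_sgn)
  with weak_type_fun_le[of "x + h" "y + k"] show ?thesis
    using False by (simp add: weak_type_fun_def)
qed

lemma weak_type_fun_measurable[measurable]: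
  assumes [measurable]: "f \<in> borel_measurable M" "g \<in> borel_measurable M"
  shows "(\<lambda>w. weak_type_fun (f w) (g w)) \<in> borel_measurable M"
  unfolding weak_type_fun_def by measurable

lemma weak_type_fun_abs_le: "\<bar>weak_type_fun x y\<bar> \<le> 1 + 2 * \<bar>x\<bar>"
  using weak_type_fun_le[of x y] weak_type_fun_ge[of y x] by (auto split: if_splits)

text \<open>The discrete martingale property in weak form, tested against bounded weights known at
  step \<open>k\<close>. This form can be checked directly for Brownian motion and for stopped local
  martingales, and it is what the one-step inequality consumes.\<close>

definition orthogonal_increments :: "'a measure \<Rightarrow> nat \<Rightarrow> (nat \<Rightarrow> 'a measure) \<Rightarrow> (nat \<Rightarrow> 'a \<Rightarrow> real) \<Rightarrow> bool" where
  "orthogonal_increments M n G X \<longleftrightarrow> (\<forall>k\<le>n. integrable M (X k)) \<and>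
     (\<forall>k<n. \<forall>v. v \<in> borel_measurable (G k) \<and> bounded (range v) \<longrightarrow>
        (\<integral>\<omega>. v \<omega> * (X (Suc k) \<omega> - X k \<omega>) \<partial>M) = 0)"

context prob_space
begin

lemma integrable_bounded_mult:
  fixes v X :: "'a \<Rightarrow> real"
  assumes "v \<in> borel_measurable M" "bounded (range v)" "integrable M X"
  shows "integrable M (\<lambda>\<omega>. v \<omega> * X \<omega>)"
proof -
  obtain B where B: "\<And>\<omega>. norm (v \<omega>) \<le> B" using assms(2) by (auto simp: bounded_iff)
  have *: "norm (v \<omega> * X \<omega>) \<le> norm (B * X \<omega>)" for \<omega>
    using mult_right_mono[OF order_trans[OF B[of \<omega>] abs_ge_self[of B]], of "\<bar>X \<omega>\<bar>"]
    by (simp add: abs_mult)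
  have "(\<lambda>\<omega>. v \<omega> * X \<omega>) \<in> borel_measurable M"
    using assms by (intro borel_measurable_times borel_measurable_integrable[OF assms(3)])
  moreover have "integrable M (\<lambda>\<omega>. B * X \<omega>)" using assms by simp
  ultimately show ?thesis
    using * by (rule_tac Bochner_Integration.integrable_bound[where f="\<lambda>\<omega>. B * X \<omega>"]) auto
qed

text \<open>Burkholder's function method: the auxiliary function is a supermartingale along the transform.\<close>

lemma transform_weak_type:
  fixes X :: "nat \<Rightarrow> 'a \<Rightarrow> real"
  assumes orth: "orthogonal_increments M n G X" and X0: "\<And>\<omega>. X 0 \<omega> = 0"
    and adapt: "\<And>k. k < n \<Longrightarrow> v k \<in> borel_measurable (G k)"
      "\<And>j k. j \<le> k \<Longrightarrow> k \<le> n \<Longrightarrow> X j \<in> borel_measurable (G k)"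
    and sub: "\<And>j k. j \<le> k \<Longrightarrow> k \<le> n \<Longrightarrow> subalgebra (G k) (G j)" "\<And>k. k \<le> n \<Longrightarrow> subalgebra M (G k)"
    and v: "\<And>k \<omega>. k < n \<Longrightarrow> \<bar>v k \<omega>\<bar> \<le> 1" and "C > 0"
  shows "measure M {\<omega>\<in>space M. C \<le> \<bar>\<Sum>k<n. v k \<omega> * (X (Suc k) \<omega> - X k \<omega>)\<bar>} \<le> 2 * (\<integral>\<omega>. \<bar>X n \<omega>\<bar> \<partial>M) / C"
proof -
  define S where "S k \<omega> = (\<Sum>j<k. v j \<omega> * (X (Suc j) \<omega> - X j \<omega>))" for k \<omega>
  define U where "U k \<omega> = weak_type_fun (X k \<omega> / C) (S k \<omega> / C)" for k \<omega>
  have vk: "v j \<in> borel_measurable (G k)" if "j < k" "k \<le> n" for j k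
    using measurable_from_subalg[OF sub(1)[of j k] adapt(1)[of j]] that by auto
  have S_meas: "S k \<in> borel_measurable (G k)" if "k \<le> n" for k
    unfolding S_def using that
    by (intro borel_measurable_sum borel_measurable_times borel_measurable_diff vk adapt) auto
  have M_meas: "f \<in> borel_measurable M" if "f \<in> borel_measurable (G k)" "k \<le> n" for f :: "'a \<Rightarrow> real" and k
    using measurable_from_subalg[OF sub(2) that(1)] that(2) by auto
  have intX: "integrable M (X k)" if "k \<le> n" for k
    using orth that by (auto simp: orthogonal_increments_def)
  have intU: "integrable M (U k)" if "k \<le> n" for k
  proof (rule Bochner_Integration.integrable_bound)
    show "integrable M (\<lambda>\<omega>. 1 + 2 * \<bar>X k \<omega> / C\<bar>)" using intX[OF that] by auto
    show "U k \<in> borel_measurable M"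
      unfolding U_def using M_meas[OF adapt(2)[of k k]] M_meas[OF S_meas] that by measurable
  qed (use weak_type_fun_abs_le[of "X k _ / C" "S k _ / C"] in \<open>auto simp: U_def\<close>)
  have step: "(\<integral>\<omega>. U (Suc k) \<omega> \<partial>M) \<le> (\<integral>\<omega>. U k \<omega> \<partial>M)" if k: "k < n" for k
  proof -
    \<comment> \<open>\<open>a\<close> and \<open>b\<close> are the slopes of
      \<open>weak_type_fun_step\<close> at the rescaled point. Divided by \<open>C\<close>, and with
      \<open>v k\<close> absorbed into \<open>B\<close>, they are bounded weights known at step
      \<open>k\<close>, so orthogonality annihilates both linear terms.\<close>
    define a where "a \<omega> = (if \<bar>X k \<omega> / C\<bar> + \<bar>S k \<omega> / C\<bar> < 1 then - 2 * (X k \<omega> / C) else - 2 * sgn (X k \<omega> / C))" for \<omega>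
    define b where "b \<omega> = (if \<bar>X k \<omega> / C\<bar> + \<bar>S k \<omega> / C\<bar> < 1 then 2 * (S k \<omega> / C) else 0)" for \<omega>
    define A where "A \<omega> = a \<omega> / C" for \<omega>
    define B where "B \<omega> = b \<omega> * v k \<omega> / C" for \<omega>
    have [measurable]: "X k \<in> borel_measurable (G k)" "S k \<in> borel_measurable (G k)" "v k \<in> borel_measurable (G k)"
      using adapt(2)[of k k] S_meas[of k] adapt(1)[of k] k by simp_all
    have AB: "A \<in> borel_measurable (G k)" "B \<in> borel_measurable (G k)"
      unfolding A_def B_def a_def b_def sgn_if by measurable
    have a: "\<bar>a \<omega>\<bar> \<le> 2" for \<omega>
      by (auto simp: a_def abs_mult abs_sgn_eq simp del: abs_divide times_divide_eq_right)
    have b: "\<bar>b \<omega>\<bar> \<le> 2" for \<omega>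
      by (auto simp: b_def abs_mult simp del: abs_divide times_divide_eq_right)
    have "\<bar>A \<omega>\<bar> \<le> 2 / C" for \<omega>
      unfolding A_def using a[of \<omega>] \<open>C > 0\<close> by (simp add: divide_right_mono)
    then have A_bd: "bounded (range A)" by (auto simp: bounded_iff)
    have "\<bar>B \<omega>\<bar> \<le> 2 / C" for \<omega>
      using mult_mono[OF b[of \<omega>] v[OF k, of \<omega>]] \<open>C > 0\<close> unfolding B_def
      by (simp add: abs_mult divide_right_mono)
    then have B_bd: "bounded (range B)" by (auto simp: bounded_iff)
    let ?d = "\<lambda>\<omega>. X (Suc k) \<omega> - X k \<omega>"
    have d: "integrable M ?d" using intX k by auto
    have zero: "(\<integral>\<omega>. A \<omega> * ?d \<omega> \<partial>M) = 0" "(\<integral>\<omega>. B \<omega> * ?d \<omega> \<partial>M) = 0"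
      using orth k AB A_bd B_bd by (auto simp: orthogonal_increments_def)
    have int: "integrable M (\<lambda>\<omega>. A \<omega> * ?d \<omega>)" "integrable M (\<lambda>\<omega>. B \<omega> * ?d \<omega>)"
      using AB[THEN M_meas] A_bd B_bd d k by (simp_all add: integrable_bounded_mult)
    have "U (Suc k) \<omega> \<le> U k \<omega> + A \<omega> * ?d \<omega> + B \<omega> * ?d \<omega>" for \<omega>
    proof -
      have "\<bar>v k \<omega>\<bar> * \<bar>?d \<omega>\<bar> \<le> 1 * \<bar>?d \<omega>\<bar>" using v[OF k, of \<omega>] by (intro mult_right_mono) auto
      then have "\<bar>v k \<omega> * ?d \<omega> / C\<bar> \<le> \<bar>?d \<omega> / C\<bar>"
        using \<open>C > 0\<close> by (simp add: abs_mult divide_right_mono)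
      note W = weak_type_fun_step[OF this, of "X k \<omega> / C" "S k \<omega> / C"]
      have "X k \<omega> / C + ?d \<omega> / C = X (Suc k) \<omega> / C"
        by (simp add: diff_divide_distrib)
      moreover have "S k \<omega> / C + v k \<omega> * ?d \<omega> / C = S (Suc k) \<omega> / C"
        by (simp add: S_def add_divide_distrib)
      moreover have "A \<omega> * ?d \<omega> = a \<omega> * (?d \<omega> / C)" "B \<omega> * ?d \<omega> = b \<omega> * (v k \<omega> * ?d \<omega> / C)"
        unfolding A_def B_def by simp_all
      ultimately show ?thesis using W unfolding U_def a_def[symmetric] b_def[symmetric] by simp
    qed
    then have "(\<integral>\<omega>. U (Suc k) \<omega> \<partial>M) \<le> (\<integral>\<omega>. U k \<omega> + A \<omega> * ?d \<omega> + B \<omega> * ?d \<omega> \<partial>M)"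
      using intU k int by (intro integral_mono) auto
    also have "\<dots> = (\<integral>\<omega>. U k \<omega> \<partial>M)" using intU[of k] k int zero by simp
    finally show ?thesis .
  qed
  have "(\<integral>\<omega>. U k \<omega> \<partial>M) \<le> 0" if "k \<le> n" for k
    using that
  proof (induction k)
    case 0
    then show ?case by (simp add: U_def S_def X0 weak_type_fun_def)
  next
    case (Suc k)
    then show ?case using step[of k] by simp
  qed
  then have U_le: "(\<integral>\<omega>. U n \<omega> \<partial>M) \<le> 0" by simp
  let ?E = "{\<omega>\<in>space M. C \<le> \<bar>S n \<omega>\<bar>}"
  have [measurable]: "S n \<in> borel_measurable M" using M_meas[OF S_meas] by auto
  have E: "?E \<in> sets M" by measurable
  have "measure M ?E - 2 * (\<integral>\<omega>. \<bar>X n \<omega>\<bar> \<partial>M) / C = (\<integral>\<omega>. indicator ?E \<omega> - 2 * \<bar>X n \<omega>\<bar> / C \<partial>M)"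
    using E intX[of n] by (subst Bochner_Integration.integral_diff) (auto simp: emeasure_eq_measure)
  also have "\<dots> \<le> (\<integral>\<omega>. U n \<omega> \<partial>M)"
  proof (rule integral_mono)
    fix \<omega> assume "\<omega> \<in> space M"
    then show "indicator ?E \<omega> - 2 * \<bar>X n \<omega>\<bar> / C \<le> U n \<omega>"
      using weak_type_fun_ge[of "S n \<omega> / C" "X n \<omega> / C"] \<open>C > 0\<close> unfolding U_def
      by (auto simp: indicator_def field_simps split: if_splits)
  qed (use E intX[of n] intU[of n] in \<open>auto simp: emeasure_eq_measure\<close>)
  finally show ?thesis using U_le by (simp add: S_def)
qed

end

subsection \<open>Integrators along uniform grids\<close>

definition grid :: "real \<Rightarrow> nat \<Rightarrow> nat \<Rightarrow> real" where
  "grid t n j = t * real j / real n"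

definition incr :: "(real \<Rightarrow> 'a \<Rightarrow> 'b::ab_group_add) \<Rightarrow> real \<Rightarrow> nat \<Rightarrow> nat \<Rightarrow> 'a \<Rightarrow> 'b" where
  "incr X t n j \<omega> = X (grid t n (Suc j)) \<omega> - X (grid t n j) \<omega>"

lemma grid_0 [simp]: "grid t n 0 = 0"
  by (simp add: grid_def)

lemma grid_n [simp]: "0 < n \<Longrightarrow> grid t n n = t"
  by (simp add: grid_def)

lemma grid_nonneg: "0 \<le> t \<Longrightarrow> 0 \<le> grid t n j"
  by (simp add: grid_def)

lemma grid_mono: "0 \<le> t \<Longrightarrow> i \<le> j \<Longrightarrow> grid t n i \<le> grid t n j"
  by (simp add: grid_def divide_right_mono mult_left_mono)

lemma grid_le: "0 \<le> t \<Longrightarrow> j \<le> n \<Longrightarrow> grid t n j \<le> t"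
  using grid_mono[of t j n n] by (cases "n = 0") (auto simp: grid_def)

lemma grid_Suc_diff: "grid t n (Suc j) - grid t n j = t / n"
  by (simp add: grid_def diff_divide_distrib[symmetric] algebra_simps)

lemma dense_Rats_interval: "(0::real) < t \<Longrightarrow> closure ({0<..<t} \<inter> \<rat>) = {0..t}"
proof -
  assume "0 < t"
  then have "{0<..<t} \<subseteq> closure ({0<..<t} \<inter> \<rat>)"
    using open_Int_closure_subset[of "{0<..<t}" "\<rat>"] by (simp add: Rats_closure_real)
  then have "closure {0<..<t} \<subseteq> closure ({0<..<t} \<inter> \<rat>)"
    by (simp add: closure_minimal)
  moreover have "closure ({0<..<t} \<inter> \<rat>) \<subseteq> closure {0<..<t}"
    by (intro closure_mono) auto
  ultimately show ?thesis using \<open>0 < t\<close> by simp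
qed

text \<open>The condition |s - s'| < d is open, so sequences from \<open>D\<close> that approach
  \<open>s\<close> and \<open>s'\<close> satisfy it eventually, and the closed bound survives the
  limit.\<close>

lemma modulus_from_dense:
  fixes f :: "real \<Rightarrow> 'b::real_normed_vector"
  assumes cont: "continuous_on {0..t} f" and D: "closure D = {0..t}"
    and le: "\<And>s s'. s \<in> D \<Longrightarrow> s' \<in> D \<Longrightarrow> \<bar>s - s'\<bar> < d \<Longrightarrow> norm (f s - f s') \<le> e"
    and s: "s \<in> {0..t}" "s' \<in> {0..t}" "\<bar>s - s'\<bar> < d"
  shows "norm (f s - f s') \<le> e"
proof -
  obtain a b where a: "\<And>n. a n \<in> D" "a \<longlonglongrightarrow> s" and b: "\<And>n. b n \<in> D" "b \<longlonglongrightarrow> s'"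
    using s D by (metis closure_sequential)
  have ab: "a n \<in> {0..t}" "b n \<in> {0..t}" for n
    using a(1)[of n] b(1)[of n] D closure_subset[of D] by blast+
  have "(\<lambda>n. f (a n)) \<longlonglongrightarrow> f s" "(\<lambda>n. f (b n)) \<longlonglongrightarrow> f s'"
    using cont s a b ab by (auto simp: continuous_on_sequentially o_def)
  then have "(\<lambda>n. norm (f (a n) - f (b n))) \<longlonglongrightarrow> norm (f s - f s')"
    by (intro tendsto_intros)
  moreover have "(\<lambda>n. \<bar>a n - b n\<bar>) \<longlonglongrightarrow> \<bar>s - s'\<bar>"
    using a b by (intro tendsto_intros)
  then have "eventually (\<lambda>n. \<bar>a n - b n\<bar> < d) sequentially"
    using s(3) by (rule order_tendstoD)
  then have "eventually (\<lambda>n. norm (f (a n) - f (b n)) \<le> e) sequentially"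
    by eventually_elim (use a b le in auto)
  ultimately show ?thesis
    by (rule tendsto_upperbound) simp
qed

section \<open>Filtered spaces and path properties of continuous adapted processes\<close>

locale filtered_space = prob_space M for M :: "'a measure" +
  fixes F :: "real \<Rightarrow> 'a measure"
  assumes filtered: "filtered_prob_space M F"
begin

lemma subalgebra_F: "subalgebra M (F t)"
  using filtered by (auto simp: filtered_prob_space_def)

lemma subalgebra_mono: "s \<le> t \<Longrightarrow> subalgebra (F t) (F s)"
  using filtered by (auto simp: filtered_prob_space_def filtration_def subalgebra_def)

lemma measurable_F_mono: "f \<in> measurable (F s) N \<Longrightarrow> s \<le> t \<Longrightarrow> f \<in> measurable (F t) N"
  using measurable_from_subalg[OF subalgebra_mono] by blast

lemma measurable_F_M: "f \<in> measurable (F s) N \<Longrightarrow> f \<in> measurable M N"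
  using measurable_from_subalg[OF subalgebra_F] by blast

lemma adapted_measurable: "continuous_adapted M F X \<Longrightarrow> 0 \<le> s \<Longrightarrow> s \<le> t \<Longrightarrow> X s \<in> borel_measurable (F t)"
  unfolding continuous_adapted_def using measurable_F_mono by blast

lemma adapted_rv: "continuous_adapted M F X \<Longrightarrow> 0 \<le> s \<Longrightarrow> X s \<in> borel_measurable M"
  using adapted_measurable[of X s s] measurable_F_M by blast

text \<open>Every continuous path has a random modulus on a compact interval; outside a small event
  it may be taken deterministic. Restricting to rational times makes the events measurable, and
  continuity restores all times.\<close>

lemma whp_modulus:
  fixes X :: "real \<Rightarrow> 'a \<Rightarrow> 'b::{real_normed_vector, second_countable_topology}"
  assumes X: "continuous_adapted M F X" and "0 < t" "0 < e" "0 < r"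
  shows "\<exists>d>0. whp r (\<lambda>\<omega>. \<forall>s\<in>{0..t}. \<forall>s'\<in>{0..t}. \<bar>s - s'\<bar> < d \<longrightarrow> norm (X s \<omega> - X s' \<omega>) \<le> e)"
proof -
  define D where "D = {0<..<t} \<inter> \<rat>"
  have D: "countable D" "closure D = {0..t}"
    unfolding D_def using dense_Rats_interval[OF \<open>0 < t\<close>] by (auto intro: countable_subset[OF _ countable_rat])
  define P where "P n \<omega> \<longleftrightarrow> (\<forall>s\<in>D. \<forall>s'\<in>D. \<bar>s - s'\<bar> < 1 / real (Suc n) \<longrightarrow> norm (X s \<omega> - X s' \<omega>) \<le> e)"
    for n :: nat and \<omega>
  have cont: "AE \<omega> in M. continuous_on {0..} (\<lambda>t. X t \<omega>)"
    using X by (auto simp: continuous_adapted_def)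
  have "\<exists>n. whp (r/2) (P n)"
  proof (rule whp_eventually)
    fix n
    have [measurable]: "X s \<in> borel_measurable M" if "s \<in> D" for s
      using that by (intro adapted_rv[OF X]) (auto simp: D_def)
    have *: "{\<omega>\<in>space M. P n \<omega>} = {\<omega>\<in>space M. \<forall>s\<in>D. \<forall>s'\<in>D. \<bar>s - s'\<bar> < 1 / real (Suc n) \<longrightarrow> norm (X s \<omega> - X s' \<omega>) \<le> e}"
      by (simp add: P_def)
    show "{\<omega>\<in>space M. P n \<omega>} \<in> sets M"
      unfolding * using D(1) by (intro sets.sets_Collect_countable_All') measurable
  next
    fix m n \<omega> assume "m \<le> n" "P m \<omega>"
    moreover have "1 / real (Suc n) \<le> 1 / real (Suc m)" using \<open>m \<le> n\<close> by (simp add: frac_le)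
    ultimately show "P n \<omega>" unfolding P_def by (meson order_less_le_trans)
  next
    show "AE \<omega> in M. \<exists>n. P n \<omega>"
      using cont
    proof eventually_elim
      case (elim \<omega>)
      then have "uniformly_continuous_on {0..t} (\<lambda>t. X t \<omega>)"
        by (intro compact_uniformly_continuous) (auto intro: continuous_on_subset)
      then obtain d where d: "d > 0" "\<And>s s'. s \<in> {0..t} \<Longrightarrow> s' \<in> {0..t} \<Longrightarrow> \<bar>s - s'\<bar> < d \<Longrightarrow> norm (X s \<omega> - X s' \<omega>) < e"
        using \<open>0 < e\<close> unfolding uniformly_continuous_on_def dist_norm real_norm_def by metis
      obtain n where n: "1 / real (Suc n) < d" using nat_approx_posE[OF d(1)] by auto
      have "P n \<omega>"
        unfolding P_def
      proof (intro ballI impI)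
        fix s s' assume "s \<in> D" "s' \<in> D" "\<bar>s - s'\<bar> < 1 / real (Suc n)"
        then show "norm (X s \<omega> - X s' \<omega>) \<le> e"
          using d(2)[of s s'] n by (auto simp: D_def intro: less_imp_le)
      qed
      then show ?case by blast
    qed
  qed (use \<open>0 < r\<close> in auto)
  then obtain n where n: "whp (r/2) (P n)" by blast
  have "whp r (\<lambda>\<omega>. P n \<omega> \<and> continuous_on {0..} (\<lambda>t. X t \<omega>))"
    using n AE_imp_whp[OF cont, of "r/2"] \<open>0 < r\<close> by (intro whp_conj') auto
  then have "whp r (\<lambda>\<omega>. \<forall>s\<in>{0..t}. \<forall>s'\<in>{0..t}. \<bar>s - s'\<bar> < 1 / real (Suc n) \<longrightarrow> norm (X s \<omega> - X s' \<omega>) \<le> e)"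
  proof (rule whp_mono)
    fix \<omega> assume *: "P n \<omega> \<and> continuous_on {0..} (\<lambda>t. X t \<omega>)"
    then have "continuous_on {0..t} (\<lambda>t. X t \<omega>)" by (auto intro: continuous_on_subset)
    from modulus_from_dense[OF this D(2), of "1 / real (Suc n)" e] *
    show "\<forall>s\<in>{0..t}. \<forall>s'\<in>{0..t}. \<bar>s - s'\<bar> < 1 / real (Suc n) \<longrightarrow> norm (X s \<omega> - X s' \<omega>) \<le> e"
      unfolding P_def by blast
  qed simp
  then show ?thesis by (intro exI[of _ "1 / real (Suc n)"]) auto
qed

lemma whp_bounded:
  fixes X :: "real \<Rightarrow> 'a \<Rightarrow> 'b::{real_normed_vector, second_countable_topology}"
  assumes X: "continuous_adapted M F X" and "0 < t" "0 < r"
  shows "\<exists>L>0. whp r (\<lambda>\<omega>. \<forall>s\<in>{0..t}. norm (X s \<omega>) \<le> L)"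
proof -
  define D where "D = {0<..<t} \<inter> \<rat>"
  have D: "countable D" "closure D = {0..t}"
    unfolding D_def using dense_Rats_interval[OF \<open>0 < t\<close>] by (auto intro: countable_subset[OF _ countable_rat])
  define P where "P n \<omega> \<longleftrightarrow> (\<forall>s\<in>D. norm (X s \<omega>) \<le> real n)" for n :: nat and \<omega>
  have cont: "AE \<omega> in M. continuous_on {0..} (\<lambda>t. X t \<omega>)"
    using X by (auto simp: continuous_adapted_def)
  have "\<exists>n. whp (r/2) (P n)"
  proof (rule whp_eventually)
    fix n
    have [measurable]: "X s \<in> borel_measurable M" if "s \<in> D" for s
      using that by (intro adapted_rv[OF X]) (auto simp: D_def)
    show "{\<omega>\<in>space M. P n \<omega>} \<in> sets M"
      unfolding P_def using D(1) by (intro sets.sets_Collect_countable_All') measurable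
  next
    fix m n \<omega> assume "m \<le> n" "P m \<omega>"
    then show "P n \<omega>" unfolding P_def by (meson of_nat_mono order_trans)
  next
    show "AE \<omega> in M. \<exists>n. P n \<omega>"
      using cont
    proof eventually_elim
      case (elim \<omega>)
      then have "compact ((\<lambda>t. X t \<omega>) ` {0..t})"
        by (intro compact_continuous_image) (auto intro: continuous_on_subset)
      then obtain B where B: "\<And>s. s \<in> {0..t} \<Longrightarrow> norm (X s \<omega>) \<le> B"
        by (force dest!: compact_imp_bounded simp: bounded_iff)
      obtain n where "B \<le> real n" using real_arch_simple by blast
      have "P n \<omega>"
        unfolding P_def
      proof
        fix s assume "s \<in> D"
        then show "norm (X s \<omega>) \<le> real n" using B[of s] \<open>B \<le> real n\<close> by (auto simp: D_def)
      qed
      then show ?case by blast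
    qed
  qed (use \<open>0 < r\<close> in auto)
  then obtain n where n: "whp (r/2) (P n)" by blast
  have "whp r (\<lambda>\<omega>. P n \<omega> \<and> continuous_on {0..} (\<lambda>t. X t \<omega>))"
    using n AE_imp_whp[OF cont, of "r/2"] \<open>0 < r\<close> by (intro whp_conj') auto
  then have "whp r (\<lambda>\<omega>. \<forall>s\<in>{0..t}. norm (X s \<omega>) \<le> real (Suc n))"
  proof (rule whp_mono)
    fix \<omega> assume *: "P n \<omega> \<and> continuous_on {0..} (\<lambda>t. X t \<omega>)"
    then have "continuous_on (closure D) (\<lambda>t. X t \<omega>)" using D by (auto intro: continuous_on_subset)
    then have "(\<lambda>t. X t \<omega>) ` closure D \<subseteq> cball 0 (real n)"
      by (rule image_closure_subset) (use * in \<open>auto simp: P_def\<close>)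
    then show "\<forall>s\<in>{0..t}. norm (X s \<omega>) \<le> real (Suc n)" using D by force
  qed simp
  then show ?thesis by (intro exI[of _ "real (Suc n)"]) auto
qed

text \<open>The notion of a good integrator of Bichteler and Dellacherie, restricted to uniform
  grids: sums with adapted integrands bounded by 1 are bounded in probability, uniformly in grid and
  integrand. It holds for local martingales and for finite variation processes and is stable under
  sums, and through it the semimartingale decomposition of the solution enters the
  estimates.\<close>

definition good :: "(real \<Rightarrow> 'a \<Rightarrow> real) \<Rightarrow> real \<Rightarrow> bool" where
  "good X t \<longleftrightarrow> (\<forall>r>0. \<exists>C>0. \<forall>n>0. \<forall>v.
     (\<forall>j<n. v j \<in> borel_measurable (F (grid t n j)) \<and> (\<forall>\<omega>. \<bar>v j \<omega>\<bar> \<le> 1)) \<longrightarrow>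
     whp r (\<lambda>\<omega>. \<bar>\<Sum>j<n. v j \<omega> * incr X t n j \<omega>\<bar> \<le> C))"

lemma goodI:
  assumes "\<And>r. r > 0 \<Longrightarrow> \<exists>C>0. \<forall>n>0. \<forall>v.
     (\<forall>j<n. v j \<in> borel_measurable (F (grid t n j)) \<and> (\<forall>\<omega>. \<bar>v j \<omega>\<bar> \<le> 1)) \<longrightarrow>
     whp r (\<lambda>\<omega>. \<bar>\<Sum>j<n. v j \<omega> * incr X t n j \<omega>\<bar> \<le> C)"
  shows "good X t"
  using assms by (simp add: good_def)

lemma goodE:
  assumes "good X t" "0 < r"
  obtains C where "C > 0" "\<And>n v. n > 0 \<Longrightarrow>
      (\<forall>j<n. v j \<in> borel_measurable (F (grid t n j)) \<and> (\<forall>\<omega>. \<bar>v j \<omega>\<bar> \<le> 1)) \<Longrightarrow>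
      whp r (\<lambda>\<omega>. \<bar>\<Sum>j<n. v j \<omega> * incr X t n j \<omega>\<bar> \<le> C)"
  using assms(1)[unfolded good_def, rule_format, OF assms(2)] by auto

text \<open>The weak-type inequality bounds the transform by the mean of |X t - X 0|, a quantity
  that no longer depends on the grid.\<close>

lemma good_orthogonal:
  fixes X :: "real \<Rightarrow> 'a \<Rightarrow> real"
  assumes "0 \<le> t" and adapt: "\<And>s. 0 \<le> s \<Longrightarrow> s \<le> t \<Longrightarrow> X s \<in> borel_measurable (F s)"
    and int: "\<And>s. 0 \<le> s \<Longrightarrow> s \<le> t \<Longrightarrow> integrable M (X s)"
    and orth: "\<And>s u (v :: 'a \<Rightarrow> real). 0 \<le> s \<Longrightarrow> s \<le> u \<Longrightarrow> u \<le> t \<Longrightarrow> v \<in> borel_measurable (F s) \<Longrightarrow> bounded (range v) \<Longrightarrow>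
        (\<integral>\<omega>. v \<omega> * (X u \<omega> - X s \<omega>) \<partial>M) = 0"
  shows "good X t"
proof (rule goodI)
  fix r :: real assume "r > 0"
  define E where "E = (\<integral>\<omega>. \<bar>X t \<omega> - X 0 \<omega>\<bar> \<partial>M)"
  have "E \<ge> 0" unfolding E_def by simp
  \<comment> \<open>The summand 1 keeps \<open>C\<close> positive when \<open>E\<close> is
    0.\<close>
  define C where "C = 2 * (E + 1) / r"
  have "C > 0" using \<open>E \<ge> 0\<close> \<open>r > 0\<close> by (simp add: C_def)
  have EC: "2 * E / C \<le> r" using \<open>E \<ge> 0\<close> \<open>r > 0\<close> \<open>C > 0\<close> by (simp add: C_def field_simps)
  show "\<exists>C>0. \<forall>n>0. \<forall>v. (\<forall>j<n. v j \<in> borel_measurable (F (grid t n j)) \<and> (\<forall>\<omega>. \<bar>v j \<omega>\<bar> \<le> 1)) \<longrightarrow>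
     whp r (\<lambda>\<omega>. \<bar>\<Sum>j<n. v j \<omega> * incr X t n j \<omega>\<bar> \<le> C)"
  proof (intro exI conjI allI impI)
    fix n :: nat and v :: "nat \<Rightarrow> 'a \<Rightarrow> real"
    assume "0 < n" and v: "\<forall>j<n. v j \<in> borel_measurable (F (grid t n j)) \<and> (\<forall>\<omega>. \<bar>v j \<omega>\<bar> \<le> 1)"
    define Y where "Y k \<omega> = X (grid t n k) \<omega> - X 0 \<omega>" for k \<omega>
    let ?G = "\<lambda>k. F (grid t n k)"
    have g: "0 \<le> grid t n k" "k \<le> n \<Longrightarrow> grid t n k \<le> t" for k
      using \<open>0 \<le> t\<close> by (auto simp: grid_nonneg grid_le)
    have X0: "X s \<in> borel_measurable (F u)" if "0 \<le> s" "s \<le> u" "u \<le> t" for s u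
      using measurable_F_mono[OF adapt] that by auto
    have Yd: "Y (Suc k) \<omega> - Y k \<omega> = incr X t n k \<omega>" for k \<omega>
      by (simp add: Y_def incr_def)
    have Y: "Y j \<in> borel_measurable (?G k)" if "j \<le> k" "k \<le> n" for j k
      unfolding Y_def using that g[of j] g[of k] \<open>0 \<le> t\<close> grid_mono[of t j k n]
      by (intro borel_measurable_diff X0) auto
    have "orthogonal_increments M n ?G Y"
      unfolding orthogonal_increments_def Yd
    proof (intro conjI allI impI)
      fix k assume "k \<le> n" then show "integrable M (Y k)"
        unfolding Y_def using g[of k] \<open>0 \<le> t\<close> by (intro Bochner_Integration.integrable_diff int) auto
    next
      fix k and v :: "'a \<Rightarrow> real" assume "k < n" "v \<in> borel_measurable (?G k) \<and> bounded (range v)"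
      then show "(\<integral>\<omega>. v \<omega> * incr X t n k \<omega> \<partial>M) = 0"
        unfolding incr_def using g[of k] g[of "Suc k"] grid_mono[of t k "Suc k" n] \<open>0 \<le> t\<close>
        by (intro orth) auto
    qed
    then have "measure M {\<omega>\<in>space M. C \<le> \<bar>\<Sum>k<n. v k \<omega> * (Y (Suc k) \<omega> - Y k \<omega>)\<bar>} \<le> 2 * (\<integral>\<omega>. \<bar>Y n \<omega>\<bar> \<partial>M) / C"
    proof (rule transform_weak_type)
      show "subalgebra (?G k) (?G j)" if "j \<le> k" for j k
        using that \<open>0 \<le> t\<close> by (intro subalgebra_mono grid_mono)
    qed (use v Y \<open>C > 0\<close> subalgebra_F in \<open>auto simp: Y_def\<close>)
    also have "\<dots> \<le> r" using EC \<open>0 < n\<close> by (simp add: Y_def E_def)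
    finally have le: "measure M {\<omega>\<in>space M. C \<le> \<bar>\<Sum>k<n. v k \<omega> * incr X t n k \<omega>\<bar>} \<le> r" by (simp add: Yd)
    show "whp r (\<lambda>\<omega>. \<bar>\<Sum>j<n. v j \<omega> * incr X t n j \<omega>\<bar> \<le> C)"
    proof (rule whpI[OF _ le])
      have [measurable]: "incr X t n j \<in> borel_measurable M" if "j < n" for j
        unfolding incr_def using that g[of j] g[of "Suc j"] adapt[THEN measurable_F_M] by auto
      have [measurable]: "v j \<in> borel_measurable M" if "j < n" for j
        using v that measurable_F_M by blast
      show "{\<omega>\<in>space M. C \<le> \<bar>\<Sum>k<n. v k \<omega> * incr X t n k \<omega>\<bar>} \<in> sets M"
        by measurable
    qed auto
  qed fact
qed

lemma martingale_orthogonal: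
  fixes X :: "real \<Rightarrow> 'a \<Rightarrow> real" and v :: "'a \<Rightarrow> real"
  assumes X: "martingale M F X" and "0 \<le> s" "s \<le> u" "v \<in> borel_measurable (F s)" "bounded (range v)"
  shows "(\<integral>\<omega>. v \<omega> * (X u \<omega> - X s \<omega>) \<partial>M) = 0"
proof -
  interpret finite_measure_subalgebra M "F s"
    by unfold_locales (rule subalgebra_F)
  have int: "integrable M (X s)" "integrable M (X u)"
    using assms by (auto simp: martingale_def)
  then have [measurable]: "X u \<in> borel_measurable M" by (rule_tac borel_measurable_integrable)
  have cond: "AE \<omega> in M. real_cond_exp M (F s) (X u) \<omega> = X s \<omega>"
    using assms by (auto simp: martingale_def)
  have [measurable]: "v \<in> borel_measurable M" using assms measurable_F_M by blast
  have iv: "integrable M (\<lambda>\<omega>. v \<omega> * X u \<omega>)" "integrable M (\<lambda>\<omega>. v \<omega> * X s \<omega>)"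
    using assms int by (auto intro!: integrable_bounded_mult)
  have "(\<integral>\<omega>. v \<omega> * X u \<omega> \<partial>M) = (\<integral>\<omega>. v \<omega> * real_cond_exp M (F s) (X u) \<omega> \<partial>M)"
    using real_cond_exp_intg(2)[OF iv(1)] assms by simp
  also have "\<dots> = (\<integral>\<omega>. v \<omega> * X s \<omega> \<partial>M)"
    using cond int(1) by (intro integral_cong_AE) (auto simp: borel_measurable_integrable)
  finally show ?thesis using iv by (simp add: right_diff_distrib)
qed

text \<open>On the event that some localizing time exceeds \<open>t\<close>, the stopped and the
  original process have the same increments on [0, t]; the stopped one is a martingale.\<close>

lemma good_local_martingale:
  assumes N: "continuous_local_martingale M F N" and "0 \<le> t"
  shows "good N t"
proof (rule goodI)
  fix r :: real assume "r > 0"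
  obtain T where T: "\<And>n. stopping_time F (T n)" "\<And>n \<omega>. \<omega> \<in> space M \<Longrightarrow> 0 \<le> T n \<omega>"
    and lim: "AE \<omega> in M. incseq (\<lambda>n. T n \<omega>) \<and> filterlim (\<lambda>n. T n \<omega>) at_top sequentially"
    and mart: "\<And>n. martingale M F (\<lambda>t \<omega>. N (min t (T n \<omega>)) \<omega> - N 0 \<omega>)"
    using N unfolding continuous_local_martingale_def by blast
  \<comment> \<open>Quantifying over all later indices makes the property monotone in
    \<open>n\<close> for every \<omega>, although the localizing times increase only almost
    surely.\<close>
  have "\<exists>n. whp (r/2) (\<lambda>\<omega>. \<forall>i\<ge>n. t < T i \<omega>)"
  proof (rule whp_eventually)
    fix n
    have "Measurable.pred (F t) (\<lambda>\<omega>. T i \<omega> \<le> t)" for i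
      using T(1) by (simp add: stopping_time_def)
    then have [measurable]: "Measurable.pred M (\<lambda>\<omega>. T i \<omega> \<le> t)" for i
      using measurable_F_M by blast
    show "{\<omega>\<in>space M. \<forall>i\<ge>n. t < T i \<omega>} \<in> sets M"
      unfolding not_le[symmetric] by measurable
  next
    show "AE \<omega> in M. \<exists>n. \<forall>i\<ge>n. t < T i \<omega>"
      using lim by eventually_elim (auto simp: filterlim_at_top_dense eventually_sequentially)
  qed (use \<open>r > 0\<close> in auto)
  then obtain m where m: "whp (r/2) (\<lambda>\<omega>. \<forall>i\<ge>m. t < T i \<omega>)" by blast
  define X where "X s \<omega> = N (min s (T m \<omega>)) \<omega> - N 0 \<omega>" for s \<omega>
  have X: "martingale M F X" unfolding X_def by (rule mart)
  have X_good: "good X t"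
    using \<open>0 \<le> t\<close> X by (intro good_orthogonal martingale_orthogonal[OF X]) (auto simp: martingale_def)
  obtain C where "C > 0" and C: "\<And>n v. n > 0 \<Longrightarrow>
      (\<forall>j<n. v j \<in> borel_measurable (F (grid t n j)) \<and> (\<forall>\<omega>. \<bar>v j \<omega>\<bar> \<le> 1)) \<Longrightarrow>
      whp (r/2) (\<lambda>\<omega>. \<bar>\<Sum>j<n. v j \<omega> * incr X t n j \<omega>\<bar> \<le> C)"
    by (rule goodE[OF X_good half_gt_zero[OF \<open>r > 0\<close>]]) (rule that)
  show "\<exists>C>0. \<forall>n>0. \<forall>v. (\<forall>j<n. v j \<in> borel_measurable (F (grid t n j)) \<and> (\<forall>\<omega>. \<bar>v j \<omega>\<bar> \<le> 1)) \<longrightarrow>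
     whp r (\<lambda>\<omega>. \<bar>\<Sum>j<n. v j \<omega> * incr N t n j \<omega>\<bar> \<le> C)"
  proof (intro exI[of _ C] conjI allI impI)
    fix n :: nat and v :: "nat \<Rightarrow> 'a \<Rightarrow> real"
    assume "0 < n" and v: "\<forall>j<n. v j \<in> borel_measurable (F (grid t n j)) \<and> (\<forall>\<omega>. \<bar>v j \<omega>\<bar> \<le> 1)"
    have "whp r (\<lambda>\<omega>. (\<forall>i\<ge>m. t < T i \<omega>) \<and> \<bar>\<Sum>j<n. v j \<omega> * incr X t n j \<omega>\<bar> \<le> C)"
      using whp_conj[OF m C[OF \<open>0 < n\<close> v]] by simp
    then show "whp r (\<lambda>\<omega>. \<bar>\<Sum>j<n. v j \<omega> * incr N t n j \<omega>\<bar> \<le> C)"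
    proof (rule whp_mono)
      fix \<omega> assume *: "(\<forall>i\<ge>m. t < T i \<omega>) \<and> \<bar>\<Sum>j<n. v j \<omega> * incr X t n j \<omega>\<bar> \<le> C"
      have "incr X t n j \<omega> = incr N t n j \<omega>" if "j < n" for j
      proof -
        have "t < T m \<omega>" using * by simp
        moreover have "grid t n j \<le> t" "grid t n (Suc j) \<le> t" using that \<open>0 \<le> t\<close> by (auto intro: grid_le)
        ultimately show ?thesis by (simp add: incr_def X_def min_def)
      qed
      then show "\<bar>\<Sum>j<n. v j \<omega> * incr N t n j \<omega>\<bar> \<le> C" using * by simp
    qed simp
  qed fact
qed

lemma subdivision_grid: "0 \<le> t \<Longrightarrow> 0 < n \<Longrightarrow> subdivision t n (grid t n)"
  by (auto simp: subdivision_def intro: grid_mono)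

lemma good_finite_variation:
  assumes A: "continuous_finite_variation M F A" and "0 \<le> t"
  shows "good A t"
proof (rule goodI)
  fix r :: real assume "r > 0"
  have adapt: "continuous_adapted M F A"
    and fv: "AE \<omega> in M. \<forall>t\<ge>0. \<exists>C. \<forall>n p. subdivision t n p \<longrightarrow> (\<Sum>i<n. \<bar>A (p (Suc i)) \<omega> - A (p i) \<omega>\<bar>) \<le> C"
    using A by (auto simp: continuous_finite_variation_def)
  have "\<exists>m. whp r (\<lambda>\<omega>. \<forall>n>0. (\<Sum>j<n. \<bar>incr A t n j \<omega>\<bar>) \<le> real m)"
  proof (rule whp_eventually)
    fix m
    have [measurable]: "incr A t n j \<in> borel_measurable M" for n j
      unfolding incr_def using \<open>0 \<le> t\<close>
      by (intro borel_measurable_diff measurable_F_M[OF adapted_measurable[OF adapt _ order_refl]] grid_nonneg)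
    show "{\<omega>\<in>space M. \<forall>n>0. (\<Sum>j<n. \<bar>incr A t n j \<omega>\<bar>) \<le> real m} \<in> sets M"
      by measurable
  next
    show "AE \<omega> in M. \<exists>m. \<forall>n>0. (\<Sum>j<n. \<bar>incr A t n j \<omega>\<bar>) \<le> real m"
      using fv
    proof eventually_elim
      case (elim \<omega>)
      then obtain C where C: "\<And>n p. subdivision t n p \<Longrightarrow> (\<Sum>i<n. \<bar>A (p (Suc i)) \<omega> - A (p i) \<omega>\<bar>) \<le> C"
        using \<open>0 \<le> t\<close> by blast
      obtain m where "C \<le> real m" using real_arch_simple by blast
      then have "\<forall>n>0. (\<Sum>j<n. \<bar>incr A t n j \<omega>\<bar>) \<le> real m"
        using C[OF subdivision_grid[OF \<open>0 \<le> t\<close>]] by (auto simp: incr_def intro: order_trans)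
      then show ?case by blast
    qed
  next
    fix m n :: nat and \<omega> assume "m \<le> n" "\<forall>k>0. (\<Sum>j<k. \<bar>incr A t k j \<omega>\<bar>) \<le> real m"
    then show "\<forall>k>0. (\<Sum>j<k. \<bar>incr A t k j \<omega>\<bar>) \<le> real n"
      by (meson of_nat_mono order_trans)
  qed (use \<open>r > 0\<close> in auto)
  then obtain m where m: "whp r (\<lambda>\<omega>. \<forall>n>0. (\<Sum>j<n. \<bar>incr A t n j \<omega>\<bar>) \<le> real m)" by blast
  show "\<exists>C>0. \<forall>n>0. \<forall>v. (\<forall>j<n. v j \<in> borel_measurable (F (grid t n j)) \<and> (\<forall>\<omega>. \<bar>v j \<omega>\<bar> \<le> 1)) \<longrightarrow>
     whp r (\<lambda>\<omega>. \<bar>\<Sum>j<n. v j \<omega> * incr A t n j \<omega>\<bar> \<le> C)"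
  proof (intro exI[of _ "real m + 1"] conjI allI impI)
    fix n :: nat and v :: "nat \<Rightarrow> 'a \<Rightarrow> real"
    assume "0 < n" and v: "\<forall>j<n. v j \<in> borel_measurable (F (grid t n j)) \<and> (\<forall>\<omega>. \<bar>v j \<omega>\<bar> \<le> 1)"
    show "whp r (\<lambda>\<omega>. \<bar>\<Sum>j<n. v j \<omega> * incr A t n j \<omega>\<bar> \<le> real m + 1)"
    proof (rule whp_mono[OF m order_refl])
      fix \<omega> assume *: "\<forall>n>0. (\<Sum>j<n. \<bar>incr A t n j \<omega>\<bar>) \<le> real m"
      have "\<bar>\<Sum>j<n. v j \<omega> * incr A t n j \<omega>\<bar> \<le> (\<Sum>j<n. \<bar>v j \<omega>\<bar> * \<bar>incr A t n j \<omega>\<bar>)"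
        unfolding abs_mult[symmetric] by (rule sum_abs)
      also have "\<dots> \<le> (\<Sum>j<n. 1 * \<bar>incr A t n j \<omega>\<bar>)"
        using v by (intro sum_mono mult_right_mono) auto
      also have "\<dots> \<le> real m" using * \<open>0 < n\<close> by simp
      finally show "\<bar>\<Sum>j<n. v j \<omega> * incr A t n j \<omega>\<bar> \<le> real m + 1" by simp
    qed
  qed simp
qed

lemma good_add:
  assumes "good N t" "good A t" and eq: "AE \<omega> in M. \<forall>t\<ge>0. X t \<omega> = N t \<omega> + A t \<omega>" and "0 \<le> t"
  shows "good X t"
proof (rule goodI)
  fix r :: real assume "r > 0"
  obtain C where "C > 0" and C: "\<And>n v. n > 0 \<Longrightarrow>
      (\<forall>j<n. v j \<in> borel_measurable (F (grid t n j)) \<and> (\<forall>\<omega>. \<bar>v j \<omega>\<bar> \<le> 1)) \<Longrightarrow>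
      whp (r/2) (\<lambda>\<omega>. \<bar>\<Sum>j<n. v j \<omega> * incr N t n j \<omega>\<bar> \<le> C)"
    by (rule goodE[OF assms(1) half_gt_zero[OF \<open>r > 0\<close>]]) (rule that)
  obtain D where "D > 0" and D: "\<And>n v. n > 0 \<Longrightarrow>
      (\<forall>j<n. v j \<in> borel_measurable (F (grid t n j)) \<and> (\<forall>\<omega>. \<bar>v j \<omega>\<bar> \<le> 1)) \<Longrightarrow>
      whp (r/2) (\<lambda>\<omega>. \<bar>\<Sum>j<n. v j \<omega> * incr A t n j \<omega>\<bar> \<le> D)"
    by (rule goodE[OF assms(2) half_gt_zero[OF \<open>r > 0\<close>]]) (rule that)
  show "\<exists>C>0. \<forall>n>0. \<forall>v. (\<forall>j<n. v j \<in> borel_measurable (F (grid t n j)) \<and> (\<forall>\<omega>. \<bar>v j \<omega>\<bar> \<le> 1)) \<longrightarrow>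
     whp r (\<lambda>\<omega>. \<bar>\<Sum>j<n. v j \<omega> * incr X t n j \<omega>\<bar> \<le> C)"
  proof (intro exI[of _ "C + D"] conjI allI impI)
    fix n :: nat and v :: "nat \<Rightarrow> 'a \<Rightarrow> real"
    assume "0 < n" and v: "\<forall>j<n. v j \<in> borel_measurable (F (grid t n j)) \<and> (\<forall>\<omega>. \<bar>v j \<omega>\<bar> \<le> 1)"
    have "whp r (\<lambda>\<omega>. (\<bar>\<Sum>j<n. v j \<omega> * incr N t n j \<omega>\<bar> \<le> C \<and> \<bar>\<Sum>j<n. v j \<omega> * incr A t n j \<omega>\<bar> \<le> D)
        \<and> (\<forall>t\<ge>0. X t \<omega> = N t \<omega> + A t \<omega>))"
      using whp_conj[OF whp_conj[OF C[OF \<open>0 < n\<close> v] D[OF \<open>0 < n\<close> v]] AE_imp_whp[OF eq order_refl]] by simp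
    then show "whp r (\<lambda>\<omega>. \<bar>\<Sum>j<n. v j \<omega> * incr X t n j \<omega>\<bar> \<le> C + D)"
    proof (rule whp_mono)
      fix \<omega> assume *: "(\<bar>\<Sum>j<n. v j \<omega> * incr N t n j \<omega>\<bar> \<le> C \<and> \<bar>\<Sum>j<n. v j \<omega> * incr A t n j \<omega>\<bar> \<le> D)
        \<and> (\<forall>t\<ge>0. X t \<omega> = N t \<omega> + A t \<omega>)"
      then have "(\<Sum>j<n. v j \<omega> * incr X t n j \<omega>) = (\<Sum>j<n. v j \<omega> * incr N t n j \<omega>) + (\<Sum>j<n. v j \<omega> * incr A t n j \<omega>)"
        using \<open>0 \<le> t\<close> by (simp add: incr_def grid_nonneg sum.distrib[symmetric] algebra_simps)
      then show "\<bar>\<Sum>j<n. v j \<omega> * incr X t n j \<omega>\<bar> \<le> C + D" using * by linarith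
    qed simp
  qed (use \<open>C > 0\<close> \<open>D > 0\<close> in auto)
qed

lemma good_semimartingale:
  assumes "real_semimartingale M F X" "0 \<le> t"
  shows "good X t"
proof -
  obtain N A where "continuous_local_martingale M F N" "continuous_finite_variation M F A"
    and eq: "AE \<omega> in M. \<forall>t\<ge>0. X t \<omega> = N t \<omega> + A t \<omega>"
    using assms(1) unfolding real_semimartingale_def by blast
  then have "good N t" "good A t"
    using assms(2) by (simp_all add: good_local_martingale good_finite_variation)
  then show ?thesis by (rule good_add[OF _ _ eq assms(2)])
qed

text \<open>Linearity turns boundedness into smallness: if \<open>C\<close> works for integrands
  bounded by 1, then integrands bounded by e / C give sums bounded by \<open>e\<close>.\<close>

lemma good_small:
  assumes "good X t" "0 < e" "0 < r"
  shows "\<exists>d>0. \<forall>n>0. \<forall>v q. (\<forall>j<n. v j \<in> borel_measurable (F (grid t n j))) \<longrightarrow>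
     whp q (\<lambda>\<omega>. \<forall>j<n. \<bar>v j \<omega>\<bar> \<le> d) \<longrightarrow> whp (q + r) (\<lambda>\<omega>. \<bar>\<Sum>j<n. v j \<omega> * incr X t n j \<omega>\<bar> \<le> e)"
proof -
  obtain C where "C > 0" and C: "\<And>n v. n > 0 \<Longrightarrow>
      (\<forall>j<n. v j \<in> borel_measurable (F (grid t n j)) \<and> (\<forall>\<omega>. \<bar>v j \<omega>\<bar> \<le> 1)) \<Longrightarrow>
      whp r (\<lambda>\<omega>. \<bar>\<Sum>j<n. v j \<omega> * incr X t n j \<omega>\<bar> \<le> C)"
    by (rule goodE[OF assms(1,3)]) (rule that)
  define d where "d = e / C"
  have "d > 0" using \<open>C > 0\<close> \<open>e > 0\<close> by (simp add: d_def)
  show ?thesis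
  proof (intro exI[of _ d] conjI allI impI)
    fix n :: nat and v :: "nat \<Rightarrow> 'a \<Rightarrow> real" and q
    assume "0 < n" and v: "\<forall>j<n. v j \<in> borel_measurable (F (grid t n j))"
      and small: "whp q (\<lambda>\<omega>. \<forall>j<n. \<bar>v j \<omega>\<bar> \<le> d)"
    \<comment> \<open>The hypothesis bounds \<open>v\<close> only outside an event. Truncation
      produces an integrand bounded for every \<omega> that agrees with \<open>v / d\<close> off
      that event.\<close>
    define u where "u j \<omega> = max (-1) (min 1 (v j \<omega> / d))" for j \<omega>
    have "\<forall>j<n. u j \<in> borel_measurable (F (grid t n j)) \<and> (\<forall>\<omega>. \<bar>u j \<omega>\<bar> \<le> 1)"
      unfolding u_def using v by auto
    from whp_conj[OF small C[OF \<open>0 < n\<close> this]]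
    show "whp (q + r) (\<lambda>\<omega>. \<bar>\<Sum>j<n. v j \<omega> * incr X t n j \<omega>\<bar> \<le> e)"
    proof (rule whp_mono)
      fix \<omega> assume *: "(\<forall>j<n. \<bar>v j \<omega>\<bar> \<le> d) \<and> \<bar>\<Sum>j<n. u j \<omega> * incr X t n j \<omega>\<bar> \<le> C"
      have "v j \<omega> = d * u j \<omega>" if "j < n" for j
      proof -
        have "\<bar>v j \<omega>\<bar> \<le> d" using * that by simp
        then have "v j \<omega> / d \<le> 1" "-1 \<le> v j \<omega> / d" using \<open>d > 0\<close> by (auto simp: field_simps abs_le_iff)
        then show ?thesis using \<open>d > 0\<close> by (simp add: u_def)
      qed
      then have "(\<Sum>j<n. v j \<omega> * incr X t n j \<omega>) = d * (\<Sum>j<n. u j \<omega> * incr X t n j \<omega>)"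
        unfolding sum_distrib_left by (intro sum.cong) (auto simp: mult.assoc)
      then have "\<bar>\<Sum>j<n. v j \<omega> * incr X t n j \<omega>\<bar> \<le> d * C"
        using * \<open>d > 0\<close> by (simp add: abs_mult mult_left_mono)
      then show "\<bar>\<Sum>j<n. v j \<omega> * incr X t n j \<omega>\<bar> \<le> e" using \<open>C > 0\<close> by (simp add: d_def)
    qed simp
  qed fact
qed

text \<open>The factor 4 counts the products of the real and imaginary parts of integrand and
  integrator, each of which pays \<open>q\<close> once.\<close>

lemma good_small_complex:
  fixes X :: "real \<Rightarrow> 'a \<Rightarrow> complex"
  assumes "good (\<lambda>s \<omega>. Re (X s \<omega>)) t" "good (\<lambda>s \<omega>. Im (X s \<omega>)) t" "0 < e" "0 < r"
  shows "\<exists>d>0. \<forall>n>0. \<forall>v q. (\<forall>j<n. v j \<in> borel_measurable (F (grid t n j))) \<longrightarrow>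
     whp q (\<lambda>\<omega>. \<forall>j<n. norm (v j \<omega>) \<le> d) \<longrightarrow> whp (4 * q + r) (\<lambda>\<omega>. norm (\<Sum>j<n. v j \<omega> * incr X t n j \<omega>) \<le> e)"
proof -
  let ?R = "\<lambda>s \<omega>. Re (X s \<omega>)" and ?I = "\<lambda>s \<omega>. Im (X s \<omega>)"
  have "e / 4 > 0" "r / 4 > 0" using assms by auto
  note pos = this
  from good_small[OF assms(1) pos]
  obtain d where "d > 0" and d: "\<forall>n>0. \<forall>v q. (\<forall>j<n. v j \<in> borel_measurable (F (grid t n j))) \<longrightarrow>
     whp q (\<lambda>\<omega>. \<forall>j<n. \<bar>v j \<omega>\<bar> \<le> d) \<longrightarrow> whp (q + r / 4) (\<lambda>\<omega>. \<bar>\<Sum>j<n. v j \<omega> * incr ?R t n j \<omega>\<bar> \<le> e / 4)"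
    by (elim exE conjE) (rule that)
  from good_small[OF assms(2) pos]
  obtain d' where "d' > 0" and d': "\<forall>n>0. \<forall>v q. (\<forall>j<n. v j \<in> borel_measurable (F (grid t n j))) \<longrightarrow>
     whp q (\<lambda>\<omega>. \<forall>j<n. \<bar>v j \<omega>\<bar> \<le> d') \<longrightarrow> whp (q + r / 4) (\<lambda>\<omega>. \<bar>\<Sum>j<n. v j \<omega> * incr ?I t n j \<omega>\<bar> \<le> e / 4)"
    by (elim exE conjE) (rule that)
  note D = d[THEN spec, THEN mp, THEN spec, THEN spec, THEN mp, THEN mp]
  note D' = d'[THEN spec, THEN mp, THEN spec, THEN spec, THEN mp, THEN mp]
  show ?thesis
  proof (intro exI[of _ "min d d'"] conjI allI impI)
    fix n :: nat and v :: "nat \<Rightarrow> 'a \<Rightarrow> complex" and q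
    assume "0 < n" and v: "\<forall>j<n. v j \<in> borel_measurable (F (grid t n j))"
      and small: "whp q (\<lambda>\<omega>. \<forall>j<n. norm (v j \<omega>) \<le> min d d')"
    have vm: "\<forall>j<n. (\<lambda>\<omega>. Re (v j \<omega>)) \<in> borel_measurable (F (grid t n j))"
       "\<forall>j<n. (\<lambda>\<omega>. Im (v j \<omega>)) \<in> borel_measurable (F (grid t n j))"
      using v by auto
    have "whp q (\<lambda>\<omega>. \<forall>j<n. \<bar>Re (v j \<omega>)\<bar> \<le> d)" "whp q (\<lambda>\<omega>. \<forall>j<n. \<bar>Im (v j \<omega>)\<bar> \<le> d)"
      "whp q (\<lambda>\<omega>. \<forall>j<n. \<bar>Re (v j \<omega>)\<bar> \<le> d')" "whp q (\<lambda>\<omega>. \<forall>j<n. \<bar>Im (v j \<omega>)\<bar> \<le> d')"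
      by (rule whp_mono[OF small order_refl]; use order_trans[OF abs_Re_le_cmod] order_trans[OF abs_Im_le_cmod] in simp)+
    note W = this
    have "whp (4 * q + r) (\<lambda>\<omega>.
        (\<bar>\<Sum>j<n. Re (v j \<omega>) * incr ?R t n j \<omega>\<bar> \<le> e/4 \<and> \<bar>\<Sum>j<n. Im (v j \<omega>) * incr ?R t n j \<omega>\<bar> \<le> e/4) \<and>
        (\<bar>\<Sum>j<n. Re (v j \<omega>) * incr ?I t n j \<omega>\<bar> \<le> e/4 \<and> \<bar>\<Sum>j<n. Im (v j \<omega>) * incr ?I t n j \<omega>\<bar> \<le> e/4))"
      using whp_conj[OF whp_conj[OF D[OF \<open>0 < n\<close> vm(1) W(1)] D[OF \<open>0 < n\<close> vm(2) W(2)]]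
        whp_conj[OF D'[OF \<open>0 < n\<close> vm(1) W(3)] D'[OF \<open>0 < n\<close> vm(2) W(4)]]]
      by (rule whp_mono) auto
    then show "whp (4 * q + r) (\<lambda>\<omega>. norm (\<Sum>j<n. v j \<omega> * incr X t n j \<omega>) \<le> e)"
    proof (rule whp_mono)
      fix \<omega> assume *: "(\<bar>\<Sum>j<n. Re (v j \<omega>) * incr ?R t n j \<omega>\<bar> \<le> e/4 \<and> \<bar>\<Sum>j<n. Im (v j \<omega>) * incr ?R t n j \<omega>\<bar> \<le> e/4) \<and>
        (\<bar>\<Sum>j<n. Re (v j \<omega>) * incr ?I t n j \<omega>\<bar> \<le> e/4 \<and> \<bar>\<Sum>j<n. Im (v j \<omega>) * incr ?I t n j \<omega>\<bar> \<le> e/4)"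
      have "Re (\<Sum>j<n. v j \<omega> * incr X t n j \<omega>) =
          (\<Sum>j<n. Re (v j \<omega>) * incr ?R t n j \<omega>) - (\<Sum>j<n. Im (v j \<omega>) * incr ?I t n j \<omega>)"
        "Im (\<Sum>j<n. v j \<omega> * incr X t n j \<omega>) =
          (\<Sum>j<n. Re (v j \<omega>) * incr ?I t n j \<omega>) + (\<Sum>j<n. Im (v j \<omega>) * incr ?R t n j \<omega>)"
        by (simp_all add: incr_def sum_subtractf sum.distrib)
      then show "norm (\<Sum>j<n. v j \<omega> * incr X t n j \<omega>) \<le> e"
        using * cmod_le[of "\<Sum>j<n. v j \<omega> * incr X t n j \<omega>"] by linarith
    qed simp
  qed (use \<open>d > 0\<close> \<open>d' > 0\<close> in auto)
qed

end

subsection \<open>Brownian motion\<close>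

locale brownian_space = filtered_space M F for M :: "'a measure" and F +
  fixes W :: "real \<Rightarrow> 'a \<Rightarrow> real"
  assumes brownian: "brownian_motion M F W"
begin

lemma W_adapted: "continuous_adapted M F W"
  using brownian by (simp add: brownian_motion_def)

lemma W_rv [measurable]: "0 \<le> s \<Longrightarrow> W s \<in> borel_measurable M"
  by (rule adapted_rv[OF W_adapted])

lemma W_increment:
  assumes "0 \<le> s" "s < u"
  shows "distributed M lborel (\<lambda>\<omega>. W u \<omega> - W s \<omega>) (normal_density 0 (sqrt (u - s)))"
    and "indep_set (sets (F s)) (sets (vimage_algebra (space M) (\<lambda>\<omega>. W u \<omega> - W s \<omega>) borel))"
  using brownian assms by (simp_all add: brownian_motion_def)

lemma W_indep:
  fixes G :: "'a \<Rightarrow> 'b::topological_space" and f :: "real \<Rightarrow> 'b"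
  assumes "0 \<le> s" "s < u" and G: "G \<in> borel_measurable (F s)" and f: "f \<in> borel_measurable borel"
  shows "indep_var borel G borel (\<lambda>\<omega>. f (W u \<omega> - W s \<omega>))"
proof -
  let ?D = "\<lambda>\<omega>. W u \<omega> - W s \<omega>"
  have D: "?D \<in> borel_measurable M" using assms by auto
  have fD: "(\<lambda>\<omega>. f (?D \<omega>)) \<in> borel_measurable M"
    using measurable_compose[OF D f] .
  have GM: "G \<in> borel_measurable M" using G by (rule measurable_F_M)
  have 1: "{G -` A \<inter> space M |A. A \<in> sets borel} \<subseteq> sets (F s)"
    using measurable_sets[OF G] subalgebra_F[of s] by (auto simp: subalgebra_def)
  have 2: "{(\<lambda>\<omega>. f (?D \<omega>)) -` A \<inter> space M |A. A \<in> sets borel} \<subseteq> sets (vimage_algebra (space M) ?D borel)"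
  proof safe
    fix A :: "'b set" assume "A \<in> sets borel"
    then have "f -` A \<in> sets borel" using measurable_sets[OF f] by simp
    then have "?D -` (f -` A) \<inter> space M \<in> sets (vimage_algebra (space M) ?D borel)"
      by (rule in_vimage_algebra)
    then show "(\<lambda>\<omega>. f (?D \<omega>)) -` A \<inter> space M \<in> sets (vimage_algebra (space M) ?D borel)"
      by (simp add: vimage_def)
  qed
  have s1: "sigma_sets (space M) {G -` A \<inter> space M |A. A \<in> sets borel} \<subseteq> sets (F s)"
    using sets.sigma_sets_subset[OF 1] subalgebra_F[of s] by (simp add: subalgebra_def)
  have s2: "sigma_sets (space M) {(\<lambda>\<omega>. f (?D \<omega>)) -` A \<inter> space M |A. A \<in> sets borel}
      \<subseteq> sets (vimage_algebra (space M) ?D borel)"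
    using sets.sigma_sets_subset[OF 2] by simp
  show ?thesis
    unfolding indep_var_eq
  proof (intro conjI GM fD)
    note ind = W_increment(2)[OF assms(1,2)]
    show "indep_set (sigma_sets (space M) {G -` A \<inter> space M |A. A \<in> sets borel})
      (sigma_sets (space M) {(\<lambda>\<omega>. f (?D \<omega>)) -` A \<inter> space M |A. A \<in> sets borel})"
      using s1 s2 indep_setD_ev1[OF ind] indep_setD_ev2[OF ind] indep_setD[OF ind]
      by (intro indep_setI) (blast intro: order_trans)+
  qed
qed

lemma W_moments:
  assumes "0 \<le> s" "s \<le> u"
  shows "integrable M (\<lambda>\<omega>. W u \<omega> - W s \<omega>)" "(\<integral>\<omega>. W u \<omega> - W s \<omega> \<partial>M) = 0"
    "integrable M (\<lambda>\<omega>. (W u \<omega> - W s \<omega>)\<^sup>2)" "(\<integral>\<omega>. (W u \<omega> - W s \<omega>)\<^sup>2 \<partial>M) = u - s"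
proof -
  have "integrable M (\<lambda>\<omega>. W u \<omega> - W s \<omega>) \<and> (\<integral>\<omega>. W u \<omega> - W s \<omega> \<partial>M) = 0
    \<and> integrable M (\<lambda>\<omega>. (W u \<omega> - W s \<omega>)\<^sup>2) \<and> (\<integral>\<omega>. (W u \<omega> - W s \<omega>)\<^sup>2 \<partial>M) = u - s"
  proof (cases "s = u")
    case False
    then have "s < u" using assms by simp
    note D = W_increment(1)[OF assms(1) this]
    have pos: "0 < sqrt (u - s)" using \<open>s < u\<close> by simp
    have i1: "integrable M (\<lambda>\<omega>. W u \<omega> - W s \<omega>)"
      using distributed_integrable[OF D, of "\<lambda>x. x"] integrable_normal_moment_nz_1[OF pos, of 0] by simp
    have e1: "(\<integral>\<omega>. W u \<omega> - W s \<omega> \<partial>M) = 0"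
      using normal_distributed_expectation[OF pos D] by simp
    have i2: "integrable M (\<lambda>\<omega>. (W u \<omega> - W s \<omega>)\<^sup>2)"
      using distributed_integrable[OF D, of "\<lambda>x. x\<^sup>2"] integrable_normal_moment[OF pos, of 0 2] by simp
    have e2: "(\<integral>\<omega>. (W u \<omega> - W s \<omega>)\<^sup>2 \<partial>M) = u - s"
      using normal_distributed_variance[OF pos D] e1 \<open>s < u\<close> by simp
    show ?thesis using i1 e1 i2 e2 by blast
  qed simp
  then show "integrable M (\<lambda>\<omega>. W u \<omega> - W s \<omega>)" "(\<integral>\<omega>. W u \<omega> - W s \<omega> \<partial>M) = 0"
    "integrable M (\<lambda>\<omega>. (W u \<omega> - W s \<omega>)\<^sup>2)" "(\<integral>\<omega>. (W u \<omega> - W s \<omega>)\<^sup>2 \<partial>M) = u - s"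
    by blast+
qed

lemma W_char:
  assumes "0 \<le> s" "s \<le> u"
  shows "(\<integral>\<omega>. iexp (a * (W u \<omega> - W s \<omega>)) \<partial>M) = exp (- (a\<^sup>2 * (u - s) / 2))"
proof (cases "s = u")
  case True
  then show ?thesis by (simp add: prob_space)
next
  case False
  then have "s < u" using assms by simp
  then have pos: "0 < sqrt (u - s)" by simp
  let ?Y = "\<lambda>\<omega>. (W u \<omega> - W s \<omega> - 0) / sqrt (u - s)"
  have D: "distributed M lborel ?Y std_normal_density"
    using W_increment(1)[OF assms(1) \<open>s < u\<close>] normal_standard_normal_convert[OF pos, of "\<lambda>\<omega>. W u \<omega> - W s \<omega>" 0] by simp
  then have d: "distr M lborel ?Y = std_normal_distribution" and Y: "?Y \<in> measurable M lborel"
    by (simp_all add: distributed_def)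
  have "exp (- (a\<^sup>2 * (u - s) / 2)) = char std_normal_distribution (a * sqrt (u - s))"
    using \<open>s < u\<close> by (simp add: char_std_normal_distribution power_mult_distrib)
  also have "\<dots> = (\<integral>x. iexp (a * sqrt (u - s) * x) \<partial>distr M lborel ?Y)"
    unfolding char_def d ..
  also have "\<dots> = (\<integral>\<omega>. iexp (a * sqrt (u - s) * ?Y \<omega>) \<partial>M)"
    by (rule integral_distr[OF Y]) measurable
  also have "\<dots> = (\<integral>\<omega>. iexp (a * (W u \<omega> - W s \<omega>)) \<partial>M)"
    using pos by simp
  finally show ?thesis by simp
qed

text \<open>The source of the damping. With \<open>a = n * c\<close> the factor is exp(- c^2/2 * n^2
  * (u - s)), and c^2/2 becomes \<epsilon>^2 in the end.\<close>

lemma W_char_mult: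
  assumes "0 \<le> s" "s \<le> u" and G: "G \<in> borel_measurable (F s)" "integrable M G"
  shows "(\<integral>\<omega>. G \<omega> * iexp (a * (W u \<omega> - W s \<omega>)) \<partial>M) = (\<integral>\<omega>. G \<omega> \<partial>M) * exp (- (a\<^sup>2 * (u - s) / 2))"
proof (cases "s = u")
  case False
  then have "s < u" using assms by simp
  have "(\<lambda>x::real. iexp (a * x)) \<in> borel_measurable borel" by measurable
  note ind = W_indep[OF assms(1) \<open>s < u\<close> G(1) this]
  have [measurable]: "W u \<in> borel_measurable M" "W s \<in> borel_measurable M" using assms by auto
  have "integrable M (\<lambda>\<omega>. iexp (a * (W u \<omega> - W s \<omega>)))"
    by (rule integrable_const_bound[where B=1]) auto
  from indep_var_lebesgue_integral[OF ind G(2) this] show ?thesis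
    using W_char[OF assms(1,2)] by simp
qed simp

lemma good_W: "0 \<le> t \<Longrightarrow> good W t"
proof (rule good_orthogonal)
  fix s assume s: "0 \<le> s" "s \<le> t"
  then show "W s \<in> borel_measurable (F s)" using adapted_measurable[OF W_adapted] by blast
  have "AE \<omega> in M. W s \<omega> - W 0 \<omega> = W s \<omega>"
    using brownian by (auto simp: brownian_motion_def)
  moreover have "integrable M (\<lambda>\<omega>. W s \<omega> - W 0 \<omega>)" using W_moments(1) s by simp
  ultimately show "integrable M (W s)"
    using s by (subst integrable_cong_AE[symmetric]) auto
next
  fix s u and v :: "'a \<Rightarrow> real"
  assume *: "0 \<le> s" "s \<le> u" "u \<le> t" and v: "v \<in> borel_measurable (F s)" "bounded (range v)"
  show "(\<integral>\<omega>. v \<omega> * (W u \<omega> - W s \<omega>) \<partial>M) = 0"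
  proof (cases "s = u")
    case False
    then have "s < u" using * by simp
    obtain B where B: "\<And>\<omega>. norm (v \<omega>) \<le> B" using v(2) by (auto simp: bounded_iff)
    have "integrable M v"
      using B by (intro integrable_const_bound[where B=B] measurable_F_M[OF v(1)]) auto
    moreover have "indep_var borel v borel (\<lambda>\<omega>. W u \<omega> - W s \<omega>)"
      using W_indep[OF *(1) \<open>s < u\<close> v(1), of "\<lambda>x. x"] by simp
    ultimately show ?thesis
      using indep_var_lebesgue_integral[of v "\<lambda>\<omega>. W u \<omega> - W s \<omega>"] W_moments[OF *(1,2)] by simp
  qed simp
qed

lemma W_quadratic_variation:
  assumes "0 \<le> t" "0 < r"
  shows "\<exists>C>0. \<forall>n>0. whp r (\<lambda>\<omega>. (\<Sum>j<n. (incr W t n j \<omega>)\<^sup>2) \<le> C)"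
proof (intro exI conjI allI impI)
  let ?C = "(t + 1) / r"
  show "?C > 0" using assms by simp
  fix n :: nat assume "0 < n"
  have g: "0 \<le> grid t n j" "grid t n j \<le> grid t n (Suc j)" for j
    using assms by (auto intro: grid_nonneg grid_mono)
  have int: "integrable M (\<lambda>\<omega>. (incr W t n j \<omega>)\<^sup>2)" "(\<integral>\<omega>. (incr W t n j \<omega>)\<^sup>2 \<partial>M) = t / n" for j
    unfolding incr_def using W_moments(3,4)[OF g] by (simp_all add: grid_Suc_diff)
  have E: "(\<integral>\<omega>. (\<Sum>j<n. (incr W t n j \<omega>)\<^sup>2) \<partial>M) = t"
    using int \<open>0 < n\<close> by (subst Bochner_Integration.integral_sum) auto
  have "whp r (\<lambda>\<omega>. (\<Sum>j<n. (incr W t n j \<omega>)\<^sup>2) < ?C)"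
  proof (rule whp_Markov)
    show "(\<integral>\<omega>. (\<Sum>j<n. (incr W t n j \<omega>)\<^sup>2) \<partial>M) / ?C \<le> r"
      unfolding E using assms by (simp add: field_simps)
  qed (use int \<open>?C > 0\<close> in \<open>auto intro!: sum_nonneg Bochner_Integration.integrable_sum\<close>)
  then show "whp r (\<lambda>\<omega>. (\<Sum>j<n. (incr W t n j \<omega>)\<^sup>2) \<le> ?C)"
    by (rule whp_mono) auto
qed

end

subsection \<open>The defect of the midpoint sums\<close>

text \<open>Refining one midpoint term into \<open>k\<close> of them changes it by a discrete Levy
  area. Both sums on the right evaluate their integrand at the left endpoint, so they are transforms
  with adapted integrands, which the midpoint sums are not.\<close>

lemma levy_area_identity:
  fixes y w :: "nat \<Rightarrow> complex"
  shows "(\<Sum>j\<in>{a..<a+k}. (y j + y (Suc j)) / 2 * (w (Suc j) - w j)) - (y a + y (a + k)) / 2 * (w (a + k) - w a)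
    = (\<Sum>j\<in>{a..<a+k}. (y j - y a) * (w (Suc j) - w j)) / 2 - (\<Sum>j\<in>{a..<a+k}. (w j - w a) * (y (Suc j) - y j)) / 2"
proof (induction k)
  case (Suc k)
  define A where "A = (\<Sum>j\<in>{a..<a+k}. (y j + y (Suc j)) / 2 * (w (Suc j) - w j))"
  define B where "B = (\<Sum>j\<in>{a..<a+k}. (y j - y a) * (w (Suc j) - w j))"
  define C where "C = (\<Sum>j\<in>{a..<a+k}. (w j - w a) * (y (Suc j) - y j))"
  have *: "(\<Sum>j\<in>{a..<a + Suc k}. f j) = (\<Sum>j\<in>{a..<a+k}. f j) + f (a + k)" for f :: "nat \<Rightarrow> complex"
    by simp
  have "A - (y a + y (a + k)) / 2 * (w (a + k) - w a) = B / 2 - C / 2"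
    using Suc by (simp only: A_def B_def C_def)
  then have A: "A = (y a + y (a + k)) / 2 * (w (a + k) - w a) + (B / 2 - C / 2)"
    by (simp only: diff_eq_eq add.commute)
  show ?case
    unfolding * A_def[symmetric] B_def[symmetric] C_def[symmetric] A by (simp add: field_simps)
qed simp

lemma integral_grid_split:
  fixes f :: "real \<Rightarrow> complex"
  assumes f: "continuous_on {0..t} f" and "0 \<le> t" "i \<le> m"
  shows "integral {0..grid t m i} f = (\<Sum>j<i. integral {grid t m j..grid t m (Suc j)} f)"
  using \<open>i \<le> m\<close>
proof (induction i)
  case (Suc i)
  have "integral {0..grid t m i} f + integral {grid t m i..grid t m (Suc i)} f = integral {0..grid t m (Suc i)} f"
  proof (rule Henstock_Kurzweil_Integration.integral_combine)
    have "{0..grid t m (Suc i)} \<subseteq> {0..t}" using grid_le[of t "Suc i" m] Suc.prems assms by auto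
    then show "f integrable_on {0..grid t m (Suc i)}"
      by (intro integrable_continuous_interval continuous_on_subset[OF f])
  qed (use assms in \<open>auto intro: grid_mono grid_nonneg\<close>)
  then show ?case using Suc by simp
qed simp

lemma riemann_block:
  fixes f :: "real \<Rightarrow> complex"
  assumes f: "continuous_on {0..t} f" and "0 \<le> t" "i < m" "t / m < d"
    and mod: "\<forall>s\<in>{0..t}. \<forall>s'\<in>{0..t}. \<bar>s - s'\<bar> < d \<longrightarrow> norm (f s - f s') \<le> e"
  shows "norm (integral {grid t m i..grid t m (Suc i)} f - f (grid t m i) * of_real (t / m)) \<le> e * (t / m)"
proof -
  let ?a = "grid t m i" and ?b = "grid t m (Suc i)"
  have ab: "0 \<le> ?a" "?a \<le> ?b" "?b \<le> t" "?b - ?a = t / m"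
    using assms by (auto intro: grid_nonneg grid_mono grid_le simp: grid_Suc_diff)
  have int: "f integrable_on {?a..?b}"
    using ab by (intro integrable_continuous_interval continuous_on_subset[OF f]) auto
  have "0 \<le> e" using mod[rule_format, of 0 0] \<open>0 \<le> t\<close> \<open>t / m < d\<close> \<open>i < m\<close>
    by (smt (verit) atLeastAtMost_iff divide_nonneg_nonneg norm_ge_zero of_nat_0_le_iff)
  have "integral {?a..?b} f - f ?a * of_real (t / m) = integral {?a..?b} (\<lambda>s. f s - f ?a)"
    by (subst Henstock_Kurzweil_Integration.integral_diff[OF int])
      (use ab in \<open>auto simp: scaleR_conv_of_real mult.commute\<close>)
  also have "norm \<dots> \<le> integral {?a..?b} (\<lambda>s. e)"
  proof (rule integral_norm_bound_integral)
    fix s assume s: "s \<in> {?a..?b}"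
    then show "norm (f s - f ?a) \<le> e"
      using ab \<open>t / m < d\<close> by (intro mod[rule_format]) auto
  qed (use int in \<open>auto intro: integrable_diff\<close>)
  also have "\<dots> = e * (t / m)" using ab by simp
  finally show ?thesis .
qed

lemma riemann_sum:
  fixes f :: "real \<Rightarrow> complex"
  assumes f: "continuous_on {0..t} f" and "0 \<le> t" "0 < m" "t / m < d"
    and mod: "\<forall>s\<in>{0..t}. \<forall>s'\<in>{0..t}. \<bar>s - s'\<bar> < d \<longrightarrow> norm (f s - f s') \<le> e"
  shows "norm (integral {0..t} f - (\<Sum>i<m. f (grid t m i) * of_real (t / m))) \<le> e * t"
proof -
  have "integral {0..t} f = (\<Sum>j<m. integral {grid t m j..grid t m (Suc j)} f)"
    using integral_grid_split[OF f \<open>0 \<le> t\<close>, of m m] \<open>0 < m\<close> by simp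
  then have "norm (integral {0..t} f - (\<Sum>i<m. f (grid t m i) * of_real (t / m)))
    = norm (\<Sum>j<m. integral {grid t m j..grid t m (Suc j)} f - f (grid t m j) * of_real (t / m))"
    by (simp add: sum_subtractf)
  also have "\<dots> \<le> (\<Sum>j<m. e * (t / m))"
    by (rule sum_norm_le) (use riemann_block[OF f \<open>0 \<le> t\<close> _ \<open>t / m < d\<close> mod] in auto)
  also have "\<dots> = e * t" using \<open>0 < m\<close> by simp
  finally show ?thesis .
qed

text \<open>\<open>j div k\<close> is the coarse cell that contains the fine index \<open>j\<close>.
  In this form a weighted sum over coarse cells is one transform on the fine grid.\<close>

lemma sum_blocks:
  fixes g :: "nat \<Rightarrow> complex"
  assumes "0 < k"
  shows "(\<Sum>i<m. v i * (\<Sum>j\<in>{i*k..<i*k+k}. g j)) = (\<Sum>j<m*k. v (j div k) * g j)"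
proof -
  have "v i * (\<Sum>j\<in>{i*k..<i*k+k}. g j) = (\<Sum>j\<in>{i*k..<i*k+k}. v (j div k) * g j)" for i
    unfolding sum_distrib_left
  proof (rule sum.cong)
    fix j assume "j \<in> {i*k..<i*k+k}"
    then have "j div k = i" using assms by (auto simp: div_nat_eqI mult.commute)
    then show "v i * g j = v (j div k) * g j" by simp
  qed simp
  then show ?thesis using sum.nat_group[of "\<lambda>j. v (j div k) * g j" k m] by simp
qed

lemma grid_refine: "0 < k \<Longrightarrow> grid t (m * k) (i * k) = grid t m i"
  by (simp add: grid_def)

section \<open>Midpoint sums of the solution on refined grids\<close>

locale linear_noise_solution = brownian_space M F W for M :: "'a measure" and F W +
  fixes b :: "complex \<Rightarrow> complex" and c :: real and x :: complex and h :: "real \<Rightarrow> 'a \<Rightarrow> complex"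
  assumes sol: "stratonovich_solution M F W b (\<lambda>z. \<i> * of_real c * z) x h"
    and b_cont: "continuous_on UNIV b"
begin

lemma h_semi: "real_semimartingale M F (\<lambda>t \<omega>. Re (h t \<omega>))" "real_semimartingale M F (\<lambda>t \<omega>. Im (h t \<omega>))"
  using sol by (auto simp: stratonovich_solution_def complex_semimartingale_def)

lemma h_adapted: "continuous_adapted M F h"
proof -
  have *: "continuous_adapted M F (\<lambda>t \<omega>. Re (h t \<omega>))" "continuous_adapted M F (\<lambda>t \<omega>. Im (h t \<omega>))"
    using h_semi by (auto simp: real_semimartingale_def)
  have "AE \<omega> in M. continuous_on {0..} (\<lambda>t. Re (h t \<omega>))" "AE \<omega> in M. continuous_on {0..} (\<lambda>t. Im (h t \<omega>))"
    using * by (auto simp: continuous_adapted_def)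
  then have "AE \<omega> in M. continuous_on {0..} (\<lambda>t. h t \<omega>)"
  proof eventually_elim
    case (elim \<omega>)
    then have "continuous_on {0..} (\<lambda>t. of_real (Re (h t \<omega>)) + \<i> * of_real (Im (h t \<omega>)))"
      by (intro continuous_on_add continuous_on_mult continuous_on_const continuous_on_of_real)
    then show ?case by (simp only: complex_eq[symmetric])
  qed
  then show ?thesis
    using * unfolding continuous_adapted_def by (subst borel_measurable_complex_iff) auto
qed

lemma h_cont: "AE \<omega> in M. continuous_on {0..} (\<lambda>t. h t \<omega>)"
  using h_adapted by (simp add: continuous_adapted_def)

lemma h_rv [measurable]: "0 \<le> s \<Longrightarrow> h s \<in> borel_measurable M"
  by (rule adapted_rv[OF h_adapted])

lemma b_h_adapted: "continuous_adapted M F (\<lambda>s \<omega>. b (h s \<omega>))"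
proof -
  have "b \<in> borel_measurable borel" using b_cont by (rule borel_measurable_continuous_onI)
  moreover have "AE \<omega> in M. continuous_on {0..} (\<lambda>t. b (h t \<omega>))"
    using h_cont
    by eventually_elim (rule continuous_on_compose2[OF b_cont], auto)
  ultimately show ?thesis
    using h_adapted unfolding continuous_adapted_def by (auto intro: measurable_compose)
qed

text \<open>The first \<open>i * Suc k\<close> points of the refined grid subdivide [0, s] with
  \<open>s = grid t m i\<close> and mesh tending to 0, so the definition of the Stratonovich
  integral up to \<open>s\<close> applies. The equation then identifies its limit almost
  surely.\<close>

lemma sums_in_prob:
  assumes "0 < t" "0 < m" "i \<le> m" "0 < e" "0 < r"
  shows "\<forall>\<^sub>F k in sequentially. whp r (\<lambda>\<omega>. norm ((\<Sum>j<i*Suc k. \<i> * of_real c * ((h (grid t (m * Suc k) j) \<omega> + h (grid t (m * Suc k) (Suc j)) \<omega>) / 2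
     * of_real (incr W t (m * Suc k) j \<omega>))) - (h (grid t m i) \<omega> - x - integral {0..grid t m i} (\<lambda>s. b (h s \<omega>)))) \<le> e)"
proof -
  let ?s = "grid t m i"
  have s: "0 \<le> ?s" "?s \<le> t" using assms by (auto intro: grid_nonneg grid_le)
  obtain I where I: "stratonovich_integral M F W (\<lambda>s \<omega>. \<i> * of_real c * h s \<omega>) ?s I"
    and eq: "AE \<omega> in M. h ?s \<omega> = x + integral {0..?s} (\<lambda>s. b (h s \<omega>)) + I \<omega>"
    using sol s by (auto simp: stratonovich_solution_def)
  define S where "S k \<omega> = (\<Sum>j<i*Suc k. (\<i> * of_real c * h (grid t (m * Suc k) j) \<omega> + \<i> * of_real c * h (grid t (m * Suc k) (Suc j)) \<omega>) / 2
     * of_real (W (grid t (m * Suc k) (Suc j)) \<omega> - W (grid t (m * Suc k) j) \<omega>))" for k \<omega>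
  have sub: "subdivision ?s (i * Suc k) (grid t (m * Suc k))" for k
    unfolding subdivision_def using grid_refine[of "Suc k" t m i] assms
    by (auto intro: grid_mono simp del: mult_Suc_right)
  have mesh: "\<forall>\<^sub>F k in sequentially. \<forall>j<i * Suc k. grid t (m * Suc k) (Suc j) - grid t (m * Suc k) j < d" if "d > 0" for d
  proof -
    have "(\<lambda>k. t / real m * (1 / real (Suc k))) \<longlonglongrightarrow> t / real m * 0"
      by (intro tendsto_intros lim_1_over_n[THEN LIMSEQ_Suc])
    then have "\<forall>\<^sub>F k in sequentially. t / real m * (1 / real (Suc k)) < d"
      using that by (intro order_tendstoD) auto
    then show ?thesis
      by eventually_elim (simp add: grid_Suc_diff del: mult_Suc_right of_nat_Suc)
  qed
  have "tendsto_in_prob M S I"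
  proof -
    have "\<And>n p. (\<forall>k. subdivision ?s (n k) (p k)) \<Longrightarrow>
       (\<forall>d>0. \<forall>\<^sub>F k in sequentially. \<forall>i<n k. p k (Suc i) - p k i < d) \<Longrightarrow>
       tendsto_in_prob M (\<lambda>k \<omega>. \<Sum>i<n k. (\<i> * of_real c * h (p k i) \<omega> + \<i> * of_real c * h (p k (Suc i)) \<omega>) / 2
          * of_real (W (p k (Suc i)) \<omega> - W (p k i) \<omega>)) I"
      using I unfolding stratonovich_integral_def by blast
    from this[of "\<lambda>k. i * Suc k" "\<lambda>k. grid t (m * Suc k)"] show ?thesis
      using sub mesh unfolding S_def by blast
  qed
  then have "(\<lambda>k. measure M {\<omega>\<in>space M. e \<le> dist (S k \<omega>) (I \<omega>)}) \<longlonglongrightarrow> 0"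
    using \<open>0 < e\<close> by (simp add: tendsto_in_prob_def)
  then have "\<forall>\<^sub>F k in sequentially. measure M {\<omega>\<in>space M. e \<le> dist (S k \<omega>) (I \<omega>)} < r"
    using \<open>0 < r\<close> by (rule order_tendstoD)
  then show ?thesis
  proof eventually_elim
    case (elim k)
    have [measurable]: "h (grid t n j) \<in> borel_measurable M" "W (grid t n j) \<in> borel_measurable M" for n j
      using assms by (simp_all add: h_rv W_rv grid_nonneg)
    have [measurable]: "I \<in> borel_measurable M" using I by (simp add: stratonovich_integral_def)
    have [measurable]: "S k \<in> borel_measurable M" unfolding S_def by measurable
    have 1: "whp r (\<lambda>\<omega>. dist (S k \<omega>) (I \<omega>) < e)"
      by (rule whpI[of "{\<omega>\<in>space M. e \<le> dist (S k \<omega>) (I \<omega>)}"]) (use elim in auto)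
    have "whp (r + 0) (\<lambda>\<omega>. dist (S k \<omega>) (I \<omega>) < e \<and> h ?s \<omega> = x + integral {0..?s} (\<lambda>s. b (h s \<omega>)) + I \<omega>)"
      using 1 AE_imp_whp[OF eq] by (intro whp_conj) auto
    then show ?case
    proof (rule whp_mono)
      fix \<omega> assume *: "dist (S k \<omega>) (I \<omega>) < e \<and> h ?s \<omega> = x + integral {0..?s} (\<lambda>s. b (h s \<omega>)) + I \<omega>"
      have "S k \<omega> = (\<Sum>j<i*Suc k. \<i> * of_real c * ((h (grid t (m * Suc k) j) \<omega> + h (grid t (m * Suc k) (Suc j)) \<omega>) / 2
     * of_real (incr W t (m * Suc k) j \<omega>)))"
        unfolding S_def incr_def by (intro sum.cong) (auto simp: field_simps)
      then show "norm ((\<Sum>j<i*Suc k. \<i> * of_real c * ((h (grid t (m * Suc k) j) \<omega> + h (grid t (m * Suc k) (Suc j)) \<omega>) / 2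
     * of_real (incr W t (m * Suc k) j \<omega>))) - (h (grid t m i) \<omega> - x - integral {0..grid t m i} (\<lambda>s. b (h s \<omega>)))) \<le> e"
        using * by (simp add: dist_norm)
    qed simp
  qed
qed

lemma block_sums_in_prob:
  assumes "0 < t" "0 < m" "0 < e" "0 < r"
  shows "\<exists>k>0. whp r (\<lambda>\<omega>. \<forall>i<m. norm (\<i> * of_real c * (\<Sum>j\<in>{i*k..<i*k+k}. (h (grid t (m * k) j) \<omega> + h (grid t (m * k) (Suc j)) \<omega>) / 2
     * of_real (incr W t (m * k) j \<omega>)) - (incr h t m i \<omega> - integral {grid t m i..grid t m (Suc i)} (\<lambda>s. b (h s \<omega>)))) \<le> e)"
proof -
  define T where "T k j \<omega> = \<i> * of_real c * ((h (grid t (m * k) j) \<omega> + h (grid t (m * k) (Suc j)) \<omega>) / 2 * of_real (incr W t (m * k) j \<omega>))" for k j \<omega>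
  define R where "R i \<omega> = h (grid t m i) \<omega> - x - integral {0..grid t m i} (\<lambda>s. b (h s \<omega>))" for i \<omega>
  \<comment> \<open>There are \<open>m + 1\<close> coarse points to control, hence
    \<open>r / Suc m\<close>; a block is the difference of two partial sums, hence
    \<open>e / 2\<close>. As \<open>m\<close> is fixed, one refinement serves all points.\<close>
  have "\<forall>\<^sub>F k in sequentially. \<forall>i\<in>{..m}. whp (r / real (Suc m)) (\<lambda>\<omega>. norm ((\<Sum>j<i*Suc k. T (Suc k) j \<omega>) - R i \<omega>) \<le> e / 2)"
    unfolding T_def R_def using assms
    by (intro eventually_ball_finite ballI sums_in_prob) (auto simp del: of_nat_Suc)
  then obtain k' where k': "\<forall>i\<in>{..m}. whp (r / real (Suc m)) (\<lambda>\<omega>. norm ((\<Sum>j<i*Suc k'. T (Suc k') j \<omega>) - R i \<omega>) \<le> e / 2)"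
    by (auto simp: eventually_sequentially)
  define k where "k = Suc k'"
  have "whp (\<Sum>i\<in>{..m}. r / real (Suc m)) (\<lambda>\<omega>. \<forall>i\<in>{..m}. norm ((\<Sum>j<i*k. T k j \<omega>) - R i \<omega>) \<le> e / 2)"
    using k' unfolding k_def by (intro whp_Ball_finite) auto
  then have 1: "whp r (\<lambda>\<omega>. \<forall>i\<in>{..m}. norm ((\<Sum>j<i*k. T k j \<omega>) - R i \<omega>) \<le> e / 2)"
    by simp
  have "AE \<omega> in M. continuous_on {0..} (\<lambda>s. b (h s \<omega>))"
    using b_h_adapted by (simp add: continuous_adapted_def)
  from whp_conj[OF 1 AE_imp_whp[OF this order_refl]]
  have "whp r (\<lambda>\<omega>. \<forall>i<m. norm (\<i> * of_real c * (\<Sum>j\<in>{i*k..<i*k+k}. (h (grid t (m * k) j) \<omega> + h (grid t (m * k) (Suc j)) \<omega>) / 2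
     * of_real (incr W t (m * k) j \<omega>)) - (incr h t m i \<omega> - integral {grid t m i..grid t m (Suc i)} (\<lambda>s. b (h s \<omega>)))) \<le> e)"
  proof (rule whp_mono)
    fix \<omega>
    assume *: "(\<forall>i\<in>{..m}. norm ((\<Sum>j<i*k. T k j \<omega>) - R i \<omega>) \<le> e / 2) \<and> continuous_on {0..} (\<lambda>s. b (h s \<omega>))"

    let ?f = "\<lambda>s. b (h s \<omega>)"
    show "\<forall>i<m. norm (\<i> * of_real c * (\<Sum>j\<in>{i*k..<i*k+k}. (h (grid t (m * k) j) \<omega> + h (grid t (m * k) (Suc j)) \<omega>) / 2
     * of_real (incr W t (m * k) j \<omega>)) - (incr h t m i \<omega> - integral {grid t m i..grid t m (Suc i)} ?f)) \<le> e"
    proof (intro allI impI)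
    fix i assume "i < m"
    have c: "continuous_on {0..t} ?f" using * by (auto intro: continuous_on_subset)
    have "integral {0..grid t m (Suc i)} ?f = integral {0..grid t m i} ?f + integral {grid t m i..grid t m (Suc i)} ?f"
      using integral_grid_split[OF c, of "Suc i" m] integral_grid_split[OF c, of i m] \<open>i < m\<close> assms by simp
    then have R: "R (Suc i) \<omega> - R i \<omega> = incr h t m i \<omega> - integral {grid t m i..grid t m (Suc i)} ?f"
      by (simp add: R_def incr_def)
    have "{..<Suc i * k} = {..<i*k} \<union> {i*k..<i*k+k}" by auto
    then have S: "(\<Sum>j<Suc i*k. T k j \<omega>) = (\<Sum>j<i*k. T k j \<omega>) + (\<Sum>j\<in>{i*k..<i*k+k}. T k j \<omega>)"
      by (simp add: sum.union_disjoint ivl_disj_int)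
    have T: "(\<Sum>j\<in>{i*k..<i*k+k}. T k j \<omega>) = \<i> * of_real c * (\<Sum>j\<in>{i*k..<i*k+k}. (h (grid t (m * k) j) \<omega> + h (grid t (m * k) (Suc j)) \<omega>) / 2
     * of_real (incr W t (m * k) j \<omega>))"
      unfolding T_def sum_distrib_left ..
    have "(\<Sum>j\<in>{i*k..<i*k+k}. T k j \<omega>) - (R (Suc i) \<omega> - R i \<omega>)
        = ((\<Sum>j<Suc i*k. T k j \<omega>) - R (Suc i) \<omega>) - ((\<Sum>j<i*k. T k j \<omega>) - R i \<omega>)"
      unfolding S by simp
    also have "norm \<dots> \<le> e / 2 + e / 2"
      using * \<open>i < m\<close> by (rule_tac order_trans[OF norm_triangle_ineq4 add_mono]) (auto simp del: mult_Suc)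
    finally show "norm (\<i> * of_real c * (\<Sum>j\<in>{i*k..<i*k+k}. (h (grid t (m * k) j) \<omega> + h (grid t (m * k) (Suc j)) \<omega>) / 2
     * of_real (incr W t (m * k) j \<omega>)) - (incr h t m i \<omega> - integral {grid t m i..grid t m (Suc i)} ?f)) \<le> e"
      unfolding T R by simp
    qed
  qed simp
  then show ?thesis by (intro exI[of _ k]) (simp add: k_def)
qed

text \<open>The local error of one coarse step when the solution is inserted into the scheme with
  explicit drift and trapezoidal noise term.\<close>

definition defect :: "real \<Rightarrow> nat \<Rightarrow> nat \<Rightarrow> 'a \<Rightarrow> complex" where
  "defect t m i \<omega> = incr h t m i \<omega> - b (h (grid t m i) \<omega>) * of_real (t / m)
     - \<i> * of_real c * ((h (grid t m i) \<omega> + h (grid t m (Suc i)) \<omega>) / 2 * of_real (incr W t m i \<omega>))"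

text \<open>
  On a refined grid the defect becomes a Levy area, that is, a sum of transforms of \<open>W\<close> and \<open>h\<close>
  with integrands that are uniformly small.
\<close>

lemma defect_eq:
  assumes "0 < k"
  shows "defect t m i \<omega> =
     (incr h t m i \<omega> - J - \<i> * of_real c * (\<Sum>j\<in>{i*k..<i*k+k}. (h (grid t (m * k) j) \<omega> + h (grid t (m * k) (Suc j)) \<omega>) / 2
     * of_real (incr W t (m * k) j \<omega>))) + (J - b (h (grid t m i) \<omega>) * of_real (t / m))
     + \<i> * of_real c / 2 * ((\<Sum>j\<in>{i*k..<i*k+k}. (h (grid t (m * k) j) \<omega> - h (grid t m i) \<omega>) * of_real (incr W t (m * k) j \<omega>))
       - (\<Sum>j\<in>{i*k..<i*k+k}. of_real (W (grid t (m * k) j) \<omega> - W (grid t m i) \<omega>) * incr h t (m * k) j \<omega>))"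
proof -
  let ?y = "\<lambda>j. h (grid t (m * k) j) \<omega>" and ?w = "\<lambda>j. complex_of_real (W (grid t (m * k) j) \<omega>)"
  have g: "grid t (m * k) (i * k) = grid t m i" "grid t (m * k) (i * k + k) = grid t m (Suc i)"
    using grid_refine[OF assms, of t m i] grid_refine[OF assms, of t m "Suc i"] by (simp_all add: add.commute)
  have "(\<Sum>j\<in>{i*k..<i*k+k}. (?y j + ?y (Suc j)) / 2 * (?w (Suc j) - ?w j))
      - (h (grid t m i) \<omega> + h (grid t m (Suc i)) \<omega>) / 2 * of_real (incr W t m i \<omega>)
    = (\<Sum>j\<in>{i*k..<i*k+k}. (?y j - h (grid t m i) \<omega>) * (?w (Suc j) - ?w j)) / 2
      - (\<Sum>j\<in>{i*k..<i*k+k}. (?w j - W (grid t m i) \<omega>) * (?y (Suc j) - ?y j)) / 2"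
    using levy_area_identity[of ?y ?w "i * k" k] by (simp add: g incr_def)
  moreover define A B C H where "A = (\<Sum>j\<in>{i*k..<i*k+k}. (?y j + ?y (Suc j)) / 2 * of_real (incr W t (m * k) j \<omega>))"
    and "B = (\<Sum>j\<in>{i*k..<i*k+k}. (?y j - h (grid t m i) \<omega>) * of_real (incr W t (m * k) j \<omega>))"
    and "C = (\<Sum>j\<in>{i*k..<i*k+k}. of_real (W (grid t (m * k) j) \<omega> - W (grid t m i) \<omega>) * incr h t (m * k) j \<omega>)"
    and "H = (h (grid t m i) \<omega> + h (grid t m (Suc i)) \<omega>) / 2 * complex_of_real (incr W t m i \<omega>)"
  ultimately have AH: "A - H = B / 2 - C / 2"
    by (simp only: incr_def of_real_diff)
  have H: "H = A - (B / 2 - C / 2)" by (subst AH[symmetric]) simp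
  show ?thesis
    unfolding defect_def A_def[symmetric] B_def[symmetric] C_def[symmetric] H_def[symmetric] H
    by (simp add: field_simps)
qed

end

text \<open>Discrete integration by parts. The sum of squares becomes a transform of
  \<open>d\<close> whose integrand, the partial sum, is known before the increment that it
  multiplies.\<close>

lemma sum_squares_eq:
  fixes d :: "nat \<Rightarrow> real"
  shows "(\<Sum>i<m. (d i)\<^sup>2) = (\<Sum>i<m. d i)\<^sup>2 - 2 * (\<Sum>i<m. (\<Sum>j<i. d j) * d i)"
  by (induction m) (simp_all add: power2_eq_square algebra_simps)

text \<open>Discrete stopping. The weight is 1 until a partial sum first exceeds \<open>e\<close>
  and 0 afterwards, so the weighted sum is the partial sum at the first exit, which the hypothesis
  forbids to be large.\<close>

lemma partial_sums_bounded:
  fixes d :: "nat \<Rightarrow> real"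
  assumes "\<bar>\<Sum>i<m. (if \<forall>l\<le>i. \<bar>\<Sum>j<l. d j\<bar> \<le> e then 1 else 0) * d i\<bar> \<le> e" "l \<le> m"
  shows "\<bar>\<Sum>j<l. d j\<bar> \<le> e"
proof (rule ccontr)
  let ?v = "\<lambda>i. if \<forall>l\<le>i. \<bar>\<Sum>j<l. d j\<bar> \<le> e then 1 else (0::real)"
  assume "\<not> \<bar>\<Sum>j<l. d j\<bar> \<le> e"
  define n where "n = (LEAST l. \<not> \<bar>\<Sum>j<l. d j\<bar> \<le> e)"
  have n: "\<not> \<bar>\<Sum>j<n. d j\<bar> \<le> e"
    unfolding n_def by (rule LeastI) fact
  have less: "\<bar>\<Sum>j<l. d j\<bar> \<le> e" if "l < n" for l
    using that not_less_Least unfolding n_def by blast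
  have "n \<le> l" unfolding n_def by (rule Least_le) fact
  then have "n \<le> m" using \<open>l \<le> m\<close> by simp
  have "?v i = (if i < n then 1 else 0)" for i
    using n less by (auto simp: not_less)
  then have "(\<Sum>i<m. ?v i * d i) = (\<Sum>i<m. if i < n then d i else 0)"
    by (intro sum.cong) auto
  also have "\<dots> = (\<Sum>i<n. d i)"
    using \<open>n \<le> m\<close> by (intro sum.mono_neutral_cong_right) auto
  finally show False using assms(1) n by simp
qed

text \<open>Two adapted weights suffice. The stopping weight \<open>v\<close> bounds all partial
  sums by \<open>e\<close>; then the truncation in \<open>u\<close> is inactive because e is at most
  1, and \<open>sum_squares_eq\<close> gives e^2 + 2 e, at most 3 e.\<close>

lemma (in prob_space) whp_sum_squares:
  fixes d :: "nat \<Rightarrow> 'a \<Rightarrow> real"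
  assumes small: "\<And>v. (\<forall>i<m. v i \<in> borel_measurable (G i) \<and> (\<forall>\<omega>. \<bar>v i \<omega>\<bar> \<le> 1)) \<Longrightarrow>
      whp r (\<lambda>\<omega>. \<bar>\<Sum>i<m. v i \<omega> * d i \<omega>\<bar> \<le> e)"
    and adapt: "\<And>i j. i < j \<Longrightarrow> j < m \<Longrightarrow> d i \<in> borel_measurable (G j)" and "e \<le> 1"
  shows "whp (2 * r) (\<lambda>\<omega>. (\<Sum>i<m. (d i \<omega>)\<^sup>2) \<le> 3 * e)"
proof -
  have S: "(\<lambda>\<omega>. \<Sum>j<l. d j \<omega>) \<in> borel_measurable (G i)" if "l \<le> i" "i < m" for i l
    using that by (intro borel_measurable_sum adapt) auto
  define v where "v i \<omega> = (if \<forall>l\<le>i. \<bar>\<Sum>j<l. d j \<omega>\<bar> \<le> e then 1 else (0::real))" for i \<omega>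
  define u where "u i \<omega> = max (-1) (min 1 (\<Sum>j<i. d j \<omega>))" for i \<omega>
  have v: "v i \<in> borel_measurable (G i)" if "i < m" for i
  proof -
    have [measurable]: "(\<lambda>\<omega>. \<Sum>j<l. d j \<omega>) \<in> borel_measurable (G i)" if "l \<in> {..i}" for l
      using S[of l i] that \<open>i < m\<close> by auto
    have "v i = (\<lambda>\<omega>. if \<forall>l\<in>{..i}. \<bar>\<Sum>j<l. d j \<omega>\<bar> \<le> e then 1 else 0)"
      by (auto simp: v_def fun_eq_iff)
    then show ?thesis by simp
  qed
  have u: "u i \<in> borel_measurable (G i)" if "i < m" for i
    unfolding u_def using S[OF order_refl that] by auto
  have "whp (r + r) (\<lambda>\<omega>. \<bar>\<Sum>i<m. v i \<omega> * d i \<omega>\<bar> \<le> e \<and> \<bar>\<Sum>i<m. u i \<omega> * d i \<omega>\<bar> \<le> e)"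
  proof (rule whp_conj; rule small; intro allI impI conjI)
    fix i \<omega> assume "i < m"
    then show "v i \<in> borel_measurable (G i)" "u i \<in> borel_measurable (G i)" by (simp_all add: v u)
    show "\<bar>v i \<omega>\<bar> \<le> 1" "\<bar>u i \<omega>\<bar> \<le> 1" by (simp_all add: v_def u_def)
  qed
  then show ?thesis
  proof (rule whp_mono)
    fix \<omega> assume *: "\<bar>\<Sum>i<m. v i \<omega> * d i \<omega>\<bar> \<le> e \<and> \<bar>\<Sum>i<m. u i \<omega> * d i \<omega>\<bar> \<le> e"
    then have Sl: "\<bar>\<Sum>j<l. d j \<omega>\<bar> \<le> e" if "l \<le> m" for l
      using partial_sums_bounded[of "\<lambda>i. d i \<omega>" e m l] that unfolding v_def by simp
    have "u i \<omega> = (\<Sum>j<i. d j \<omega>)" if "i < m" for i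
      using Sl[of i] that \<open>e \<le> 1\<close> unfolding u_def by auto
    then have "(\<Sum>i<m. (\<Sum>j<i. d j \<omega>) * d i \<omega>) = (\<Sum>i<m. u i \<omega> * d i \<omega>)"
      by (intro sum.cong) auto
    moreover have "(\<Sum>i<m. d i \<omega>)\<^sup>2 \<le> e"
    proof -
      have "0 \<le> e" using Sl[of m] by linarith
      have "(\<Sum>i<m. d i \<omega>)\<^sup>2 \<le> e\<^sup>2"
        using Sl[of m] by (intro power2_le_iff_abs_le[THEN iffD2] \<open>0 \<le> e\<close>) auto
      also have "\<dots> \<le> e * 1" unfolding power2_eq_square using \<open>0 \<le> e\<close> \<open>e \<le> 1\<close> by (intro mult_left_mono)
      finally show ?thesis by simp
    qed
    ultimately show "(\<Sum>i<m. (d i \<omega>)\<^sup>2) \<le> 3 * e"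
      unfolding sum_squares_eq[of "\<lambda>i. d i \<omega>" m] using * by linarith
  qed simp
qed

section \<open>Transforms and squares of the defects\<close>

context linear_noise_solution
begin

lemma mesh_small: "0 < t \<Longrightarrow> 0 < d \<Longrightarrow> \<exists>m0. \<forall>m\<ge>m0. 0 < m \<longrightarrow> t / real m < d"
proof -
  assume "0 < t" "0 < d"
  obtain m0 :: nat where "t / d < real m0" using reals_Archimedean2 by blast
  then have "t / real m < d" if "m0 \<le> m" "0 < m" for m
    using that \<open>0 < d\<close> \<open>0 < t\<close> by (simp add: field_simps) (smt (verit) mult_left_mono of_nat_mono)
  then show ?thesis by blast
qed

text \<open>The order of choices matters. First the mesh of \<open>m\<close> is made smaller than
  moduli of continuity of \<open>W\<close>, \<open>h\<close> and the drift; then \<open>k\<close>,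
  depending on \<open>m\<close>, makes the refined midpoint sums close to the true integrals. The
  Levy area lives on the grid with \<open>m * k\<close> cells, and its bound does not deteriorate
  with \<open>k\<close> because \<open>good\<close> is uniform over grids.\<close>

lemma whp_transform_defect:
  assumes "0 < t" "0 < e" "0 < r"
  shows "\<exists>m0. \<forall>m\<ge>m0. \<forall>v. 0 < m \<longrightarrow> (\<forall>i<m. v i \<in> borel_measurable (F (grid t m i)) \<and> (\<forall>\<omega>. norm (v i \<omega>) \<le> 1)) \<longrightarrow>
    whp r (\<lambda>\<omega>. norm (\<Sum>i<m. v i \<omega> * defect t m i \<omega>) \<le> e)"
proof -
  let ?W = "\<lambda>s \<omega>. complex_of_real (W s \<omega>)"
  \<comment> \<open>\<open>C\<close> dominates the factor |c|/2 of the Levy area and stays positive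
    for c = 0. Its two sums get e / (4 C) each and so contribute at most e/2, which leaves e/4 each
    for the sampling error and the Riemann error.\<close>
  define C where "C = \<bar>c\<bar> + 1"
  have "C > 0" by (simp add: C_def)
  have good_h: "good (\<lambda>s \<omega>. Re (h s \<omega>)) t" "good (\<lambda>s \<omega>. Im (h s \<omega>)) t"
    using h_semi \<open>0 < t\<close> by (simp_all add: good_semimartingale)
  have good_Wc: "good (\<lambda>s \<omega>. Re (?W s \<omega>)) t" "good (\<lambda>s \<omega>. Im (?W s \<omega>)) t"
  proof -
    show "good (\<lambda>s \<omega>. Re (?W s \<omega>)) t" using good_W \<open>0 < t\<close> by simp
    show "good (\<lambda>s \<omega>. Im (?W s \<omega>)) t"
      using \<open>0 < t\<close> by (intro good_orthogonal) auto
  qed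
  have pos: "0 < e / (4 * C)" "0 < r / 8" using assms \<open>C > 0\<close> by auto
  from good_small_complex[OF good_h pos]
  obtain d1 where "0 < d1" and d1: "\<forall>n>0. \<forall>v q. (\<forall>j<n. v j \<in> borel_measurable (F (grid t n j))) \<longrightarrow>
     whp q (\<lambda>\<omega>. \<forall>j<n. norm (v j \<omega>) \<le> d1) \<longrightarrow> whp (4 * q + r / 8) (\<lambda>\<omega>. norm (\<Sum>j<n. v j \<omega> * incr h t n j \<omega>) \<le> e / (4 * C))"
    by (elim exE conjE) (rule that)
  from good_small_complex[OF good_Wc pos]
  obtain d2 where "0 < d2" and d2: "\<forall>n>0. \<forall>v q. (\<forall>j<n. v j \<in> borel_measurable (F (grid t n j))) \<longrightarrow>
     whp q (\<lambda>\<omega>. \<forall>j<n. norm (v j \<omega>) \<le> d2) \<longrightarrow> whp (4 * q + r / 8) (\<lambda>\<omega>. norm (\<Sum>j<n. v j \<omega> * incr ?W t n j \<omega>) \<le> e / (4 * C))"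
    by (elim exE conjE) (rule that)
  \<comment> \<open>\<open>good_small_complex\<close> turns exceptional probability \<open>q\<close>
    into 4 q + r/8; with q = r/32 this is r/4, one quarter of the budget.\<close>
  have r32: "0 < r / 32" using assms by simp
  obtain l1 where l1: "0 < l1" "whp (r / 32) (\<lambda>\<omega>. \<forall>s\<in>{0..t}. \<forall>s'\<in>{0..t}. \<bar>s - s'\<bar> < l1 \<longrightarrow> norm (W s \<omega> - W s' \<omega>) \<le> d1)"
    using whp_modulus[OF W_adapted \<open>0 < t\<close> \<open>0 < d1\<close> r32] by blast
  obtain l2 where l2: "0 < l2" "whp (r / 32) (\<lambda>\<omega>. \<forall>s\<in>{0..t}. \<forall>s'\<in>{0..t}. \<bar>s - s'\<bar> < l2 \<longrightarrow> norm (h s \<omega> - h s' \<omega>) \<le> d2)"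
    using whp_modulus[OF h_adapted \<open>0 < t\<close> \<open>0 < d2\<close> r32] by blast
  have pos3: "0 < e / (4 * t)" "0 < r / 8" using assms by auto
  obtain l3 where l3: "0 < l3" "whp (r / 8) (\<lambda>\<omega>. \<forall>s\<in>{0..t}. \<forall>s'\<in>{0..t}. \<bar>s - s'\<bar> < l3 \<longrightarrow> norm (b (h s \<omega>) - b (h s' \<omega>)) \<le> e / (4 * t))"
    using whp_modulus[OF b_h_adapted \<open>0 < t\<close> pos3] by blast
  have cont: "AE \<omega> in M. continuous_on {0..} (\<lambda>s. b (h s \<omega>))"
    using b_h_adapted by (simp add: continuous_adapted_def)
  obtain m0 where m0: "\<And>m. m0 \<le> m \<Longrightarrow> 0 < m \<Longrightarrow> t / real m < min l1 (min l2 l3)"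
    using mesh_small[OF \<open>0 < t\<close>, of "min l1 (min l2 l3)"] l1(1) l2(1) l3(1) by auto
  show ?thesis
  proof (intro exI[of _ m0] allI impI)
    fix m :: nat and v :: "nat \<Rightarrow> 'a \<Rightarrow> complex"
    assume "m0 \<le> m" "0 < m" and v: "\<forall>i<m. v i \<in> borel_measurable (F (grid t m i)) \<and> (\<forall>\<omega>. norm (v i \<omega>) \<le> 1)"
    have mesh: "t / real m < l1" "t / real m < l2" "t / real m < l3"
      using m0[OF \<open>m0 \<le> m\<close> \<open>0 < m\<close>] by auto
    have "0 < e / (4 * m)" "0 < r / 4" using assms \<open>0 < m\<close> by auto
    from block_sums_in_prob[OF \<open>0 < t\<close> \<open>0 < m\<close> this]
    obtain k where "0 < k" and k: "whp (r / 4) (\<lambda>\<omega>. \<forall>i<m. norm (\<i> * of_real c * (\<Sum>j\<in>{i*k..<i*k+k}. (h (grid t (m * k) j) \<omega> + h (grid t (m * k) (Suc j)) \<omega>) / 2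
     * of_real (incr W t (m * k) j \<omega>)) - (incr h t m i \<omega> - integral {grid t m i..grid t m (Suc i)} (\<lambda>s. b (h s \<omega>)))) \<le> e / (4 * m))"
      by blast
    let ?n = "m * k"
    let ?g = "grid t ?n"
    have "0 < ?n" using \<open>0 < m\<close> \<open>0 < k\<close> by simp
    have div: "j div k < m" "grid t m (j div k) \<le> ?g j" "0 \<le> grid t m (j div k)" "0 \<le> ?g j" "?g j \<le> t"
      "?g j - grid t m (j div k) \<le> t / m" "grid t m (j div k) \<le> t" if "j < ?n" for j
    proof -
      show 1: "j div k < m" using that \<open>0 < k\<close> by (simp add: less_mult_imp_div_less)
      have 2: "grid t m (j div k) = ?g ((j div k) * k)" by (rule grid_refine[OF \<open>0 < k\<close>, symmetric])
      show "grid t m (j div k) \<le> ?g j" unfolding 2 using \<open>0 < t\<close> by (intro grid_mono) auto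
      have "j \<le> Suc (j div k) * k"
        using \<open>0 < k\<close> by (metis dividend_less_div_times add.commute mult_Suc less_imp_le)
      then have "?g j \<le> ?g (Suc (j div k) * k)" using \<open>0 < t\<close> by (intro grid_mono) auto
      also have "\<dots> = grid t m (Suc (j div k))" by (rule grid_refine[OF \<open>0 < k\<close>])
      finally show "?g j - grid t m (j div k) \<le> t / m" using grid_Suc_diff[of t m "j div k"] by linarith
      show "0 \<le> grid t m (j div k)" "0 \<le> ?g j" "?g j \<le> t" "grid t m (j div k) \<le> t"
        using \<open>0 < t\<close> that 1 by (auto intro: grid_nonneg grid_le)
    qed
    \<comment> \<open>The integrands of the Levy area on the fine grid: oscillations since the left
      end of the surrounding coarse cell, multiplied by the coarse weight. They are adapted and
      small by the choice of the mesh.\<close>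
    define u1 where "u1 j \<omega> = v (j div k) \<omega> * of_real (W (?g j) \<omega> - W (grid t m (j div k)) \<omega>)" for j \<omega>
    define u2 where "u2 j \<omega> = v (j div k) \<omega> * (h (?g j) \<omega> - h (grid t m (j div k)) \<omega>)" for j \<omega>
    have vm: "v (j div k) \<in> borel_measurable (F (?g j))" if "j < ?n" for j
      using v div[OF that] by (blast intro: measurable_F_mono)
    have u1m: "\<forall>j<?n. u1 j \<in> borel_measurable (F (?g j))"
    proof (intro allI impI)
      fix j assume j: "j < ?n"
      note [measurable] = vm[OF j] adapted_measurable[OF W_adapted div(3)[OF j] div(2)[OF j]]
         adapted_measurable[OF W_adapted div(4)[OF j] order_refl]
      show "u1 j \<in> borel_measurable (F (?g j))" unfolding u1_def by measurable
    qed
    have u2m: "\<forall>j<?n. u2 j \<in> borel_measurable (F (?g j))"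
    proof (intro allI impI)
      fix j assume j: "j < ?n"
      note [measurable] = vm[OF j] adapted_measurable[OF h_adapted div(3)[OF j] div(2)[OF j]]
         adapted_measurable[OF h_adapted div(4)[OF j] order_refl]
      show "u2 j \<in> borel_measurable (F (?g j))" unfolding u2_def by measurable
    qed
    have vle: "norm (v (j div k) \<omega> * z) \<le> d" if "j < ?n" "norm z \<le> d" for j \<omega> z d
      using v div(1)[OF that(1)] that(2) mult_mono[of "norm (v (j div k) \<omega>)" 1 "norm z" d] by (auto simp: norm_mult)
    have u1s: "whp (r / 32) (\<lambda>\<omega>. \<forall>j<?n. norm (u1 j \<omega>) \<le> d1)"
    proof (rule whp_mono[OF l1(2) order_refl], intro allI impI)
      fix \<omega> j assume *: "\<forall>s\<in>{0..t}. \<forall>s'\<in>{0..t}. \<bar>s - s'\<bar> < l1 \<longrightarrow> norm (W s \<omega> - W s' \<omega>) \<le> d1" and j: "j < ?n"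
      have "norm (W (?g j) \<omega> - W (grid t m (j div k)) \<omega>) \<le> d1"
        using *[rule_format, of "?g j" "grid t m (j div k)"] div[OF j] mesh by auto
      then show "norm (u1 j \<omega>) \<le> d1" unfolding u1_def by (intro vle[OF j]) (simp add: norm_of_real del: of_real_diff)
    qed
    have u2s: "whp (r / 32) (\<lambda>\<omega>. \<forall>j<?n. norm (u2 j \<omega>) \<le> d2)"
    proof (rule whp_mono[OF l2(2) order_refl], intro allI impI)
      fix \<omega> j assume *: "\<forall>s\<in>{0..t}. \<forall>s'\<in>{0..t}. \<bar>s - s'\<bar> < l2 \<longrightarrow> norm (h s \<omega> - h s' \<omega>) \<le> d2" and j: "j < ?n"
      have "norm (h (?g j) \<omega> - h (grid t m (j div k)) \<omega>) \<le> d2"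
        using *[rule_format, of "?g j" "grid t m (j div k)"] div[OF j] mesh by auto
      then show "norm (u2 j \<omega>) \<le> d2" unfolding u2_def by (rule vle[OF j])
    qed
    have t1: "whp (r / 4) (\<lambda>\<omega>. norm (\<Sum>j<?n. u1 j \<omega> * incr h t ?n j \<omega>) \<le> e / (4 * C))"
      using d1[THEN spec, THEN mp, THEN spec, THEN spec, THEN mp, THEN mp, OF \<open>0 < ?n\<close> u1m u1s]
      by (rule whp_mono) auto
    have t2: "whp (r / 4) (\<lambda>\<omega>. norm (\<Sum>j<?n. u2 j \<omega> * incr ?W t ?n j \<omega>) \<le> e / (4 * C))"
      using d2[THEN spec, THEN mp, THEN spec, THEN spec, THEN mp, THEN mp, OF \<open>0 < ?n\<close> u2m u2s]
      by (rule whp_mono) auto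
    have t3: "whp (r / 4) (\<lambda>\<omega>. (\<forall>s\<in>{0..t}. \<forall>s'\<in>{0..t}. \<bar>s - s'\<bar> < l3 \<longrightarrow> norm (b (h s \<omega>) - b (h s' \<omega>)) \<le> e / (4 * t))
        \<and> continuous_on {0..} (\<lambda>s. b (h s \<omega>)))"
      using whp_conj[OF l3(2) AE_imp_whp[OF cont order_refl]] by (rule whp_mono) (use assms in auto)
    from whp_conj[OF whp_conj[OF t1 t2] whp_conj[OF t3 k]]
    show "whp r (\<lambda>\<omega>. norm (\<Sum>i<m. v i \<omega> * defect t m i \<omega>) \<le> e)"
    proof (rule whp_mono)
      show "r / 4 + r / 4 + (r / 4 + r / 4) \<le> r" by simp
      fix \<omega>
      let ?J = "\<lambda>i. integral {grid t m i..grid t m (Suc i)} (\<lambda>s. b (h s \<omega>))"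
      let ?B = "\<lambda>i. \<i> * of_real c * (\<Sum>j\<in>{i*k..<i*k+k}. (h (?g j) \<omega> + h (?g (Suc j)) \<omega>) / 2 * of_real (incr W t ?n j \<omega>))"
      assume *: "(norm (\<Sum>j<?n. u1 j \<omega> * incr h t ?n j \<omega>) \<le> e / (4 * C) \<and> norm (\<Sum>j<?n. u2 j \<omega> * incr ?W t ?n j \<omega>) \<le> e / (4 * C)) \<and>
        ((\<forall>s\<in>{0..t}. \<forall>s'\<in>{0..t}. \<bar>s - s'\<bar> < l3 \<longrightarrow> norm (b (h s \<omega>) - b (h s' \<omega>)) \<le> e / (4 * t)) \<and> continuous_on {0..} (\<lambda>s. b (h s \<omega>))) \<and>
        (\<forall>i<m. norm (?B i - (incr h t m i \<omega> - ?J i)) \<le> e / (4 * m))"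
      have vle1: "norm (v i \<omega> * z) \<le> d" if "i < m" "norm z \<le> d" for i z d
        using v that mult_mono[of "norm (v i \<omega>)" 1 "norm z" d] by (auto simp: norm_mult)
      have cb: "continuous_on {0..t} (\<lambda>s. b (h s \<omega>))" using * by (auto intro: continuous_on_subset)
      define X1 where "X1 = (\<Sum>i<m. v i \<omega> * (incr h t m i \<omega> - ?J i - ?B i))"
      define X2 where "X2 = (\<Sum>i<m. v i \<omega> * (?J i - b (h (grid t m i) \<omega>) * of_real (t / m)))"
      define X3 where "X3 = (\<Sum>i<m. v i \<omega> * (\<Sum>j\<in>{i*k..<i*k+k}. (h (?g j) \<omega> - h (grid t m i) \<omega>) * of_real (incr W t ?n j \<omega>)))"
      define X4 where "X4 = (\<Sum>i<m. v i \<omega> * (\<Sum>j\<in>{i*k..<i*k+k}. of_real (W (?g j) \<omega> - W (grid t m i) \<omega>) * incr h t ?n j \<omega>))"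
      have "(\<Sum>i<m. v i \<omega> * defect t m i \<omega>) = X1 + X2 + \<i> * of_real c / 2 * (X3 - X4)"
      proof -
        define a1 where "a1 i = incr h t m i \<omega> - ?J i - ?B i" for i
        define a2 where "a2 i = ?J i - b (h (grid t m i) \<omega>) * of_real (t / m)" for i
        define a3 where "a3 i = (\<Sum>j\<in>{i*k..<i*k+k}. (h (?g j) \<omega> - h (grid t m i) \<omega>) * of_real (incr W t ?n j \<omega>))" for i
        define a4 where "a4 i = (\<Sum>j\<in>{i*k..<i*k+k}. of_real (W (?g j) \<omega> - W (grid t m i) \<omega>) * incr h t ?n j \<omega>)" for i
        have "v i \<omega> * defect t m i \<omega> = v i \<omega> * a1 i + v i \<omega> * a2 i + \<i> * of_real c / 2 * (v i \<omega> * a3 i - v i \<omega> * a4 i)" for i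
        proof -
          have "defect t m i \<omega> = a1 i + a2 i + \<i> * of_real c / 2 * (a3 i - a4 i)"
            unfolding a1_def a2_def a3_def a4_def by (rule defect_eq[OF \<open>0 < k\<close>])
          then show ?thesis by (simp only: distrib_left right_diff_distrib mult.left_commute)
        qed
        then show ?thesis
          unfolding X1_def X2_def X3_def X4_def a1_def[symmetric] a2_def[symmetric] a3_def[symmetric] a4_def[symmetric]
          by (simp only: sum.distrib sum_distrib_left[symmetric] sum_subtractf)
      qed
      moreover have "norm X1 \<le> e / 4"
      proof -
        have "norm X1 \<le> (\<Sum>i<m. e / (4 * m))"
          unfolding X1_def
        proof (rule sum_norm_le)
          fix i assume "i \<in> {..<m}"
          then have "norm (?B i - (incr h t m i \<omega> - ?J i)) \<le> e / (4 * m)" using * by blast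
          then show "norm (v i \<omega> * (incr h t m i \<omega> - ?J i - ?B i)) \<le> e / (4 * m)"
            using \<open>i \<in> {..<m}\<close> by (intro vle1) (auto simp: norm_minus_commute)
        qed
        then show ?thesis using \<open>0 < m\<close> by simp
      qed
      moreover have "norm X2 \<le> e / 4"
      proof -
        have "norm X2 \<le> (\<Sum>i<m. e / (4 * t) * (t / m))"
          unfolding X2_def
        proof (rule sum_norm_le)
          fix i assume "i \<in> {..<m}"
          then show "norm (v i \<omega> * (?J i - b (h (grid t m i) \<omega>) * of_real (t / m))) \<le> e / (4 * t) * (t / m)"
            using * assms mesh by (intro vle1 riemann_block[OF cb, where d=l3]) auto
        qed
        then show ?thesis using \<open>0 < m\<close> \<open>0 < t\<close> by simp
      qed
      moreover
      have dk: "j div k = i" if "j \<in> {i*k..<i*k+k}" for i j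
        using that by (auto simp: div_nat_eqI mult.commute)
      have "norm X3 \<le> e / (4 * C)"
      proof -
        have "X3 = (\<Sum>i<m. v i \<omega> * (\<Sum>j\<in>{i*k..<i*k+k}. (h (?g j) \<omega> - h (grid t m (j div k)) \<omega>) * of_real (incr W t ?n j \<omega>)))"
          unfolding X3_def
          by (intro sum.cong refl arg_cong2[where f="(*)"]) (simp add: dk)
        also have "\<dots> = (\<Sum>j<?n. u2 j \<omega> * incr ?W t ?n j \<omega>)"
          unfolding sum_blocks[OF \<open>0 < k\<close>] u2_def by (simp add: incr_def mult.assoc)
        finally show ?thesis using * by simp
      qed
      moreover have "norm X4 \<le> e / (4 * C)"
      proof -
        have "X4 = (\<Sum>i<m. v i \<omega> * (\<Sum>j\<in>{i*k..<i*k+k}. of_real (W (?g j) \<omega> - W (grid t m (j div k)) \<omega>) * incr h t ?n j \<omega>))"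
          unfolding X4_def
          by (intro sum.cong refl arg_cong2[where f="(*)"]) (simp add: dk)
        also have "\<dots> = (\<Sum>j<?n. u1 j \<omega> * incr h t ?n j \<omega>)"
          unfolding sum_blocks[OF \<open>0 < k\<close>] u1_def by (simp only: mult.assoc)
        finally show ?thesis using * by simp
      qed
      moreover have "norm (\<i> * of_real c / 2 * (X3 - X4)) \<le> e / 2"
      proof -
        have "norm (\<i> * of_real c / 2 * (X3 - X4)) \<le> C * (e / (4 * C) + e / (4 * C))"
          unfolding norm_mult
        proof (rule mult_mono)
          show "norm (X3 - X4) \<le> e / (4 * C) + e / (4 * C)"
            using \<open>norm X3 \<le> e / (4 * C)\<close> \<open>norm X4 \<le> e / (4 * C)\<close> norm_triangle_ineq4[of X3 X4] by linarith
        qed (use \<open>C > 0\<close> in \<open>auto simp: C_def norm_mult norm_divide\<close>)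
        also have "\<dots> = e / 2" using \<open>C > 0\<close> by (simp add: field_simps)
        finally show ?thesis .
      qed
      ultimately show "norm (\<Sum>i<m. v i \<omega> * defect t m i \<omega>) \<le> e"
        using norm_triangle_ineq[of "X1 + X2" "\<i> * of_real c / 2 * (X3 - X4)"] norm_triangle_ineq[of X1 X2] by simp
    qed
  qed
qed

lemma defect_adapted:
  assumes "0 < t" "0 < m" "i < j"
  shows "defect t m i \<in> borel_measurable (F (grid t m j))"
proof -
  have g: "0 \<le> grid t m i" "0 \<le> grid t m (Suc i)" "grid t m i \<le> grid t m j" "grid t m (Suc i) \<le> grid t m j"
    using assms by (auto intro: grid_nonneg grid_mono)
  note [measurable] = adapted_measurable[OF h_adapted g(1,3)] adapted_measurable[OF h_adapted g(2,4)]
    adapted_measurable[OF W_adapted g(1,3)] adapted_measurable[OF W_adapted g(2,4)]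
    borel_measurable_continuous_onI[OF b_cont]
  show ?thesis unfolding defect_def incr_def by measurable
qed

lemma whp_defect_squares:
  assumes "0 < t" "0 < e" "0 < r"
  shows "\<exists>m0. \<forall>m\<ge>m0. 0 < m \<longrightarrow> whp r (\<lambda>\<omega>. (\<Sum>i<m. (norm (defect t m i \<omega>))\<^sup>2) \<le> e)"
proof -
  \<comment> \<open>Real and imaginary parts contribute 3 d each, hence e/6; the bound 1 is required
    by \<open>whp_sum_squares\<close>.\<close>
  define d where "d = min 1 (e / 6)"
  have d: "0 < d" "d \<le> 1" "6 * d \<le> e" using assms by (auto simp: d_def)
  have "0 < r / 4" using assms by simp
  from whp_transform_defect[OF \<open>0 < t\<close> d(1) this]
  obtain m0 where m0: "\<And>m v. m0 \<le> m \<Longrightarrow> 0 < m \<Longrightarrow> \<forall>i<m. v i \<in> borel_measurable (F (grid t m i)) \<and> (\<forall>\<omega>. norm (v i \<omega>) \<le> 1) \<Longrightarrow>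
    whp (r / 4) (\<lambda>\<omega>. norm (\<Sum>i<m. v i \<omega> * defect t m i \<omega>) \<le> d)"
    by blast
  show ?thesis
  proof (intro exI[of _ m0] allI impI)
    fix m :: nat assume m: "m0 \<le> m" "0 < m"
    have tr: "whp (r / 4) (\<lambda>\<omega>. \<bar>\<Sum>i<m. v i \<omega> * Re (defect t m i \<omega>)\<bar> \<le> d)"
      "whp (r / 4) (\<lambda>\<omega>. \<bar>\<Sum>i<m. v i \<omega> * Im (defect t m i \<omega>)\<bar> \<le> d)"
      if v: "\<forall>i<m. v i \<in> borel_measurable (F (grid t m i)) \<and> (\<forall>\<omega>. \<bar>v i \<omega>\<bar> \<le> 1)" for v :: "nat \<Rightarrow> 'a \<Rightarrow> real"
    proof -
      have "whp (r / 4) (\<lambda>\<omega>. norm (\<Sum>i<m. of_real (v i \<omega>) * defect t m i \<omega>) \<le> d)"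
        using v by (intro m0[OF m]) auto
      note W = whp_mono[OF this order_refl]
      show "whp (r / 4) (\<lambda>\<omega>. \<bar>\<Sum>i<m. v i \<omega> * Re (defect t m i \<omega>)\<bar> \<le> d)"
      proof (rule W)
        fix \<omega> assume "norm (\<Sum>i<m. of_real (v i \<omega>) * defect t m i \<omega>) \<le> d"
        then show "\<bar>\<Sum>i<m. v i \<omega> * Re (defect t m i \<omega>)\<bar> \<le> d"
          using abs_Re_le_cmod[of "\<Sum>i<m. of_real (v i \<omega>) * defect t m i \<omega>"] by simp
      qed
      show "whp (r / 4) (\<lambda>\<omega>. \<bar>\<Sum>i<m. v i \<omega> * Im (defect t m i \<omega>)\<bar> \<le> d)"
      proof (rule W)
        fix \<omega> assume "norm (\<Sum>i<m. of_real (v i \<omega>) * defect t m i \<omega>) \<le> d"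
        then show "\<bar>\<Sum>i<m. v i \<omega> * Im (defect t m i \<omega>)\<bar> \<le> d"
          using abs_Im_le_cmod[of "\<Sum>i<m. of_real (v i \<omega>) * defect t m i \<omega>"] by simp
      qed
    qed
    have "whp (2 * (r / 4)) (\<lambda>\<omega>. (\<Sum>i<m. (Re (defect t m i \<omega>))\<^sup>2) \<le> 3 * d)"
      by (rule whp_sum_squares[where G="\<lambda>i. F (grid t m i)"])
        (use tr(1) defect_adapted[OF \<open>0 < t\<close> m(2)] d in auto)
    moreover have "whp (2 * (r / 4)) (\<lambda>\<omega>. (\<Sum>i<m. (Im (defect t m i \<omega>))\<^sup>2) \<le> 3 * d)"
      by (rule whp_sum_squares[where G="\<lambda>i. F (grid t m i)"])
        (use tr(2) defect_adapted[OF \<open>0 < t\<close> m(2)] d in auto)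
    ultimately have "whp (2 * (r / 4) + 2 * (r / 4)) (\<lambda>\<omega>. (\<Sum>i<m. (Re (defect t m i \<omega>))\<^sup>2) \<le> 3 * d \<and> (\<Sum>i<m. (Im (defect t m i \<omega>))\<^sup>2) \<le> 3 * d)"
      by (rule whp_conj)
    then show "whp r (\<lambda>\<omega>. (\<Sum>i<m. (norm (defect t m i \<omega>))\<^sup>2) \<le> e)"
      by (rule whp_mono) (use d in \<open>auto simp: cmod_power2 sum.distrib\<close>)
  qed
qed

end

subsection \<open>Removing the noise by a rotation\<close>

lemma norm_exp_i_minus_one_le: "norm (exp (- (\<i> * of_real \<theta>)) - 1) \<le> \<bar>\<theta>\<bar>"
  using iexp_approx1[of "-\<theta>" 0] by simp

lemma abs_cos_minus_one_le: "\<bar>cos \<theta> - 1\<bar> \<le> (\<theta>::real)\<^sup>2"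
proof -
  have "norm (iexp \<theta> - (\<Sum>k\<le>1. (\<i> * \<theta>) ^ k / fact k)) \<le> \<theta>\<^sup>2 / 2"
    using iexp_approx1[of \<theta> 1] by (simp add: numeral_2_eq_2)
  moreover have "Re (iexp \<theta> - (\<Sum>k\<le>1. (\<i> * \<theta>) ^ k / fact k)) = cos \<theta> - 1"
    by (simp add: Re_exp)
  ultimately have "\<bar>cos \<theta> - 1\<bar> \<le> \<theta>\<^sup>2 / 2"
    using abs_Re_le_cmod[of "iexp \<theta> - (\<Sum>k\<le>1. (\<i> * \<theta>) ^ k / fact k)"] by linarith
  then show ?thesis using zero_le_power2[of \<theta>] by linarith
qed

lemma abs_minus_sin_le: "\<bar>\<theta> - sin \<theta>\<bar> \<le> \<bar>\<theta>::real\<bar> * \<theta>\<^sup>2"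
proof -
  have "norm (iexp \<theta> - (\<Sum>k\<le>2. (\<i> * \<theta>) ^ k / fact k)) \<le> \<bar>\<theta>\<bar> ^ 3 / 6"
    using iexp_approx1[of \<theta> 2] by (simp add: fact_numeral numeral_3_eq_3)
  moreover have "Im (iexp \<theta> - (\<Sum>k\<le>2. (\<i> * \<theta>) ^ k / fact k)) = sin \<theta> - \<theta>"
    by (simp add: Im_exp numeral_2_eq_2)
  ultimately have "\<bar>\<theta> - sin \<theta>\<bar> \<le> \<bar>\<theta>\<bar> ^ 3 / 6"
    using abs_Im_le_cmod[of "iexp \<theta> - (\<Sum>k\<le>2. (\<i> * \<theta>) ^ k / fact k)"] by linarith
  also have "\<dots> \<le> \<bar>\<theta>\<bar> ^ 3" by simp
  also have "\<dots> = \<bar>\<theta>\<bar> * \<theta>\<^sup>2" by (simp add: power3_eq_cube power2_eq_square)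
  finally show ?thesis .
qed

text \<open>Rotating by half the angle makes the first-order error terms cancel symmetrically.\<close>

lemma rotated_increment:
  fixes p q :: complex and \<theta> :: real
  shows "exp (- (\<i> * of_real (2 * \<theta>))) * q - p
    = exp (- (\<i> * of_real \<theta>)) * ((q - p) * of_real (cos \<theta>) - \<i> * (p + q) * of_real (sin \<theta>))"
proof -
  let ?e = "exp (- (\<i> * of_real \<theta>))" and ?f = "exp (\<i> * of_real \<theta>)"
  have e: "?e = of_real (cos \<theta>) - \<i> * of_real (sin \<theta>)"
    using cis_conv_exp[of "-\<theta>"] by (simp add: cis.code Complex_eq)
  have f: "?f = of_real (cos \<theta>) + \<i> * of_real (sin \<theta>)"
    using cis_conv_exp[of "\<theta>"] by (simp add: cis.code Complex_eq)
  have "?e * ?f = 1" by (simp flip: exp_add)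
  moreover have "- (\<i> * complex_of_real (2 * \<theta>)) = - (\<i> * of_real \<theta>) + - (\<i> * of_real \<theta>)"
    by simp
  then have "exp (- (\<i> * of_real (2 * \<theta>))) = ?e * ?e"
    by (simp only: exp_add)
  ultimately have "exp (- (\<i> * of_real (2 * \<theta>))) * q - p = ?e * (?e * q - ?f * p)"
    by (simp add: right_diff_distrib mult.assoc[symmetric])
  also have "?e * q - ?f * p = (q - p) * of_real (cos \<theta>) - \<i> * (p + q) * of_real (sin \<theta>)"
    unfolding e f by (simp add: algebra_simps)
  finally show ?thesis .
qed

lemma rotated_increment_error:
  fixes p q D \<beta> :: complex and \<theta> :: real
  assumes D: "D = q - p - \<beta> - 2 * \<i> * of_real \<theta> * ((p + q) / 2)"
    and "norm p \<le> L" "norm q \<le> L" "norm (q - p) \<le> \<eta>" "\<bar>\<theta>\<bar> \<le> \<eta>"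
  shows "norm (exp (- (\<i> * of_real (2 * \<theta>))) * q - p - \<beta> - D)
     \<le> (\<eta> + 2 * L * \<eta>) * \<theta>\<^sup>2 + \<bar>\<theta>\<bar> * (norm D + norm \<beta>)"
proof -
  let ?e = "exp (- (\<i> * of_real \<theta>))"
  define X where "X = (q - p) * of_real (cos \<theta> - 1) + \<i> * (p + q) * of_real (\<theta> - sin \<theta>)"
  have "q - p - \<i> * (p + q) * of_real \<theta> = \<beta> + D" unfolding D by simp
  then have "(q - p) * of_real (cos \<theta>) - \<i> * (p + q) * of_real (sin \<theta>) = X + (\<beta> + D)"
    unfolding X_def by (simp add: algebra_simps)
  then have "exp (- (\<i> * of_real (2 * \<theta>))) * q - p - \<beta> - D = ?e * X + (?e - 1) * (\<beta> + D)"
    unfolding rotated_increment by (simp add: algebra_simps)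
  also have "norm \<dots> \<le> norm X + \<bar>\<theta>\<bar> * (norm D + norm \<beta>)"
  proof (rule norm_triangle_le[OF add_mono])
    show "norm (?e * X) \<le> norm X" by (simp add: norm_mult)
    show "norm ((?e - 1) * (\<beta> + D)) \<le> \<bar>\<theta>\<bar> * (norm D + norm \<beta>)"
      unfolding norm_mult using norm_triangle_ineq[of \<beta> D]
      by (intro mult_mono norm_exp_i_minus_one_le) auto
  qed
  also have "norm X \<le> \<eta> * \<theta>\<^sup>2 + (2 * L) * (\<eta> * \<theta>\<^sup>2)"
    unfolding X_def
  proof (rule norm_triangle_le[OF add_mono])
    show "norm ((q - p) * of_real (cos \<theta> - 1)) \<le> \<eta> * \<theta>\<^sup>2"
      unfolding norm_mult norm_of_real using assms
      by (intro mult_mono abs_cos_minus_one_le) (auto intro: order_trans[OF norm_ge_zero])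
    have "\<bar>\<theta> - sin \<theta>\<bar> \<le> \<eta> * \<theta>\<^sup>2"
      using assms by (intro order_trans[OF abs_minus_sin_le] mult_right_mono) auto
    moreover have "norm (p + q) \<le> 2 * L"
      using assms norm_triangle_ineq[of p q] by linarith
    ultimately have "norm (p + q) * \<bar>\<theta> - sin \<theta>\<bar> \<le> 2 * L * (\<eta> * \<theta>\<^sup>2)"
      using norm_ge_zero[of "p + q"] by (intro mult_mono) linarith+
    then show "norm (\<i> * (p + q) * of_real (\<theta> - sin \<theta>)) \<le> 2 * L * (\<eta> * \<theta>\<^sup>2)"
      unfolding norm_mult norm_of_real by simp
  qed
  finally show ?thesis by (simp add: algebra_simps)
qed

text \<open>Young's inequality, meant for |\<theta>| * |D|: when the squares of the angles have
  bounded sum and those of the defects have sum at most \<eta>^2, both parts sum to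
  O(\<eta>).\<close>

lemma mult_le_weighted_squares:
  fixes a b \<eta> :: real
  assumes "0 < \<eta>"
  shows "a * b \<le> \<eta> * a\<^sup>2 + b\<^sup>2 / \<eta>"
proof -
  have "0 \<le> (\<eta> * a - b)\<^sup>2 + (\<eta> * a)\<^sup>2 + b\<^sup>2" by simp
  then have "a * b * \<eta> \<le> \<eta> * a\<^sup>2 * \<eta> + b\<^sup>2"
    by (simp add: power2_eq_square algebra_simps)
  then have "a * b \<le> (\<eta> * a\<^sup>2 * \<eta> + b\<^sup>2) / \<eta>"
    using assms by (simp only: pos_le_divide_eq)
  then show ?thesis using assms by (simp add: add_divide_distrib)
qed

lemma norm_sum_combine:
  fixes X x I P Q R :: complex
  assumes "X - x = P + Q + R" "norm (I - P) \<le> e / 4" "norm Q \<le> e / 4" "norm R \<le> e / 4" "0 < e"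
  shows "norm (X - x - I) \<le> e"
proof -
  have "X - x - I = Q + R - (I - P)" using assms(1) by simp
  then have "norm (X - x - I) \<le> norm (Q + R) + norm (I - P)"
    by (simp only: norm_triangle_ineq4)
  then show ?thesis
    using norm_triangle_ineq[of Q R] assms(2-) by linarith
qed

section \<open>Passage to the limit in the rotated equation\<close>

context linear_noise_solution
begin

definition rotation :: "real \<Rightarrow> 'a \<Rightarrow> complex" where
  "rotation s \<omega> = exp (- (\<i> * of_real (c * W s \<omega>)))"

lemma norm_rotation [simp]: "norm (rotation s \<omega>) = 1"
  by (simp add: rotation_def)

lemma rotation_adapted: "continuous_adapted M F rotation"
proof -
  have "AE \<omega> in M. continuous_on {0..} (\<lambda>s. W s \<omega>)"
    using W_adapted by (simp add: continuous_adapted_def)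
  then have "AE \<omega> in M. continuous_on {0..} (\<lambda>s. rotation s \<omega>)"
    unfolding rotation_def by eventually_elim (intro continuous_intros)
  moreover have "rotation s \<in> borel_measurable (F s)" if "0 \<le> s" for s
  proof -
    have [measurable]: "W s \<in> borel_measurable (F s)" using adapted_measurable[OF W_adapted that order_refl] .
    show ?thesis unfolding rotation_def by measurable
  qed
  ultimately show ?thesis by (simp add: continuous_adapted_def)
qed

lemma rotated_drift_adapted: "continuous_adapted M F (\<lambda>s \<omega>. rotation s \<omega> * b (h s \<omega>))"
proof -
  have "AE \<omega> in M. continuous_on {0..} (\<lambda>s. rotation s \<omega>)" "AE \<omega> in M. continuous_on {0..} (\<lambda>s. b (h s \<omega>))"
    using rotation_adapted b_h_adapted by (auto simp: continuous_adapted_def)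
  then have "AE \<omega> in M. continuous_on {0..} (\<lambda>s. rotation s \<omega> * b (h s \<omega>))"
    by eventually_elim (intro continuous_intros)
  then show ?thesis
    using rotation_adapted b_h_adapted by (auto simp: continuous_adapted_def intro: borel_measurable_times)
qed

lemma rotation_grid_Suc:
  "rotation (grid t m (Suc i)) \<omega> = rotation (grid t m i) \<omega> * exp (- (\<i> * of_real (2 * (c * incr W t m i \<omega> / 2))))"
proof -
  have "- (\<i> * complex_of_real (c * W (grid t m (Suc i)) \<omega>)) = - (\<i> * of_real (c * W (grid t m i) \<omega>))
      + - (\<i> * of_real (2 * (c * incr W t m i \<omega> / 2)))"
    by (simp add: incr_def field_simps)
  then show ?thesis unfolding rotation_def by (simp only: exp_add)
qed

text \<open>The increments of rotation times solution telescope over one coarse grid. Each is a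
  Riemann term of the rotated drift, plus a rotated defect, plus a remainder. The rotated defects
  sum to a small transform, and the remainders are controlled absolutely by
  \<open>rotated_increment_error\<close> and the squares of the defects.\<close>

lemma rotated_solution_at:
  assumes "0 < t"
  shows "AE \<omega> in M. rotation t \<omega> * h t \<omega> = x + integral {0..t} (\<lambda>s. rotation s \<omega> * b (h s \<omega>))"
proof -
  let ?B = "\<lambda>s \<omega>. rotation s \<omega> * b (h s \<omega>)"
  have h0: "AE \<omega> in M. h 0 \<omega> = x" using sol by (simp add: stratonovich_solution_def)
  have W0: "AE \<omega> in M. W 0 \<omega> = 0" using brownian by (simp add: brownian_motion_def)
  have contB: "AE \<omega> in M. continuous_on {0..} (\<lambda>s. ?B s \<omega>)"
    using rotated_drift_adapted by (simp add: continuous_adapted_def)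
  have ae: "AE \<omega> in M. h 0 \<omega> = x \<and> W 0 \<omega> = 0 \<and> continuous_on {0..} (\<lambda>s. ?B s \<omega>)"
    using h0 W0 contB by eventually_elim simp
  have "AE \<omega> in M. norm (rotation t \<omega> * h t \<omega> - x - integral {0..t} (\<lambda>s. ?B s \<omega>)) \<le> 0"
  proof (rule whp_imp_AE_le)
    fix e r :: real assume "0 < e" "0 < r"
    \<comment> \<open>Eight events are excluded below, apart from null sets.\<close>
    define r' where "r' = r / 8"
    have "0 < r'" using \<open>0 < r\<close> by (simp add: r'_def)
    obtain L where L: "0 < L" "whp r' (\<lambda>\<omega>. \<forall>s\<in>{0..t}. norm (h s \<omega>) \<le> L)"
      using whp_bounded[OF h_adapted \<open>0 < t\<close> \<open>0 < r'\<close>] by blast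
    obtain L' where L': "0 < L'" "whp r' (\<lambda>\<omega>. \<forall>s\<in>{0..t}. norm (b (h s \<omega>)) \<le> L')"
      using whp_bounded[OF b_h_adapted \<open>0 < t\<close> \<open>0 < r'\<close>] by blast
    obtain C where C: "0 < C" "\<And>n. n > 0 \<Longrightarrow> whp r' (\<lambda>\<omega>. (\<Sum>j<n. (incr W t n j \<omega>)\<^sup>2) \<le> C)"
      using W_quadratic_variation[OF less_imp_le[OF \<open>0 < t\<close>] \<open>0 < r'\<close>] by blast
    \<comment> \<open>\<open>Q\<close> bounds the sum of the squared angles, an angle being half of
      \<open>c\<close> times an increment of \<open>W\<close>. The remainders add up to at most
      \<eta> * K, where the summand 1 of \<open>K\<close> comes from the defects, whose squares are
      made to sum to at most \<eta>^2. Hence \<eta> = e / (4 K).\<close>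
    define Q where "Q = c\<^sup>2 * C / 4"
    have "0 \<le> Q" using C by (simp add: Q_def)
    define K where "K = (2 + 2 * L) * Q + 1 + L' * t"
    have "0 < K" unfolding K_def using \<open>0 \<le> Q\<close> L(1) L'(1) \<open>0 < t\<close>
      by (intro add_nonneg_pos add_pos_pos mult_nonneg_nonneg mult_pos_pos) auto
    define \<eta> where "\<eta> = e / (4 * K)"
    have "0 < \<eta>" using \<open>0 < e\<close> \<open>0 < K\<close> by (simp add: \<eta>_def)
    have "0 < \<eta> / (\<bar>c\<bar> + 1)" using \<open>0 < \<eta>\<close> by (simp add: add_nonneg_pos)
    from whp_modulus[OF W_adapted \<open>0 < t\<close> this \<open>0 < r'\<close>]
    obtain l1 where l1: "0 < l1" "whp r' (\<lambda>\<omega>. \<forall>s\<in>{0..t}. \<forall>s'\<in>{0..t}. \<bar>s - s'\<bar> < l1 \<longrightarrow> norm (W s \<omega> - W s' \<omega>) \<le> \<eta> / (\<bar>c\<bar> + 1))"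
      by blast
    obtain l2 where l2: "0 < l2" "whp r' (\<lambda>\<omega>. \<forall>s\<in>{0..t}. \<forall>s'\<in>{0..t}. \<bar>s - s'\<bar> < l2 \<longrightarrow> norm (h s \<omega> - h s' \<omega>) \<le> \<eta>)"
      using whp_modulus[OF h_adapted \<open>0 < t\<close> \<open>0 < \<eta>\<close> \<open>0 < r'\<close>] by blast
    have "0 < e / (4 * t)" using \<open>0 < e\<close> \<open>0 < t\<close> by simp
    from whp_modulus[OF rotated_drift_adapted \<open>0 < t\<close> this \<open>0 < r'\<close>]
    obtain l3 where l3: "0 < l3" "whp r' (\<lambda>\<omega>. \<forall>s\<in>{0..t}. \<forall>s'\<in>{0..t}. \<bar>s - s'\<bar> < l3 \<longrightarrow> norm (?B s \<omega> - ?B s' \<omega>) \<le> e / (4 * t))"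
      by blast
    have "0 < e / 4" "0 < \<eta>\<^sup>2" using \<open>0 < e\<close> \<open>0 < \<eta>\<close> by auto
    obtain m1 where m1: "\<And>m v. m1 \<le> m \<Longrightarrow> 0 < m \<Longrightarrow> \<forall>i<m. v i \<in> borel_measurable (F (grid t m i)) \<and> (\<forall>\<omega>. norm (v i \<omega>) \<le> 1) \<Longrightarrow>
      whp r' (\<lambda>\<omega>. norm (\<Sum>i<m. v i \<omega> * defect t m i \<omega>) \<le> e / 4)"
      using whp_transform_defect[OF \<open>0 < t\<close> \<open>0 < e / 4\<close> \<open>0 < r'\<close>] by blast
    obtain m2 where m2: "\<And>m. m2 \<le> m \<Longrightarrow> 0 < m \<Longrightarrow> whp r' (\<lambda>\<omega>. (\<Sum>i<m. (norm (defect t m i \<omega>))\<^sup>2) \<le> \<eta>\<^sup>2)"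
      using whp_defect_squares[OF \<open>0 < t\<close> \<open>0 < \<eta>\<^sup>2\<close> \<open>0 < r'\<close>] by blast
    obtain m3 where m3: "\<And>m. m3 \<le> m \<Longrightarrow> 0 < m \<Longrightarrow> t / real m < min l1 (min l2 l3)"
      using mesh_small[OF \<open>0 < t\<close>, of "min l1 (min l2 l3)"] l1(1) l2(1) l3(1) by auto
    define m where "m = Suc (max m1 (max m2 m3))"
    have m: "m1 \<le> m" "m2 \<le> m" "m3 \<le> m" "0 < m" by (auto simp: m_def)
    have mesh: "t / real m < l1" "t / real m < l2" "t / real m < l3" using m3[OF m(3,4)] by auto
    have E1: "whp r' (\<lambda>\<omega>. norm (\<Sum>i<m. rotation (grid t m i) \<omega> * defect t m i \<omega>) \<le> e / 4)"
      using m rotation_adapted \<open>0 < t\<close> by (intro m1) (auto simp: continuous_adapted_def grid_nonneg)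
    have "whp r (\<lambda>\<omega>. (((\<forall>s\<in>{0..t}. norm (h s \<omega>) \<le> L) \<and> (\<forall>s\<in>{0..t}. norm (b (h s \<omega>)) \<le> L')) \<and>
         ((\<Sum>j<m. (incr W t m j \<omega>)\<^sup>2) \<le> C \<and> (\<forall>s\<in>{0..t}. \<forall>s'\<in>{0..t}. \<bar>s - s'\<bar> < l1 \<longrightarrow> norm (W s \<omega> - W s' \<omega>) \<le> \<eta> / (\<bar>c\<bar> + 1)))) \<and>
       (((\<forall>s\<in>{0..t}. \<forall>s'\<in>{0..t}. \<bar>s - s'\<bar> < l2 \<longrightarrow> norm (h s \<omega> - h s' \<omega>) \<le> \<eta>) \<and>
         (\<forall>s\<in>{0..t}. \<forall>s'\<in>{0..t}. \<bar>s - s'\<bar> < l3 \<longrightarrow> norm (?B s \<omega> - ?B s' \<omega>) \<le> e / (4 * t))) \<and>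
        (norm (\<Sum>i<m. rotation (grid t m i) \<omega> * defect t m i \<omega>) \<le> e / 4 \<and>
         ((\<Sum>i<m. (norm (defect t m i \<omega>))\<^sup>2) \<le> \<eta>\<^sup>2 \<and> h 0 \<omega> = x \<and> W 0 \<omega> = 0 \<and> continuous_on {0..} (\<lambda>s. ?B s \<omega>)))))"
      by (rule whp_mono[OF whp_conj[OF whp_conj[OF whp_conj[OF L(2) L'(2)] whp_conj[OF C(2)[OF m(4)] l1(2)]]
        whp_conj[OF whp_conj[OF l2(2) l3(2)] whp_conj[OF E1 whp_conj[OF m2[OF m(2,4)] AE_imp_whp[OF ae order_refl]]]]]])
        (auto simp: r'_def)
    then show "whp r (\<lambda>\<omega>. norm (rotation t \<omega> * h t \<omega> - x - integral {0..t} (\<lambda>s. ?B s \<omega>)) \<le> e)"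
    proof (rule whp_mono[OF _ order_refl])
      fix \<omega>
      let ?g = "grid t m"
      let ?Z = "\<lambda>i. rotation (?g i) \<omega>" and ?D = "\<lambda>i. defect t m i \<omega>" and ?b = "\<lambda>i. b (h (?g i) \<omega>) * of_real (t / m)"
      let ?R = "\<lambda>i. exp (- (\<i> * of_real (2 * (c * incr W t m i \<omega> / 2)))) * h (?g (Suc i)) \<omega> - h (?g i) \<omega> - ?b i - ?D i"
      let ?\<theta> = "\<lambda>i. c * incr W t m i \<omega> / 2"
      assume *: "(((\<forall>s\<in>{0..t}. norm (h s \<omega>) \<le> L) \<and> (\<forall>s\<in>{0..t}. norm (b (h s \<omega>)) \<le> L')) \<and>
         ((\<Sum>j<m. (incr W t m j \<omega>)\<^sup>2) \<le> C \<and> (\<forall>s\<in>{0..t}. \<forall>s'\<in>{0..t}. \<bar>s - s'\<bar> < l1 \<longrightarrow> norm (W s \<omega> - W s' \<omega>) \<le> \<eta> / (\<bar>c\<bar> + 1)))) \<and>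
       (((\<forall>s\<in>{0..t}. \<forall>s'\<in>{0..t}. \<bar>s - s'\<bar> < l2 \<longrightarrow> norm (h s \<omega> - h s' \<omega>) \<le> \<eta>) \<and>
         (\<forall>s\<in>{0..t}. \<forall>s'\<in>{0..t}. \<bar>s - s'\<bar> < l3 \<longrightarrow> norm (?B s \<omega> - ?B s' \<omega>) \<le> e / (4 * t))) \<and>
        (norm (\<Sum>i<m. rotation (grid t m i) \<omega> * defect t m i \<omega>) \<le> e / 4 \<and>
         ((\<Sum>i<m. (norm (defect t m i \<omega>))\<^sup>2) \<le> \<eta>\<^sup>2 \<and> h 0 \<omega> = x \<and> W 0 \<omega> = 0 \<and> continuous_on {0..} (\<lambda>s. ?B s \<omega>))))"
      have hL: "\<And>s. s \<in> {0..t} \<Longrightarrow> norm (h s \<omega>) \<le> L" and bL: "\<And>s. s \<in> {0..t} \<Longrightarrow> norm (b (h s \<omega>)) \<le> L'"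
        and QV: "(\<Sum>j<m. (incr W t m j \<omega>)\<^sup>2) \<le> C"
        and modW: "\<And>s s'. s \<in> {0..t} \<Longrightarrow> s' \<in> {0..t} \<Longrightarrow> \<bar>s - s'\<bar> < l1 \<Longrightarrow> norm (W s \<omega> - W s' \<omega>) \<le> \<eta> / (\<bar>c\<bar> + 1)"
        and modh: "\<And>s s'. s \<in> {0..t} \<Longrightarrow> s' \<in> {0..t} \<Longrightarrow> \<bar>s - s'\<bar> < l2 \<Longrightarrow> norm (h s \<omega> - h s' \<omega>) \<le> \<eta>"
        and modB: "\<forall>s\<in>{0..t}. \<forall>s'\<in>{0..t}. \<bar>s - s'\<bar> < l3 \<longrightarrow> norm (?B s \<omega> - ?B s' \<omega>) \<le> e / (4 * t)"
        and ZD: "norm (\<Sum>i<m. ?Z i * ?D i) \<le> e / 4" and DD: "(\<Sum>i<m. (norm (?D i))\<^sup>2) \<le> \<eta>\<^sup>2"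
        and init: "h 0 \<omega> = x" "W 0 \<omega> = 0" and cB: "continuous_on {0..t} (\<lambda>s. ?B s \<omega>)"
        using * by (blast, blast, blast, blast, blast, blast, blast, blast, blast, blast, auto intro: continuous_on_subset)
      have g: "?g i \<in> {0..t}" "?g (Suc i) \<in> {0..t}" "\<bar>?g (Suc i) - ?g i\<bar> = t / m" if "i < m" for i
        using that \<open>0 < t\<close> by (auto intro: grid_nonneg grid_le simp: grid_Suc_diff)
      have R: "norm (?R i) \<le> (\<eta> * (2 + 2 * L)) * (?\<theta> i)\<^sup>2 + (norm (?D i))\<^sup>2 / \<eta> + \<eta> * L' * (t / m)" if "i < m" for i
      proof -
        have inc: "\<bar>incr W t m i \<omega>\<bar> \<le> \<eta> / (\<bar>c\<bar> + 1)"
          unfolding incr_def using modW[OF g(2)[OF that] g(1)[OF that]] g(3)[OF that] mesh by simp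
        have \<theta>: "\<bar>?\<theta> i\<bar> \<le> \<eta>"
        proof -
          have "\<bar>c\<bar> * \<bar>incr W t m i \<omega>\<bar> \<le> (\<bar>c\<bar> + 1) * (\<eta> / (\<bar>c\<bar> + 1))"
            using inc by (intro mult_mono) auto
          also have "\<dots> = \<eta>" by simp
          finally show ?thesis using \<open>0 < \<eta>\<close> by (simp add: abs_mult)
        qed
        have "norm (?R i) \<le> (\<eta> + 2 * L * \<eta>) * (?\<theta> i)\<^sup>2 + \<bar>?\<theta> i\<bar> * (norm (?D i) + norm (?b i))"
        proof (rule rotated_increment_error)
          show "?D i = h (?g (Suc i)) \<omega> - h (?g i) \<omega> - ?b i - 2 * \<i> * of_real (?\<theta> i) * ((h (?g i) \<omega> + h (?g (Suc i)) \<omega>) / 2)"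
            by (simp add: defect_def incr_def)
          show "norm (h (?g (Suc i)) \<omega> - h (?g i) \<omega>) \<le> \<eta>"
            using modh[OF g(2)[OF that] g(1)[OF that]] g(3)[OF that] mesh by simp
        qed (use hL g that \<theta> in auto)
        also have "\<bar>?\<theta> i\<bar> * (norm (?D i) + norm (?b i)) \<le> (\<eta> * (?\<theta> i)\<^sup>2 + (norm (?D i))\<^sup>2 / \<eta>) + \<eta> * (L' * (t / m))"
          unfolding distrib_left
        proof (rule add_mono)
          show "\<bar>?\<theta> i\<bar> * norm (?D i) \<le> \<eta> * (?\<theta> i)\<^sup>2 + (norm (?D i))\<^sup>2 / \<eta>"
            using mult_le_weighted_squares[OF \<open>0 < \<eta>\<close>, of "\<bar>?\<theta> i\<bar>" "norm (?D i)"] by (simp only: power2_abs)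
          have "norm (?b i) \<le> L' * (t / m)"
            using mult_right_mono[OF bL[OF g(1)[OF that]], of "t / m"] \<open>0 < t\<close>
            by (simp add: norm_mult norm_divide)
          then show "\<bar>?\<theta> i\<bar> * norm (?b i) \<le> \<eta> * (L' * (t / m))"
            using \<theta> \<open>0 < \<eta>\<close> by (intro mult_mono) auto
        qed
        finally show ?thesis by (simp only: distrib_left distrib_right mult_ac add_ac) (simp add: algebra_simps)
      qed
      have "(\<Sum>i<m. (?\<theta> i)\<^sup>2) = c\<^sup>2 / 4 * (\<Sum>i<m. (incr W t m i \<omega>)\<^sup>2)"
        unfolding sum_distrib_left by (intro sum.cong) (auto simp: power2_eq_square)
      also have "\<dots> \<le> c\<^sup>2 / 4 * C" using QV by (intro mult_left_mono) auto
      finally have thQ: "(\<Sum>i<m. (?\<theta> i)\<^sup>2) \<le> Q" by (simp add: Q_def)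
      have "norm (\<Sum>i<m. ?Z i * ?R i) \<le> (\<Sum>i<m. norm (?R i))"
        by (rule order_trans[OF norm_sum]) (simp add: norm_mult del: of_real_mult of_real_divide)
      also have "\<dots> \<le> (\<Sum>i<m. (\<eta> * (2 + 2 * L)) * (?\<theta> i)\<^sup>2 + (norm (?D i))\<^sup>2 / \<eta> + \<eta> * L' * (t / m))"
        by (intro sum_mono R) auto
      also have "\<dots> = (\<eta> * (2 + 2 * L)) * (\<Sum>i<m. (?\<theta> i)\<^sup>2) + (\<Sum>i<m. (norm (?D i))\<^sup>2) / \<eta> + \<eta> * L' * t"
        using \<open>0 < m\<close> by (simp only: sum.distrib sum_distrib_left[symmetric] sum_divide_distrib[symmetric]) simp
      also have "\<dots> \<le> (\<eta> * (2 + 2 * L)) * Q + \<eta>\<^sup>2 / \<eta> + \<eta> * L' * t"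
        using thQ DD \<open>0 < \<eta>\<close> L(1) by (intro add_mono mult_left_mono divide_right_mono order_refl) auto
      also have "\<dots> = \<eta> * K" using \<open>0 < \<eta>\<close> by (simp add: K_def power2_eq_square algebra_simps)
      also have "\<dots> = e / 4" using \<open>0 < K\<close> by (simp add: \<eta>_def)
      finally have ZR: "norm (\<Sum>i<m. ?Z i * ?R i) \<le> e / 4" .
      have "?Z (Suc i) * h (?g (Suc i)) \<omega> - ?Z i * h (?g i) \<omega> = ?B (?g i) \<omega> * of_real (t / m) + ?Z i * ?D i + ?Z i * ?R i" for i
        unfolding rotation_grid_Suc by (simp only: right_diff_distrib mult.assoc) simp
      then have S1: "(\<Sum>i<m. ?Z (Suc i) * h (?g (Suc i)) \<omega> - ?Z i * h (?g i) \<omega>)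
          = (\<Sum>i<m. ?B (?g i) \<omega> * of_real (t / m)) + (\<Sum>i<m. ?Z i * ?D i) + (\<Sum>i<m. ?Z i * ?R i)"
        by (simp only: sum.distrib)
      have S2: "(\<Sum>i<m. ?Z (Suc i) * h (?g (Suc i)) \<omega> - ?Z i * h (?g i) \<omega>) = rotation t \<omega> * h t \<omega> - x"
        using sum_lessThan_telescope[of "\<lambda>i. ?Z i * h (?g i) \<omega>" m] \<open>0 < m\<close> init by (simp add: rotation_def)
      have RS: "norm (integral {0..t} (\<lambda>s. ?B s \<omega>) - (\<Sum>i<m. ?B (?g i) \<omega> * of_real (t / m))) \<le> e / 4"
        using riemann_sum[OF cB less_imp_le[OF \<open>0 < t\<close>] \<open>0 < m\<close> mesh(3) modB] \<open>0 < t\<close> by simp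
      show "norm (rotation t \<omega> * h t \<omega> - x - integral {0..t} (\<lambda>s. ?B s \<omega>)) \<le> e"
        by (rule norm_sum_combine[OF trans[OF S2[symmetric] S1] RS ZD ZR \<open>0 < e\<close>])
    qed
  qed
  then show ?thesis by eventually_elim (simp add: algebra_simps)
qed

text \<open>The identities at positive rational times hold off a common null set, and both sides are
  continuous in time.\<close>

theorem rotated_solution:
  "AE \<omega> in M. continuous_on {0..} (\<lambda>s. rotation s \<omega>) \<and> continuous_on {0..} (\<lambda>s. h s \<omega>) \<and>
     (\<forall>t\<ge>0. rotation t \<omega> * h t \<omega> = x + integral {0..t} (\<lambda>s. rotation s \<omega> * b (h s \<omega>)))"
proof -
  have contB: "AE \<omega> in M. continuous_on {0..} (\<lambda>s. rotation s \<omega> * b (h s \<omega>))"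
    using rotated_drift_adapted by (simp add: continuous_adapted_def)
  have contZ: "AE \<omega> in M. continuous_on {0..} (\<lambda>s. rotation s \<omega>)"
    using rotation_adapted by (simp add: continuous_adapted_def)
  define D where "D = {0<..} \<inter> (\<rat> :: real set)"
  have "countable D" unfolding D_def by (auto intro: countable_subset[OF _ countable_rat])
  then have "AE \<omega> in M. \<forall>t\<in>D. rotation t \<omega> * h t \<omega> = x + integral {0..t} (\<lambda>s. rotation s \<omega> * b (h s \<omega>))"
    by (subst AE_ball_countable) (auto simp: D_def intro: rotated_solution_at)
  then show ?thesis
    using contB contZ h_cont
  proof eventually_elim
    case (elim \<omega>)
    let ?B = "\<lambda>s. rotation s \<omega> * b (h s \<omega>)"
    have "rotation t \<omega> * h t \<omega> = x + integral {0..t} ?B" if "0 \<le> t" for t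
    proof -
      let ?f = "\<lambda>t. rotation t \<omega> * h t \<omega> - (x + integral {0..t} ?B)"
      have cl: "closure ({0<..<t+1} \<inter> \<rat>) = {0..t+1}" using that by (intro dense_Rats_interval) simp
      have "continuous_on {0..t+1} (\<lambda>t. integral {0..t} ?B)"
        by (intro indefinite_integral_continuous_1 integrable_continuous_interval continuous_on_subset[OF elim(2)]) auto
      then have "continuous_on (closure ({0<..<t+1} \<inter> \<rat>)) ?f"
        unfolding cl by (intro continuous_intros continuous_on_subset[OF elim(3)] continuous_on_subset[OF elim(4)]) auto
      then have "?f ` closure ({0<..<t+1} \<inter> \<rat>) \<subseteq> {0}"
        by (rule image_closure_subset) (use elim(1) in \<open>auto simp: D_def\<close>)
      then show ?thesis using that unfolding cl by force
    qed
    then show ?case using elim by blast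
  qed
qed

end

subsection \<open>Solutions in the closed disc\<close>

text \<open>The quotient form, read along sequences, opens derivatives of expectations to dominated
  convergence.\<close>

lemma has_vector_derivative_iff_quotient:
  fixes f :: "real \<Rightarrow> complex"
  shows "(f has_vector_derivative D) (at t within S) \<longleftrightarrow>
    ((\<lambda>u. (f u - f t) / of_real (u - t)) \<longlongrightarrow> D) (at t within S)"
proof -
  have *: "norm ((1 / norm (u - t)) *\<^sub>R (f u - (f t + (u - t) *\<^sub>R D))) = norm ((f u - f t) / of_real (u - t) - D)"
    if "u \<noteq> t" for u
  proof -
    have eq: "(f u - f t) / of_real (u - t) - D = (f u - (f t + (u - t) *\<^sub>R D)) / of_real (u - t)"
      using that by (simp add: scaleR_conv_of_real field_simps)
    show ?thesis unfolding eq by (simp add: norm_divide del: of_real_diff)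
  qed
  have "(f has_vector_derivative D) (at t within S) \<longleftrightarrow>
      ((\<lambda>u. norm ((1 / norm (u - t)) *\<^sub>R (f u - (f t + (u - t) *\<^sub>R D)))) \<longlongrightarrow> 0) (at t within S)"
    unfolding has_vector_derivative_def has_derivative_within
    by (subst tendsto_norm_zero_iff) (simp add: bounded_linear_scaleR_left)
  also have "\<dots> \<longleftrightarrow> ((\<lambda>u. norm ((f u - f t) / of_real (u - t) - D)) \<longlongrightarrow> 0) (at t within S)"
  proof (rule filterlim_cong[OF refl refl])
    have "eventually (\<lambda>u. u \<noteq> t) (at t within S)" by (simp add: eventually_at_filter)
    then show "eventually (\<lambda>u. norm ((1 / norm (u - t)) *\<^sub>R (f u - (f t + (u - t) *\<^sub>R D)))
        = norm ((f u - f t) / of_real (u - t) - D)) (at t within S)"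
      by eventually_elim (rule *)
  qed
  also have "\<dots> \<longleftrightarrow> ((\<lambda>u. (f u - f t) / of_real (u - t)) \<longlongrightarrow> D) (at t within S)"
    by (simp only: tendsto_norm_zero_iff LIM_zero_iff)
  finally show ?thesis .
qed

lemma integral_equation_derivative:
  fixes f :: "real \<Rightarrow> complex"
  assumes f: "continuous_on {0..} f" and g: "\<And>t. 0 \<le> t \<Longrightarrow> g t = x + integral {0..t} f" and "0 \<le> t"
  shows "(g has_vector_derivative f t) (at t within {0..})"
proof -
  have "continuous_on {0..t+1} f" using f by (rule continuous_on_subset) auto
  then have "((\<lambda>u. integral {0..u} f) has_vector_derivative f t) (at t within {0..t+1})"
    using \<open>0 \<le> t\<close> by (intro integral_has_vector_derivative) auto
  then have "((\<lambda>u. x + integral {0..u} f) has_vector_derivative f t) (at t within {0..t+1})"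
    using has_vector_derivative_add[OF has_vector_derivative_const] by fastforce
  moreover have "at t within {0..t+1} = at t within {0..}"
    by (rule at_within_nhd[of _ "{..<t+1}"]) auto
  ultimately have "((\<lambda>u. x + integral {0..u} f) has_vector_derivative f t) (at t within {0..})" by simp
  then show ?thesis
    by (rule has_vector_derivative_transform[rotated 2]) (use \<open>0 \<le> t\<close> g in auto)
qed

text \<open>Since |Z| = 1, 1 - |h|^2 equals 1 - |Z h|^2, and Z h is differentiable in time where h
  alone need not be. The identity Re (cnj h * (1 - h^2)) = Re h * (1 - |h|^2) makes the equation for
  1 - |h|^2 linear, with rate - 2 K Re h, and the integrating factor gives the exponential.\<close>

lemma unit_disc_defect_formula:
  fixes Z h :: "real \<Rightarrow> complex" and K :: real
  assumes Z: "continuous_on {0..} Z" "\<And>t. norm (Z t) = 1" and h: "continuous_on {0..} h"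
    and eq: "\<And>t. 0 \<le> t \<Longrightarrow> Z t * h t = x + integral {0..t} (\<lambda>s. Z s * (of_real K * (1 - (h s)\<^sup>2)))"
    and "0 \<le> t"
  shows "1 - (norm (h t))\<^sup>2 = (1 - (norm x)\<^sup>2) * exp (- 2 * K * integral {0..t} (\<lambda>s. Re (h s)))"
proof -
  let ?f = "\<lambda>s. Z s * (of_real K * (1 - (h s)\<^sup>2))"
  have cf: "continuous_on {0..} ?f" using Z h by (intro continuous_intros)
  note dg = integral_equation_derivative[OF cf eq]
  define I where "I t = integral {0..t} (\<lambda>s. Re (h s))" for t
  have cR: "continuous_on {0..} (\<lambda>s. complex_of_real (Re (h s)))" using h by (intro continuous_intros)
  have dI: "(I has_vector_derivative Re (h s)) (at s within {0..})" if "0 \<le> s" for s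
  proof -
    have "continuous_on {0..s+1} (\<lambda>s. Re (h s))"
      by (intro continuous_intros continuous_on_subset[OF h]) auto
    then have "(I has_vector_derivative Re (h s)) (at s within {0..s+1})"
      unfolding I_def using that by (intro integral_has_vector_derivative) auto
    moreover have "at s within {0..s+1} = at s within {0..}"
      by (rule at_within_nhd[of _ "{..<s+1}"]) auto
    ultimately show ?thesis by simp
  qed
  define \<rho> where "\<rho> s = 1 - (norm (h s))\<^sup>2" for s
  have rho: "\<rho> s = Re (1 - (Z s * h s) * cnj (Z s * h s))" for s
    using Z(2)[of s] unfolding complex_norm_square[symmetric] by (simp add: \<rho>_def norm_mult)
  have drho: "(\<rho> has_vector_derivative - 2 * K * Re (h s) * \<rho> s) (at s within {0..})" if "0 \<le> s" for s
  proof -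
    have "((\<lambda>s. Re (1 - (Z s * h s) * cnj (Z s * h s))) has_vector_derivative
        Re (0 - ((Z s * h s) * cnj (?f s) + ?f s * cnj (Z s * h s)))) (at s within {0..})"
      by (rule bounded_linear.has_vector_derivative[OF bounded_linear_Re])
        (intro derivative_intros dg that)
    moreover have "Re (0 - ((Z s * h s) * cnj (?f s) + ?f s * cnj (Z s * h s))) = - 2 * K * Re (h s) * \<rho> s"
    proof -
      have zz: "Z s * cnj (Z s) = 1" using Z(2)[of s] complex_norm_square[of "Z s"] by simp
      have e1: "(Z s * h s) * cnj (?f s) = (Z s * cnj (Z s)) * (of_real K * (h s - h s * (cnj (h s))\<^sup>2))"
        by (simp add: algebra_simps)
      have e2: "?f s * cnj (Z s * h s) = (Z s * cnj (Z s)) * (of_real K * (cnj (h s) - cnj (h s) * (h s)\<^sup>2))"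
        by (simp add: algebra_simps)
      show ?thesis
        unfolding e1 e2 zz \<rho>_def cmod_power2 by (simp add: power2_eq_square algebra_simps)
    qed
    ultimately show ?thesis unfolding rho[abs_def] rho by simp
  qed
  define \<psi> where "\<psi> s = \<rho> s * exp (2 * K * I s)" for s
  have "(\<psi> has_vector_derivative 0) (at s within {0..})" if "s \<in> {0..}" for s
  proof -
    have "(\<psi> has_vector_derivative \<rho> s * (exp (2 * K * I s) * (2 * K * Re (h s))) + (- 2 * K * Re (h s) * \<rho> s) * exp (2 * K * I s)) (at s within {0..})"
      using dI[of s] drho[of s] that unfolding \<psi>_def has_real_derivative_iff_has_vector_derivative[symmetric]
      by (auto intro!: derivative_eq_intros)
    then show ?thesis by (simp add: algebra_simps)
  qed
  from has_vector_derivative_zero_constant[OF convex_real_interval(1) this]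
  obtain d where d: "\<And>s. s \<in> {0..} \<Longrightarrow> \<psi> s = d" by blast
  have "Z 0 * h 0 = x" using eq[of 0] by simp
  then have "norm (h 0) = norm x" using Z(2)[of 0] by (metis mult_1 norm_mult)
  then have "\<psi> 0 = 1 - (norm x)\<^sup>2" by (simp add: \<psi>_def \<rho>_def I_def)
  then have "\<rho> t * exp (2 * K * I t) = 1 - (norm x)\<^sup>2" using d[of 0] d[of t] \<open>0 \<le> t\<close> by (simp add: \<psi>_def)
  then show ?thesis by (simp add: \<rho>_def I_def exp_minus field_simps)
qed

locale disc_solution = linear_noise_solution M F W "\<lambda>z. of_real K * (1 - z\<^sup>2)" c x h
  for M :: "'a measure" and F W and K c :: real and x :: complex and h +
  assumes K_pos: "0 < K" and x_disc: "norm x \<le> 1"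
begin

lemma defect_formula:
  "AE \<omega> in M. \<forall>t\<ge>0. 1 - (norm (h t \<omega>))\<^sup>2 = (1 - (norm x)\<^sup>2) * exp (- 2 * K * integral {0..t} (\<lambda>s. Re (h s \<omega>)))"
  using rotated_solution
proof eventually_elim
  case (elim \<omega>)
  show ?case
    by (intro allI impI unit_disc_defect_formula[of "\<lambda>t. rotation t \<omega>"]) (use elim in auto)
qed

lemma norm_h_le: "AE \<omega> in M. \<forall>t\<ge>0. norm (h t \<omega>) \<le> 1"
  using defect_formula
proof eventually_elim
  case (elim \<omega>)
  have "(norm (h t \<omega>))\<^sup>2 \<le> 1" if "0 \<le> t" for t
  proof -
    have "0 \<le> (1 - (norm x)\<^sup>2) * exp (- 2 * K * integral {0..t} (\<lambda>s. Re (h s \<omega>)))"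
      using x_disc by (intro mult_nonneg_nonneg) (auto simp: power_le_one)
    then show ?thesis using elim that by (metis diff_ge_0_iff_ge)
  qed
  then show ?case by (simp add: power2_le_iff_abs_le abs_square_le_1)
qed

lemma norm_h_less: "norm x < 1 \<Longrightarrow> AE \<omega> in M. \<forall>t\<ge>0. norm (h t \<omega>) < 1"
  using defect_formula
proof eventually_elim
  case (elim \<omega>)
  have "(norm (h t \<omega>))\<^sup>2 < 1" if "0 \<le> t" for t
  proof -
    have "0 < (1 - (norm x)\<^sup>2) * exp (- 2 * K * integral {0..t} (\<lambda>s. Re (h s \<omega>)))"
      using elim(1) by (intro mult_pos_pos) (auto simp: abs_square_less_1)
    then show ?thesis using elim that by (metis diff_gt_0_iff_gt)
  qed
  then show ?case by (simp add: abs_square_less_1)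
qed

lemma path_derivative:
  "AE \<omega> in M. \<forall>t\<ge>0. ((\<lambda>t. rotation t \<omega> * h t \<omega>) has_vector_derivative
     rotation t \<omega> * (of_real K * (1 - (h t \<omega>)\<^sup>2))) (at t within {0..})"
  using rotated_solution
proof eventually_elim
  case (elim \<omega>)
  then have cont: "continuous_on {0..} (\<lambda>s. rotation s \<omega> * (of_real K * (1 - (h s \<omega>)\<^sup>2)))"
    by (intro continuous_intros) auto
  show ?case
  proof (intro allI impI)
    fix t :: real assume "0 \<le> t"
    from elim have "\<And>t. 0 \<le> t \<Longrightarrow> rotation t \<omega> * h t \<omega> = x + integral {0..t} (\<lambda>s. rotation s \<omega> * (of_real K * (1 - (h s \<omega>)\<^sup>2)))"
      by blast
    from integral_equation_derivative[OF cont this \<open>0 \<le> t\<close>]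
    show "((\<lambda>t. rotation t \<omega> * h t \<omega>) has_vector_derivative
       rotation t \<omega> * (of_real K * (1 - (h t \<omega>)\<^sup>2))) (at t within {0..})" .
  qed
qed

text \<open>In the closed disc the drift is bounded by 2 K. The resulting deterministic constant
  dominates the difference quotients of the moments.\<close>

lemma path_Lipschitz:
  "AE \<omega> in M. \<forall>t\<ge>0. \<forall>u\<ge>0. norm (rotation u \<omega> * h u \<omega> - rotation t \<omega> * h t \<omega>) \<le> 2 * K * \<bar>u - t\<bar>"
  using path_derivative norm_h_le
proof eventually_elim
  case (elim \<omega>)
  show ?case
  proof (intro allI impI)
    fix t u :: real assume "0 \<le> t" "0 \<le> u"
    have "norm (rotation u \<omega> * h u \<omega> - rotation t \<omega> * h t \<omega>) \<le> (2 * K) * norm (u - t)"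
    proof (rule differentiable_bound[where S="{0..}" and f'="\<lambda>s y. y *\<^sub>R (rotation s \<omega> * (of_real K * (1 - (h s \<omega>)\<^sup>2)))"])
      show "convex {0::real..}" by simp
      fix s :: real assume s: "s \<in> {0..}"
      then show "((\<lambda>t. rotation t \<omega> * h t \<omega>) has_derivative (\<lambda>y. y *\<^sub>R (rotation s \<omega> * (of_real K * (1 - (h s \<omega>)\<^sup>2))))) (at s within {0..})"
        using elim unfolding has_vector_derivative_def by auto
      have "norm (1 - (h s \<omega>)\<^sup>2) \<le> 1 + (norm (h s \<omega>))\<^sup>2"
        using norm_triangle_ineq4[of 1 "(h s \<omega>)\<^sup>2"] by (simp add: norm_power)
      also have "\<dots> \<le> 2" using elim(2) s by (simp add: power_le_one)
      finally have "norm (rotation s \<omega> * (of_real K * (1 - (h s \<omega>)\<^sup>2))) \<le> 2 * K"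
        using K_pos by (simp add: norm_mult)
      then show "onorm (\<lambda>y. y *\<^sub>R (rotation s \<omega> * (of_real K * (1 - (h s \<omega>)\<^sup>2)))) \<le> 2 * K"
        unfolding onorm_scaleR_left[OF bounded_linear_ident] by (simp add: onorm_id)
    qed (use \<open>0 \<le> t\<close> \<open>0 \<le> u\<close> in auto)
    then show "norm (rotation u \<omega> * h u \<omega> - rotation t \<omega> * h t \<omega>) \<le> 2 * K * \<bar>u - t\<bar>" by simp
  qed
qed

section \<open>Weighted moments and their increments\<close>

definition wmom :: "('a \<Rightarrow> real) \<Rightarrow> nat \<Rightarrow> real \<Rightarrow> complex" where
  "wmom G n t = (\<integral>\<omega>. of_real (G \<omega>) * h t \<omega> ^ n \<partial>M)"

lemma wmom_integrable:
  assumes "G \<in> borel_measurable M" "\<And>\<omega>. \<bar>G \<omega>\<bar> \<le> B" "0 \<le> t"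
  shows "integrable M (\<lambda>\<omega>. of_real (G \<omega>) * h t \<omega> ^ n)"
proof (rule integrable_const_bound[where B=B])
  have [measurable]: "h t \<in> borel_measurable M" using assms by auto
  show "(\<lambda>\<omega>. complex_of_real (G \<omega>) * h t \<omega> ^ n) \<in> borel_measurable M" using assms(1) by measurable
  show "AE \<omega> in M. norm (complex_of_real (G \<omega>) * h t \<omega> ^ n) \<le> B"
    using norm_h_le
  proof eventually_elim
    case (elim \<omega>)
    then have "norm (h t \<omega> ^ n) \<le> 1" using assms(3) by (simp add: norm_power power_le_one)
    then have "\<bar>G \<omega>\<bar> * norm (h t \<omega> ^ n) \<le> B * 1"
      using assms(2)[of \<omega>] by (intro mult_mono) auto
    then show ?case by (simp add: norm_mult)
  qed
qed

lemma norm_wmom_le: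
  assumes "G \<in> borel_measurable M" "\<And>\<omega>. 0 \<le> G \<omega>" "\<And>\<omega>. \<bar>G \<omega>\<bar> \<le> B" "0 \<le> t"
  shows "norm (wmom G n t) \<le> (\<integral>\<omega>. G \<omega> \<partial>M)"
proof -
  have "norm (wmom G n t) \<le> (\<integral>\<omega>. norm (of_real (G \<omega>) * h t \<omega> ^ n) \<partial>M)"
    unfolding wmom_def by (rule integral_norm_bound)
  also have "\<dots> \<le> (\<integral>\<omega>. G \<omega> \<partial>M)"
  proof (rule integral_mono_AE)
    show "integrable M (\<lambda>\<omega>. norm (complex_of_real (G \<omega>) * h t \<omega> ^ n))"
      using wmom_integrable[OF assms(1,3,4)] by (rule integrable_norm)
    show "integrable M G" using assms by (intro integrable_const_bound[where B=B]) auto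
    show "AE \<omega> in M. norm (complex_of_real (G \<omega>) * h t \<omega> ^ n) \<le> G \<omega>"
      using norm_h_le
    proof eventually_elim
      case (elim \<omega>)
      then have "norm (h t \<omega> ^ n) \<le> 1" using assms(4) by (simp add: norm_power power_le_one)
      then have "\<bar>G \<omega>\<bar> * norm (h t \<omega> ^ n) \<le> \<bar>G \<omega>\<bar> * 1" by (intro mult_left_mono) auto
      then show ?case using assms(2)[of \<omega>] by (simp add: norm_mult)
    qed
  qed
  finally show ?thesis .
qed

lemma h_eq_rotation: "h t \<omega> = cnj (rotation t \<omega>) * (rotation t \<omega> * h t \<omega>)"
proof -
  have "rotation t \<omega> * cnj (rotation t \<omega>) = 1"
    using complex_norm_square[of "rotation t \<omega>"] by simp
  moreover have "cnj (rotation t \<omega>) * (rotation t \<omega> * h t \<omega>) = (rotation t \<omega> * cnj (rotation t \<omega>)) * h t \<omega>"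
    by (simp only: mult_ac)
  ultimately show ?thesis by simp
qed

text \<open>Write \<open>h u ^ n\<close> as the conjugate rotation at \<open>u\<close> to the power
  \<open>n\<close> times (Z h)^n and compare (Z h)^n at \<open>u\<close> and at \<open>s\<close>.
  The difference is an increment of a differentiable path. What remains is
  \<open>G * h s ^ n\<close>, known at time \<open>s\<close>, times a character of the independent
  increment of \<open>W\<close>, which averages to a Gaussian factor.\<close>

lemma wmom_increment:
  assumes s0: "0 \<le> s0" "s0 \<le> s" "s \<le> u"
    and G: "G \<in> borel_measurable (F s0)" "\<And>\<omega>. \<bar>G \<omega>\<bar> \<le> B"
  shows "wmom G n u - wmom G n s =
     (\<integral>\<omega>. of_real (G \<omega>) * cnj (rotation u \<omega>) ^ n * ((rotation u \<omega> * h u \<omega>) ^ n - (rotation s \<omega> * h s \<omega>) ^ n) \<partial>M)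
     + wmom G n s * of_real (exp (- (c\<^sup>2 / 2 * (real n)\<^sup>2 * (u - s))) - 1)"
proof -
  have GM: "G \<in> borel_measurable M" by (rule measurable_F_M[OF G(1)])
  have pos: "0 \<le> s" "0 \<le> u" using s0 by auto
  have [measurable]: "h s \<in> borel_measurable M" "h u \<in> borel_measurable M" "G \<in> borel_measurable M"
    "rotation s \<in> borel_measurable M" "rotation u \<in> borel_measurable M"
    using pos GM adapted_rv[OF rotation_adapted] by auto
  let ?H = "\<lambda>\<omega>. complex_of_real (G \<omega>) * h s \<omega> ^ n"
  have "?H \<in> borel_measurable (F s)"
  proof -
    have [measurable]: "G \<in> borel_measurable (F s)" "h s \<in> borel_measurable (F s)"
      using measurable_F_mono[OF G(1) s0(2)] adapted_measurable[OF h_adapted pos(1) order_refl] by auto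
    show ?thesis by measurable
  qed
  moreover have intH: "integrable M ?H" using wmom_integrable[OF GM G(2) pos(1)] .
  ultimately have char: "(\<integral>\<omega>. ?H \<omega> * iexp (real n * c * (W u \<omega> - W s \<omega>)) \<partial>M) =
      wmom G n s * exp (- ((real n * c)\<^sup>2 * (u - s) / 2))"
    using W_char_mult[OF pos(1) s0(3)] unfolding wmom_def by blast
  have rot: "cnj (rotation u \<omega>) ^ n * (rotation s \<omega> * h s \<omega>) ^ n = h s \<omega> ^ n * iexp (real n * c * (W u \<omega> - W s \<omega>))" for \<omega>
  proof -
    have A: "cnj (rotation u \<omega>) * rotation s \<omega> = exp (\<i> * of_real (c * (W u \<omega> - W s \<omega>)))"
      unfolding rotation_def exp_cnj exp_add[symmetric] by (simp add: algebra_simps)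
    have B: "exp (\<i> * of_real (c * (W u \<omega> - W s \<omega>))) ^ n = iexp (real n * c * (W u \<omega> - W s \<omega>))"
      by (simp add: exp_of_nat_mult[symmetric] mult_ac)
    have "cnj (rotation u \<omega>) ^ n * (rotation s \<omega> * h s \<omega>) ^ n = (cnj (rotation u \<omega>) * rotation s \<omega>) ^ n * h s \<omega> ^ n"
      by (simp only: power_mult_distrib mult_ac)
    also have "\<dots> = iexp (real n * c * (W u \<omega> - W s \<omega>)) * h s \<omega> ^ n"
      by (simp only: A B)
    finally show ?thesis by (simp only: mult.commute)
  qed
  have eq: "of_real (G \<omega>) * h u \<omega> ^ n - of_real (G \<omega>) * h s \<omega> ^ n =
      of_real (G \<omega>) * cnj (rotation u \<omega>) ^ n * ((rotation u \<omega> * h u \<omega>) ^ n - (rotation s \<omega> * h s \<omega>) ^ n)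
      + (?H \<omega> * iexp (real n * c * (W u \<omega> - W s \<omega>)) - ?H \<omega>)" for \<omega>
  proof -
    have "h u \<omega> ^ n = cnj (rotation u \<omega>) ^ n * (rotation u \<omega> * h u \<omega>) ^ n"
      by (subst h_eq_rotation) (simp only: power_mult_distrib)
    then show ?thesis
      using rot[of \<omega>] by (simp add: right_diff_distrib mult.assoc)
  qed
  have intI: "integrable M (\<lambda>\<omega>. ?H \<omega> * iexp (real n * c * (W u \<omega> - W s \<omega>)))"
  proof (rule Bochner_Integration.integrable_bound[OF intH])
    have [measurable]: "W s \<in> borel_measurable M" "W u \<in> borel_measurable M" using pos by auto
    show "(\<lambda>\<omega>. ?H \<omega> * iexp (real n * c * (W u \<omega> - W s \<omega>))) \<in> borel_measurable M" by measurable
  qed (simp add: norm_mult)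
  have int_u: "integrable M (\<lambda>\<omega>. of_real (G \<omega>) * h u \<omega> ^ n)" using wmom_integrable[OF GM G(2) pos(2)] .
  have intA: "integrable M (\<lambda>\<omega>. of_real (G \<omega>) * cnj (rotation u \<omega>) ^ n * ((rotation u \<omega> * h u \<omega>) ^ n - (rotation s \<omega> * h s \<omega>) ^ n))"
  proof -
    have "integrable M (\<lambda>\<omega>. of_real (G \<omega>) * h u \<omega> ^ n - of_real (G \<omega>) * h s \<omega> ^ n - (?H \<omega> * iexp (real n * c * (W u \<omega> - W s \<omega>)) - ?H \<omega>))"
      using int_u intH intI by (intro Bochner_Integration.integrable_diff)
    then show ?thesis unfolding eq by simp
  qed
  have "wmom G n u - wmom G n s = (\<integral>\<omega>. of_real (G \<omega>) * h u \<omega> ^ n - of_real (G \<omega>) * h s \<omega> ^ n \<partial>M)"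
    unfolding wmom_def using int_u intH by simp
  also have "\<dots> = (\<integral>\<omega>. of_real (G \<omega>) * cnj (rotation u \<omega>) ^ n * ((rotation u \<omega> * h u \<omega>) ^ n - (rotation s \<omega> * h s \<omega>) ^ n) \<partial>M)
      + ((\<integral>\<omega>. ?H \<omega> * iexp (real n * c * (W u \<omega> - W s \<omega>)) \<partial>M) - (\<integral>\<omega>. ?H \<omega> \<partial>M))"
    unfolding eq using intA intI intH by simp
  also have "\<dots> = (\<integral>\<omega>. of_real (G \<omega>) * cnj (rotation u \<omega>) ^ n * ((rotation u \<omega> * h u \<omega>) ^ n - (rotation s \<omega> * h s \<omega>) ^ n) \<partial>M)
     + wmom G n s * of_real (exp (- (c\<^sup>2 / 2 * (real n)\<^sup>2 * (u - s))) - 1)"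
    unfolding char wmom_def[symmetric]
    by (simp add: power_mult_distrib exp_of_real[symmetric] right_diff_distrib mult_ac del: exp_of_real)
  finally show ?thesis .
qed

lemma wmom_tendsto:
  assumes G: "G \<in> borel_measurable M" "\<And>\<omega>. \<bar>G \<omega>\<bar> \<le> B"
    and u: "\<And>k. 0 \<le> u k" "u \<longlonglongrightarrow> t" "0 \<le> t"
  shows "(\<lambda>k. wmom G n (u k)) \<longlonglongrightarrow> wmom G n t"
  unfolding wmom_def
proof (rule integral_dominated_convergence[where w="\<lambda>_. B"])
  show "(\<lambda>\<omega>. complex_of_real (G \<omega>) * h t \<omega> ^ n) \<in> borel_measurable M"
    "\<And>k. (\<lambda>\<omega>. complex_of_real (G \<omega>) * h (u k) \<omega> ^ n) \<in> borel_measurable M"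
    using wmom_integrable[OF G] u by (blast intro: borel_measurable_integrable)+
  show "AE \<omega> in M. (\<lambda>k. complex_of_real (G \<omega>) * h (u k) \<omega> ^ n) \<longlonglongrightarrow> of_real (G \<omega>) * h t \<omega> ^ n"
    using h_cont
  proof eventually_elim
    case (elim \<omega>)
    then have "(\<lambda>k. h (u k) \<omega>) \<longlonglongrightarrow> h t \<omega>"
      using u by (auto simp: continuous_on_sequentially o_def)
    then show ?case by (intro tendsto_intros)
  qed
  fix k
  show "AE \<omega> in M. norm (complex_of_real (G \<omega>) * h (u k) \<omega> ^ n) \<le> B"
    using norm_h_le
  proof eventually_elim
    case (elim \<omega>)
    then have "norm (h (u k) \<omega> ^ n) \<le> 1" using u by (simp add: norm_power power_le_one)
    then have "\<bar>G \<omega>\<bar> * norm (h (u k) \<omega> ^ n) \<le> B * 1"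
      using G(2)[of \<omega>] by (intro mult_mono) auto
    then show ?case by (simp add: norm_mult)
  qed
qed simp

end

subsection \<open>Decay of solutions of the moment system\<close>

text \<open>For n = 0 the truncated \<open>n - 1\<close> does no harm, since its factor
  \<open>K * n\<close> vanishes and \<open>a 0\<close> is constant. The equations start strictly
  after \<open>s\<close>, the time at which the weight becomes known.\<close>

definition moment_system :: "real \<Rightarrow> real \<Rightarrow> real \<Rightarrow> real \<Rightarrow> (nat \<Rightarrow> real \<Rightarrow> complex) \<Rightarrow> bool" where
  "moment_system \<kappa> K s B a \<longleftrightarrow> (\<forall>n. \<forall>t>s. norm (a n t) \<le> B \<and>
     (a n has_vector_derivative (- of_real (\<kappa> * (real n)\<^sup>2) * a n t + of_real (K * real n) * (a (n - 1) t - a (Suc n) t))) (at t))"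

lemma exp_minus_le_inverse: "0 < y \<Longrightarrow> exp (- y) \<le> 1 / (y::real)"
proof -
  assume "0 < y"
  moreover have "y \<le> exp y" using exp_ge_add_one_self[of y] by linarith
  ultimately show ?thesis by (simp add: exp_minus field_simps)
qed

text \<open>Parabolic smoothing. Over a time interval of length 1/2 the damping \<kappa> n^2 forgets
  the initial value up to exp(- \<kappa> n^2 / 2), which is O(1/n), and the forcing of size 2 K B n
  divided by the damping is O(1/n) as well.\<close>

lemma moment_system_decay:
  assumes a: "moment_system \<kappa> K s B a" and "0 < \<kappa>" "0 < K" "0 < n" "s + 1 \<le> t"
  shows "norm (a n t) \<le> B * (2 + 2 * K) / \<kappa> / n"
proof -
  define y where "y = \<kappa> * (real n)\<^sup>2"
  have "y > 0" using assms by (simp add: y_def)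
  have B: "norm (a k u) \<le> B" if "s < u" for k u
    using a that by (simp add: moment_system_def)
  have "0 \<le> B" using order_trans[OF norm_ge_zero B[of t 0]] assms by simp
  \<comment> \<open>Half a unit back, not a whole one: for t = s + 1 a whole unit would end at
    \<open>s\<close>, where the system says nothing.\<close>
  define r where "r = t - 1 / 2"
  have r: "s < r" "r < t" using assms by (auto simp: r_def)
  define \<phi> where "\<phi> u = of_real (exp (y * u)) * a n u" for u
  define \<phi>' where "\<phi>' u = of_real (exp (y * u)) * (of_real (K * real n) * (a (n - 1) u - a (Suc n) u))" for u
  define C where "C = 2 * K * B / (\<kappa> * n)"
  have da: "(a n has_vector_derivative (- of_real y * a n u + of_real (K * real n) * (a (n - 1) u - a (Suc n) u))) (at u)"
    if "s < u" for u
    using a that by (simp add: moment_system_def y_def)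
  have d\<phi>: "(\<phi> has_vector_derivative \<phi>' u) (at u)" if "s < u" for u
  proof -
    have "((\<lambda>u. exp (y * u)) has_real_derivative exp (y * u) * y) (at u)"
      by (auto intro!: derivative_eq_intros)
    then have "((\<lambda>u. complex_of_real (exp (y * u))) has_vector_derivative of_real (exp (y * u) * y)) (at u)"
      by (rule has_vector_derivative_of_real)
    from has_vector_derivative_mult[OF this da[OF that]] show ?thesis
      unfolding \<phi>_def[abs_def] \<phi>'_def by (simp add: algebra_simps)
  qed
  have "norm (\<phi> t - \<phi> r) \<le> C * exp (y * t) - C * exp (y * r)"
  proof (rule differentiable_bound_general[OF r(2)])
    show "continuous_on {r..t} \<phi>"
      by (intro continuous_at_imp_continuous_on ballI has_vector_derivative_continuous[OF d\<phi>]) (use r in auto)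
    show "continuous_on {r..t} (\<lambda>u. C * exp (y * u))" by (intro continuous_intros)
    fix u assume u: "r < u" "u < t"
    then show "(\<phi> has_vector_derivative \<phi>' u) (at u)" using r by (intro d\<phi>) auto
    show "((\<lambda>u. C * exp (y * u)) has_vector_derivative C * (exp (y * u) * y)) (at u)"
      unfolding has_real_derivative_iff_has_vector_derivative[symmetric]
      by (auto intro!: derivative_eq_intros)
    have "norm (a (n - 1) u - a (Suc n) u) \<le> 2 * B"
      using norm_triangle_ineq4[of "a (n - 1) u" "a (Suc n) u"] B[of u "n - 1"] B[of u "Suc n"] u r by simp
    then have "norm (\<phi>' u) \<le> exp (y * u) * (K * n * (2 * B))"
      using \<open>0 < K\<close> by (simp add: \<phi>'_def norm_mult mult_left_mono)
    also have "\<dots> = C * (exp (y * u) * y)"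
      using assms by (simp add: C_def y_def power2_eq_square)
    finally show "norm (\<phi>' u) \<le> C * (exp (y * u) * y)" .
  qed
  moreover have "0 \<le> C" using \<open>0 \<le> B\<close> assms by (simp add: C_def)
  ultimately have le: "norm (\<phi> t) \<le> norm (\<phi> r) + C * exp (y * t)"
    using norm_triangle_sub[of "\<phi> t" "\<phi> r"] by (smt (verit) exp_ge_zero mult_nonneg_nonneg)
  have n\<phi>: "norm (\<phi> u) = exp (y * u) * norm (a n u)" for u
    by (simp add: \<phi>_def norm_mult)
  have "exp (y * r) * norm (a n r) \<le> exp (y * r) * B"
    using B[OF r(1)] by simp
  with le have "exp (y * t) * norm (a n t) \<le> exp (y * r) * B + C * exp (y * t)"
    unfolding n\<phi> by linarith
  then have "norm (a n t) \<le> (exp (y * r) * B + C * exp (y * t)) / exp (y * t)"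
    by (simp add: pos_le_divide_eq mult.commute)
  also have "\<dots> = exp (- (y / 2)) * B + C"
  proof -
    have "exp (y * r) = exp (- (y / 2)) * exp (y * t)"
      unfolding exp_add[symmetric] by (simp add: r_def algebra_simps)
    then show ?thesis by (simp only: add_divide_distrib) simp
  qed
  also have "\<dots> \<le> 1 / (y / 2) * B + C"
    using exp_minus_le_inverse[of "y / 2"] \<open>y > 0\<close> \<open>0 \<le> B\<close> by (intro add_right_mono mult_right_mono) auto
  also have "1 / (y / 2) \<le> 2 / (\<kappa> * n)"
  proof -
    have "\<kappa> * real n * 1 \<le> \<kappa> * real n * real n" using assms by (intro mult_left_mono) auto
    then show ?thesis
      using assms \<open>y > 0\<close> by (simp add: y_def power2_eq_square frac_le mult.assoc)
  qed
  finally show ?thesis using \<open>0 \<le> B\<close> assms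
    by (simp add: C_def field_simps mult_right_mono)
qed

lemma sum_inverse_squares_le: "(\<Sum>k=1..N. 1 / (real k)\<^sup>2) \<le> 2"
proof -
  have "(\<Sum>k=1..Suc N. 1 / (real k)\<^sup>2) \<le> 2 - 1 / real (Suc N)" for N
  proof (induction N)
    case (Suc N)
    have "1 / (real (Suc (Suc N)))\<^sup>2 \<le> 1 / (real (Suc N) * real (Suc (Suc N)))"
      by (intro frac_le) (auto simp: power2_eq_square)
    also have "\<dots> = 1 / real (Suc N) - 1 / real (Suc (Suc N))"
      by (simp add: field_simps)
    finally show ?case using Suc by simp
  qed simp
  from this[of "N - 1"] show ?thesis by (cases N) (auto intro: order_trans)
qed

text \<open>
  The transport part is antisymmetric for the weights \<open>1 / k\<close>, so only a boundary term of the truncated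
  energy survives next to the dissipation.
\<close>

lemma moment_system_energy:
  assumes d: "moment_system \<kappa> K s B d" and d0: "\<And>t. s < t \<Longrightarrow> d 0 t = 0"
    and pos: "0 < \<kappa>" "0 < K" and "0 < n" "s + 1 \<le> t"
  shows "(norm (d n t))\<^sup>2 \<le> n * (2 * (B * (2 + 2 * K) / \<kappa>)\<^sup>2 * exp (- 2 * \<kappa> * (t - (s + 1))))"
proof -
  define C where "C = B * (2 + 2 * K) / \<kappa>"
  have dC: "norm (d k u) \<le> C / k" if "0 < k" "s + 1 \<le> u" for k u
    using moment_system_decay[OF d pos that] by (simp add: C_def)
  have "0 \<le> C" using order_trans[OF norm_ge_zero dC[of 1 "s + 1"]] by simp
  have dd: "(d k has_vector_derivative (- of_real (\<kappa> * (real k)\<^sup>2) * d k u + of_real (K * real k) * (d (k - 1) u - d (Suc k) u))) (at u)"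
    if "s < u" for k u
    using d that by (simp add: moment_system_def)
  \<comment> \<open>The energy is started at s + 1, where the O(1/k) bound is available and keeps it
    finite uniformly in the cutoff \<open>N\<close>.\<close>
  define r where "r = s + 1"
  have main: "(norm (d n t))\<^sup>2 \<le> n * (exp (- 2 * \<kappa> * (t - r)) * (2 * C\<^sup>2) + K * C\<^sup>2 / \<kappa> * (1 / (real N)\<^sup>2))" if "n \<le> N" for N
  proof -
    have "0 < N" using that \<open>0 < n\<close> by simp
    define E where "E u = (\<Sum>k=1..N. (d k u \<bullet> d k u) / k)" for u
    define T where "T u = (\<Sum>k=1..N. d k u \<bullet> d (k - 1) u - d k u \<bullet> d (Suc k) u)" for u
    define E' where "E' u = - 2 * \<kappa> * (\<Sum>k=1..N. k * (d k u \<bullet> d k u)) + 2 * K * T u" for u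
    have dE: "(E has_real_derivative E' u) (at u)" if "s < u" for u
    proof -
      have "((\<lambda>u. d k u \<bullet> d k u / k) has_real_derivative - 2 * \<kappa> * (k * (d k u \<bullet> d k u)) + 2 * K * (d k u \<bullet> d (k - 1) u - d k u \<bullet> d (Suc k) u)) (at u)"
        if "k \<in> {1..N}" for k
      proof -
        let ?D = "- of_real (\<kappa> * (real k)\<^sup>2) * d k u + of_real (K * real k) * (d (k - 1) u - d (Suc k) u)"
        have "((\<lambda>u. d k u \<bullet> d k u) has_vector_derivative d k u \<bullet> ?D + ?D \<bullet> d k u) (at u)"
          by (rule bounded_bilinear.has_vector_derivative[OF bounded_bilinear_inner dd[OF \<open>s < u\<close>] dd[OF \<open>s < u\<close>]])
        then have "((\<lambda>u. d k u \<bullet> d k u / k) has_real_derivative (d k u \<bullet> ?D + ?D \<bullet> d k u) / k) (at u)"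
          unfolding has_real_derivative_iff_has_vector_derivative[symmetric] by (rule DERIV_cdivide)
        moreover have "?D = (- \<kappa> * (real k)\<^sup>2) *\<^sub>R d k u + (K * real k) *\<^sub>R (d (k - 1) u - d (Suc k) u)"
          by (simp add: scaleR_conv_of_real)
        then have "d k u \<bullet> ?D = - \<kappa> * (real k)\<^sup>2 * (d k u \<bullet> d k u) + K * real k * (d k u \<bullet> d (k - 1) u - d k u \<bullet> d (Suc k) u)"
          by (simp only: inner_add_right inner_scaleR_right inner_diff_right)
        then have "(d k u \<bullet> ?D + ?D \<bullet> d k u) / k = - 2 * \<kappa> * (k * (d k u \<bullet> d k u)) + 2 * K * (d k u \<bullet> d (k - 1) u - d k u \<bullet> d (Suc k) u)"
          using that by (simp only: inner_commute[of ?D]) (simp add: field_simps power2_eq_square)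
        ultimately show ?thesis by simp
      qed
      then show ?thesis
        unfolding E_def[abs_def] E'_def T_def sum_distrib_left sum.distrib[symmetric] by (rule DERIV_sum)
    qed
    have E'le: "E' u \<le> - 2 * \<kappa> * E u + 2 * K * C\<^sup>2 / (real N)\<^sup>2" if u: "r \<le> u" for u
    proof -
      have "s < u" using u by (simp add: r_def)
      \<comment> \<open>After division by \<open>k\<close> the transport terms telescope. The term
        at 0 vanishes by \<open>d0\<close>, and the one at \<open>N\<close> is a product of two
        entries of size C/N.\<close>
      have "T u = d 1 u \<bullet> d 0 u - d N u \<bullet> d (Suc N) u"
        unfolding T_def using \<open>0 < N\<close>
      proof (induction N rule: nat_induct_non_zero)
        case (Suc N)
        then show ?case by (simp add: inner_commute)
      qed simp
      then have "T u \<le> norm (d N u) * norm (d (Suc N) u)"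
        using norm_cauchy_schwarz[of "d N u" "- d (Suc N) u"] d0[OF \<open>s < u\<close>] by simp
      also have "\<dots> \<le> (C / N) * (C / Suc N)"
        using u \<open>0 < N\<close> \<open>0 \<le> C\<close> by (intro mult_mono dC) (auto simp: r_def)
      also have "\<dots> \<le> (C / N) * (C / N)"
        using \<open>0 < N\<close> \<open>0 \<le> C\<close> by (intro mult_left_mono divide_left_mono) auto
      finally have T: "T u \<le> C\<^sup>2 / (real N)\<^sup>2" by (simp add: power2_eq_square)
      \<comment> \<open>Because 1/k is at most k, the dissipation dominates the energy with constant
        1; this yields a decay rate that does not depend on \<open>N\<close>.\<close>
      have "E u \<le> (\<Sum>k=1..N. k * (d k u \<bullet> d k u))"
        unfolding E_def
      proof (rule sum_mono)
        fix k assume k: "k \<in> {1..N}"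
        have "(d k u \<bullet> d k u) / k \<le> (d k u \<bullet> d k u) / 1" using k by (intro divide_left_mono) auto
        also have "\<dots> \<le> k * (d k u \<bullet> d k u)" using k mult_right_mono[of 1 "real k" "d k u \<bullet> d k u"] by simp
        finally show "(d k u \<bullet> d k u) / k \<le> k * (d k u \<bullet> d k u)" .
      qed
      then have "2 * \<kappa> * E u \<le> 2 * \<kappa> * (\<Sum>k=1..N. k * (d k u \<bullet> d k u))" using pos by simp
      moreover have "2 * K * T u \<le> 2 * K * (C\<^sup>2 / (real N)\<^sup>2)" using pos by (intro mult_left_mono[OF T]) simp
      ultimately show ?thesis unfolding E'_def by simp
    qed
    \<comment> \<open>\<open>b\<close> is the equilibrium of the differential inequality for
      \<open>E\<close>. It tends to 0 as \<open>N\<close> grows, which removes the cutoff in the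
      end.\<close>
    define b where "b = K * C\<^sup>2 / (\<kappa> * (real N)\<^sup>2)"
    have "b \<ge> 0" using pos by (simp add: b_def)
    define \<psi> where "\<psi> u = exp (2 * \<kappa> * u) * (E u - b)" for u
    have "\<psi> t \<le> \<psi> r"
    proof (rule DERIV_nonpos_imp_nonincreasing[of r t \<psi>])
      show "r \<le> t" using assms by (simp add: r_def)
      fix u assume u: "r \<le> u" "u \<le> t"
      then have "s < u" by (simp add: r_def)
      have "(\<psi> has_real_derivative exp (2 * \<kappa> * u) * (2 * \<kappa>) * (E u - b) + exp (2 * \<kappa> * u) * E' u) (at u)"
        unfolding \<psi>_def[abs_def] using dE[OF \<open>s < u\<close>] by (auto intro!: derivative_eq_intros)
      moreover have "exp (2 * \<kappa> * u) * (2 * \<kappa>) * (E u - b) + exp (2 * \<kappa> * u) * E' u = exp (2 * \<kappa> * u) * (2 * \<kappa> * E u - 2 * \<kappa> * b + E' u)"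
        by (simp add: algebra_simps)
      moreover have "2 * \<kappa> * b = 2 * K * C\<^sup>2 / (real N)\<^sup>2" using pos by (simp add: b_def)
      then have "exp (2 * \<kappa> * u) * (2 * \<kappa> * E u - 2 * \<kappa> * b + E' u) \<le> 0"
        using E'le[OF u(1)] by (intro mult_nonneg_nonpos) auto
      ultimately show "\<exists>y. (\<psi> has_real_derivative y) (at u) \<and> y \<le> 0" by metis
    qed
    moreover have "exp (2 * \<kappa> * r) * (E r - b) \<le> exp (2 * \<kappa> * r) * E r"
      using \<open>b \<ge> 0\<close> by (intro mult_left_mono) auto
    ultimately have "exp (2 * \<kappa> * t) * (E t - b) \<le> exp (2 * \<kappa> * r) * E r"
      unfolding \<psi>_def by linarith
    then have "exp (- (2 * \<kappa> * t)) * (exp (2 * \<kappa> * t) * (E t - b)) \<le> exp (- (2 * \<kappa> * t)) * (exp (2 * \<kappa> * r) * E r)"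
      by (rule mult_left_mono) simp
    then have 1: "E t \<le> exp (- 2 * \<kappa> * (t - r)) * E r + b"
    proof -
      assume le: "exp (- (2 * \<kappa> * t)) * (exp (2 * \<kappa> * t) * (E t - b)) \<le> exp (- (2 * \<kappa> * t)) * (exp (2 * \<kappa> * r) * E r)"
      have "exp (- (2 * \<kappa> * t)) * (exp (2 * \<kappa> * t) * (E t - b)) = E t - b"
        by (simp add: exp_minus)
      moreover have "exp (- (2 * \<kappa> * t)) * exp (2 * \<kappa> * r) = exp (- 2 * \<kappa> * (t - r))"
        unfolding exp_add[symmetric] by (simp add: algebra_simps)
      then have "exp (- (2 * \<kappa> * t)) * (exp (2 * \<kappa> * r) * E r) = exp (- 2 * \<kappa> * (t - r)) * E r"
        by (simp only: mult.assoc[symmetric])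
      ultimately show ?thesis using le by linarith
    qed
    have "E r \<le> (\<Sum>k=1..N. C\<^sup>2 * (1 / (real k)\<^sup>2))"
      unfolding E_def
    proof (rule sum_mono)
      fix k assume k: "k \<in> {1..N}"
      have "d k r \<bullet> d k r \<le> (C / k)\<^sup>2"
        using dC[of k r] k unfolding power2_norm_eq_inner[symmetric] by (intro power_mono) (auto simp: r_def)
      then have "(d k r \<bullet> d k r) / k \<le> (C / k)\<^sup>2 / 1" using k by (intro frac_le) auto
      then show "(d k r \<bullet> d k r) / k \<le> C\<^sup>2 * (1 / (real k)\<^sup>2)" by (simp add: power_divide)
    qed
    also have "\<dots> \<le> C\<^sup>2 * 2"
      unfolding sum_distrib_left[symmetric] by (intro mult_left_mono sum_inverse_squares_le) auto
    finally have "exp (- 2 * \<kappa> * (t - r)) * E r \<le> exp (- 2 * \<kappa> * (t - r)) * (2 * C\<^sup>2)"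
      by (intro mult_left_mono) auto
    with 1 have "E t \<le> exp (- 2 * \<kappa> * (t - r)) * (2 * C\<^sup>2) + b"
      by linarith
    moreover have "(norm (d n t))\<^sup>2 / n \<le> E t"
      unfolding E_def power2_norm_eq_inner using that \<open>0 < n\<close>
      by (intro member_le_sum[of n "{1..N}" "\<lambda>k. (d k t \<bullet> d k t) / k"]) auto
    ultimately have "(norm (d n t))\<^sup>2 / n \<le> exp (- 2 * \<kappa> * (t - r)) * (2 * C\<^sup>2) + b" by linarith
    then have "(norm (d n t))\<^sup>2 \<le> n * (exp (- 2 * \<kappa> * (t - r)) * (2 * C\<^sup>2) + b)"
      using \<open>0 < n\<close> by (simp add: pos_divide_le_eq mult.commute)
    moreover have "b = K * C\<^sup>2 / \<kappa> * (1 / (real N)\<^sup>2)" by (simp add: b_def)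
    ultimately show ?thesis by simp
  qed
  have "(\<lambda>N. n * (exp (- 2 * \<kappa> * (t - r)) * (2 * C\<^sup>2) + K * C\<^sup>2 / \<kappa> * (1 / (real N)\<^sup>2)))
      \<longlonglongrightarrow> n * (exp (- 2 * \<kappa> * (t - r)) * (2 * C\<^sup>2) + K * C\<^sup>2 / \<kappa> * 0)"
  proof (intro tendsto_intros)
    have "(\<lambda>N. (1 / real N)\<^sup>2) \<longlonglongrightarrow> 0\<^sup>2" by (intro tendsto_intros lim_1_over_n)
    then show "(\<lambda>N. 1 / (real N)\<^sup>2) \<longlonglongrightarrow> 0" by (simp add: power_divide)
  qed
  then have "(norm (d n t))\<^sup>2 \<le> n * (exp (- 2 * \<kappa> * (t - r)) * (2 * C\<^sup>2) + K * C\<^sup>2 / \<kappa> * 0)"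
    by (rule LIMSEQ_le_const) (use main in blast)
  then show ?thesis by (simp add: r_def C_def mult_ac)
qed

lemma exp_difference_quotient:
  fixes \<kappa> :: real
  assumes "\<And>k. d k \<noteq> 0" "d \<longlonglongrightarrow> 0"
  shows "(\<lambda>k. (exp (- (\<kappa> * d k)) - 1) / d k) \<longlonglongrightarrow> - \<kappa>"
proof -
  have "((\<lambda>y. exp (- (\<kappa> * y))) has_real_derivative - \<kappa>) (at 0)"
    by (auto intro!: derivative_eq_intros)
  then have "((\<lambda>y. (exp (- (\<kappa> * y)) - 1) / y) \<longlongrightarrow> - \<kappa>) (at 0)"
    by (simp add: has_field_derivative_iff)
  moreover have "filterlim d (at 0) sequentially"
    using assms by (simp add: filterlim_at)
  ultimately show ?thesis by (rule filterlim_compose)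
qed

lemma borel_measurable_cnj:
  assumes "f \<in> borel_measurable M"
  shows "(\<lambda>x. cnj (f x)) \<in> borel_measurable M"
proof -
  have "cnj \<in> borel_measurable borel"
    by (intro borel_measurable_continuous_onI) (intro continuous_intros)
  from measurable_compose[OF assms this] show ?thesis .
qed

context disc_solution
begin

text \<open>Divide \<open>wmom_increment\<close> by the time step. The path part converges by
  dominated convergence to the transport term, and the Gaussian factor contributes the
  damping.\<close>

lemma wmom_derivative:
  assumes "0 \<le> s0" "s0 < t" and G: "G \<in> borel_measurable (F s0)" "\<And>\<omega>. \<bar>G \<omega>\<bar> \<le> B"
  shows "(wmom G n has_vector_derivative
     (- of_real (c\<^sup>2 / 2 * (real n)\<^sup>2) * wmom G n t + of_real (K * real n) * (wmom G (n - 1) t - wmom G (Suc n) t))) (at t)"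
proof -
  have GM: "G \<in> borel_measurable M" by (rule measurable_F_M[OF G(1)])
  have "0 < t" using assms by simp
  define \<kappa> where "\<kappa> = c\<^sup>2 / 2 * (real n)\<^sup>2"
  let ?g = "\<lambda>u \<omega>. rotation u \<omega> * h u \<omega>"
  define L where "L = (\<integral>\<omega>. of_real (K * real n) * (of_real (G \<omega>) * h t \<omega> ^ (n - 1) - of_real (G \<omega>) * h t \<omega> ^ Suc n) \<partial>M)"
  have L: "L = of_real (K * real n) * (wmom G (n - 1) t - wmom G (Suc n) t)"
  proof -
    note i = wmom_integrable[OF GM G(2) less_imp_le[OF \<open>0 < t\<close>]]
    show ?thesis
      unfolding L_def wmom_def integral_mult_right_zero Bochner_Integration.integral_diff[OF i i] ..
  qed
  have "(wmom G n has_vector_derivative L + wmom G n t * of_real (- \<kappa>)) (at t within {s0<..})"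
    unfolding has_vector_derivative_iff_quotient tendsto_at_iff_sequentially o_def
  proof (intro allI impI)
    fix X :: "nat \<Rightarrow> real"
    assume X: "\<forall>i. X i \<in> {s0<..} - {t}" "X \<longlonglongrightarrow> t"
    \<comment> \<open>A difference quotient is symmetric in its two times, but the independence
      argument needs them in order; this treats approach from the left and from the right at
      once.\<close>
    define lo hi where "lo k = min (X k) t" and "hi k = max (X k) t" for k
    have lh: "s0 \<le> lo k" "lo k < hi k" "0 \<le> lo k" "0 \<le> hi k" for k
      using X(1)[rule_format, of k] assms by (auto simp: lo_def hi_def)
    have lo: "lo \<longlonglongrightarrow> t" unfolding lo_def using tendsto_min[OF X(2) tendsto_const[of t]] by simp
    have hi: "hi \<longlonglongrightarrow> t" unfolding hi_def using tendsto_max[OF X(2) tendsto_const[of t]] by simp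
    have swap: "(f (hi k) - f (lo k)) / of_real (hi k - lo k) = (f (X k) - f t) / of_real (X k - t)" for f :: "real \<Rightarrow> complex" and k
    proof (cases "X k \<le> t")
      case True
      then show ?thesis
        using minus_divide_divide[of "f t - f (X k)" "complex_of_real (t - X k)"] by (simp add: lo_def hi_def)
    qed (simp add: lo_def hi_def)
    define A where "A k = (\<integral>\<omega>. of_real (G \<omega>) * cnj (rotation (hi k) \<omega>) ^ n * ((?g (X k) \<omega> ^ n - ?g t \<omega> ^ n) / of_real (X k - t)) \<partial>M)" for k
    have "(wmom G n (X k) - wmom G n t) / of_real (X k - t) = A k + wmom G n (lo k) * of_real ((exp (- (\<kappa> * (hi k - lo k))) - 1) / (hi k - lo k))" for k
    proof -
      have "(wmom G n (X k) - wmom G n t) / of_real (X k - t) =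
         (\<integral>\<omega>. of_real (G \<omega>) * cnj (rotation (hi k) \<omega>) ^ n * (?g (hi k) \<omega> ^ n - ?g (lo k) \<omega> ^ n) \<partial>M) / of_real (hi k - lo k)
          + wmom G n (lo k) * of_real (exp (- (\<kappa> * (hi k - lo k))) - 1) / of_real (hi k - lo k)"
        unfolding swap[symmetric] wmom_increment[OF \<open>0 \<le> s0\<close> lh(1) less_imp_le[OF lh(2)] G] \<kappa>_def
        by (rule add_divide_distrib)
      also have "(\<integral>\<omega>. of_real (G \<omega>) * cnj (rotation (hi k) \<omega>) ^ n * (?g (hi k) \<omega> ^ n - ?g (lo k) \<omega> ^ n) \<partial>M) / of_real (hi k - lo k) = A k"
        unfolding A_def integral_divide_zero[symmetric] times_divide_eq_right[symmetric] swap[of "\<lambda>u. ?g u _ ^ n"] ..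
      finally show ?thesis by (simp only: of_real_divide times_divide_eq_right)
    qed
    moreover have "A \<longlonglongrightarrow> L"
      unfolding A_def L_def
    \<comment> \<open>The dominating constant combines the bound on \<open>G\<close>, the factor
      \<open>n\<close> from comparing n-th powers in the unit disc, and the Lipschitz constant 2
      K.\<close>
    proof (rule integral_dominated_convergence[where w="\<lambda>_. B * (real n * (2 * K))"])
      have rv: "h t \<in> borel_measurable M" "h (X k) \<in> borel_measurable M" "G \<in> borel_measurable M"
        "rotation t \<in> borel_measurable M" "rotation (X k) \<in> borel_measurable M" "rotation (hi k) \<in> borel_measurable M" for k
        using GM adapted_rv[OF rotation_adapted] lh(4)[of k] X(1)[rule_format, of k] \<open>0 < t\<close> \<open>0 \<le> s0\<close> by auto
      note [measurable] = rv(1,3)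
      have rvG: "(\<lambda>\<omega>. complex_of_real (G \<omega>)) \<in> borel_measurable M" by measurable
      show "(\<lambda>\<omega>. of_real (K * real n) * (complex_of_real (G \<omega>) * h t \<omega> ^ (n - 1) - of_real (G \<omega>) * h t \<omega> ^ Suc n)) \<in> borel_measurable M"
        by measurable
      show "(\<lambda>\<omega>. of_real (G \<omega>) * cnj (rotation (hi k) \<omega>) ^ n * ((?g (X k) \<omega> ^ n - ?g t \<omega> ^ n) / of_real (X k - t))) \<in> borel_measurable M" for k
        by (intro borel_measurable_times borel_measurable_power borel_measurable_divide borel_measurable_diff borel_measurable_const
            borel_measurable_cnj rv rvG)
      show "AE \<omega> in M. (\<lambda>k. of_real (G \<omega>) * cnj (rotation (hi k) \<omega>) ^ n * ((?g (X k) \<omega> ^ n - ?g t \<omega> ^ n) / of_real (X k - t)))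
         \<longlonglongrightarrow> of_real (K * real n) * (of_real (G \<omega>) * h t \<omega> ^ (n - 1) - of_real (G \<omega>) * h t \<omega> ^ Suc n)"
        using path_derivative rotated_solution
      proof eventually_elim
        case (elim \<omega>)
        let ?D = "rotation t \<omega> * (of_real K * (1 - (h t \<omega>)\<^sup>2))"
        have "((\<lambda>u. ?g u \<omega>) has_vector_derivative ?D) (at t within {0..})" using elim(1) \<open>0 < t\<close> by auto
        then have "((\<lambda>z. z ^ n) \<circ> (\<lambda>u. ?g u \<omega>) has_vector_derivative ?D * (of_nat n * ?g t \<omega> ^ (n - 1))) (at t within {0..})"
          by (rule field_vector_diff_chain_within) (auto intro!: derivative_eq_intros)
        then have "((\<lambda>u. (?g u \<omega> ^ n - ?g t \<omega> ^ n) / of_real (u - t)) \<longlongrightarrow> ?D * (of_nat n * ?g t \<omega> ^ (n - 1))) (at t within {0..})"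
          unfolding has_vector_derivative_iff_quotient o_def .
        moreover have "\<forall>i. X i \<in> {0..} - {t}" using X(1) \<open>0 \<le> s0\<close> by (force intro: less_imp_le le_less_trans)
        ultimately have q: "(\<lambda>k. (?g (X k) \<omega> ^ n - ?g t \<omega> ^ n) / of_real (X k - t)) \<longlonglongrightarrow> ?D * (of_nat n * ?g t \<omega> ^ (n - 1))"
          using X(2) unfolding tendsto_at_iff_sequentially o_def by blast
        have "(\<lambda>k. rotation (hi k) \<omega>) \<longlonglongrightarrow> rotation t \<omega>"
          using elim(2) hi lh(4) \<open>0 < t\<close> by (auto simp: continuous_on_sequentially o_def)
        then have "(\<lambda>k. of_real (G \<omega>) * cnj (rotation (hi k) \<omega>) ^ n * ((?g (X k) \<omega> ^ n - ?g t \<omega> ^ n) / of_real (X k - t)))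
          \<longlonglongrightarrow> of_real (G \<omega>) * cnj (rotation t \<omega>) ^ n * (?D * (of_nat n * ?g t \<omega> ^ (n - 1)))"
          using q by (intro tendsto_intros)
        \<comment> \<open>The conjugate rotation to the power \<open>n\<close> cancels the
          \<open>n\<close> rotations in the derivative of (Z h)^n. What is left is K n (1 - h^2)
          h^(n-1); for n = 0 both sides are 0.\<close>
        also have "of_real (G \<omega>) * cnj (rotation t \<omega>) ^ n * (?D * (of_nat n * ?g t \<omega> ^ (n - 1)))
          = of_real (K * real n) * (of_real (G \<omega>) * h t \<omega> ^ (n - 1) - of_real (G \<omega>) * h t \<omega> ^ Suc n)"
        proof (cases n)
          case (Suc m)
          have one: "cnj (rotation t \<omega>) * rotation t \<omega> = 1"
            using complex_norm_square[of "rotation t \<omega>"] by (simp add: mult.commute)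
          have "cnj (rotation t \<omega>) ^ Suc m * (rotation t \<omega> * ?g t \<omega> ^ m) = (cnj (rotation t \<omega>) * rotation t \<omega>) ^ Suc m * h t \<omega> ^ m"
            by (simp only: power_mult_distrib power_Suc mult_ac)
          then have e1: "cnj (rotation t \<omega>) ^ Suc m * (rotation t \<omega> * ?g t \<omega> ^ m) = h t \<omega> ^ m"
            unfolding one by simp
          have e2: "of_real (G \<omega>) * cnj (rotation t \<omega>) ^ n * (?D * (of_nat n * ?g t \<omega> ^ (n - 1))) =
             of_real (G \<omega>) * of_real K * of_nat n * (1 - (h t \<omega>)\<^sup>2) * (cnj (rotation t \<omega>) ^ Suc m * (rotation t \<omega> * ?g t \<omega> ^ m))"
            unfolding Suc by (simp only: diff_Suc_1 mult_ac)
          show ?thesis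
            by (rule trans[OF e2[unfolded e1]]) (simp add: Suc algebra_simps power2_eq_square)
        qed simp
        finally show ?case .
      qed
      show "AE \<omega> in M. norm (of_real (G \<omega>) * cnj (rotation (hi k) \<omega>) ^ n * ((?g (X k) \<omega> ^ n - ?g t \<omega> ^ n) / of_real (X k - t)))
         \<le> B * (real n * (2 * K))" for k
        using path_Lipschitz norm_h_le
      proof eventually_elim
        case (elim \<omega>)
        have Xk: "0 \<le> X k" "X k \<noteq> t" using X(1)[rule_format, of k] \<open>0 \<le> s0\<close> by auto
        have "norm (?g (X k) \<omega> ^ n - ?g t \<omega> ^ n) \<le> n * norm (?g (X k) \<omega> - ?g t \<omega>)"
          using elim(2) Xk \<open>0 < t\<close> by (intro norm_power_diff) (auto simp: norm_mult)
        also have "\<dots> \<le> n * (2 * K * \<bar>X k - t\<bar>)"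
          using elim(1) Xk \<open>0 < t\<close> by (intro mult_left_mono) auto
        finally have "norm ((?g (X k) \<omega> ^ n - ?g t \<omega> ^ n) / of_real (X k - t)) \<le> n * (2 * K)"
          using Xk by (simp add: norm_divide pos_divide_le_eq mult.assoc del: of_real_diff)
        then have "\<bar>G \<omega>\<bar> * norm ((?g (X k) \<omega> ^ n - ?g t \<omega> ^ n) / of_real (X k - t)) \<le> B * (n * (2 * K))"
          using G(2)[of \<omega>] by (intro mult_mono) auto
        then show ?case
          by (simp only: norm_mult norm_power norm_of_real complex_mod_cnj norm_rotation power_one mult_1_right)
      qed
    qed simp
    moreover have "(\<lambda>k. wmom G n (lo k) * of_real ((exp (- (\<kappa> * (hi k - lo k))) - 1) / (hi k - lo k))) \<longlonglongrightarrow> wmom G n t * of_real (- \<kappa>)"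
    proof (intro tendsto_mult tendsto_of_real exp_difference_quotient wmom_tendsto[OF GM G(2)])
      show "(\<lambda>k. hi k - lo k) \<longlonglongrightarrow> 0" using tendsto_diff[OF hi lo] by simp
      show "hi k - lo k \<noteq> 0" for k using lh(2)[of k] by simp
    qed (use lh lo \<open>0 < t\<close> in auto)
    ultimately show "(\<lambda>k. (wmom G n (X k) - wmom G n t) / of_real (X k - t)) \<longlonglongrightarrow> L + wmom G n t * of_real (- \<kappa>)"
      by (simp only:) (rule tendsto_add)
  qed
  moreover have "t \<in> {s0<..}" using \<open>s0 < t\<close> by simp
  ultimately have "(wmom G n has_vector_derivative L + wmom G n t * of_real (- \<kappa>)) (at t)"
    by (simp only: has_vector_derivative_within_open[OF _ open_greaterThan])
  moreover have "L + wmom G n t * of_real (- \<kappa>) =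
      - of_real (c\<^sup>2 / 2 * (real n)\<^sup>2) * wmom G n t + of_real (K * real n) * (wmom G (n - 1) t - wmom G (Suc n) t)"
    by (simp add: L \<kappa>_def mult.commute[of "wmom G n t"])
  ultimately show ?thesis by simp
qed

end

subsection \<open>Polynomials on the circle and comparison of moments\<close>

text \<open>On the unit circle every real polynomial is the real part of a holomorphic polynomial.\<close>

definition circle_poly :: "(complex \<Rightarrow> real) \<Rightarrow> bool" where
  "circle_poly f \<longleftrightarrow> (\<exists>P. \<forall>z. norm z = 1 \<longrightarrow> f z = Re (poly P z))"

lemma circle_poly_add: "circle_poly f \<Longrightarrow> circle_poly g \<Longrightarrow> circle_poly (\<lambda>z. f z + g z)"
  unfolding circle_poly_def
proof (elim exE)
  fix P Q :: "complex poly"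
  assume "\<forall>z. norm z = 1 \<longrightarrow> f z = Re (poly P z)" "\<forall>z. norm z = 1 \<longrightarrow> g z = Re (poly Q z)"
  then show "\<exists>P. \<forall>z. norm z = 1 \<longrightarrow> f z + g z = Re (poly P z)"
    by (intro exI[of _ "P + Q"]) simp
qed

lemma circle_poly_sum: "finite I \<Longrightarrow> (\<And>i. i \<in> I \<Longrightarrow> circle_poly (f i)) \<Longrightarrow> circle_poly (\<lambda>z. \<Sum>i\<in>I. f i z)"
proof (induction I rule: finite_induct)
  case empty
  show ?case unfolding circle_poly_def by (intro exI[of _ 0]) simp
next
  case (insert i I)
  then show ?case using circle_poly_add[of "f i" "\<lambda>z. \<Sum>i\<in>I. f i z"] by simp
qed

lemma circle_poly_monom: "circle_poly (\<lambda>z. Re (a * z ^ i))"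
  unfolding circle_poly_def by (intro exI[of _ "monom a i"]) (simp add: poly_monom)

text \<open>Re u * Re v is half of Re (u v) + Re (u * cnj v), and on the circle
  \<open>z^i * cnj z^j\<close> collapses to \<open>z^(i - j)\<close>. The condition j \<le> i keeps
  that exponent nonnegative, hence the polynomial holomorphic.\<close>

lemma circle_poly_monom_mult_aux:
  assumes "j \<le> i"
  shows "circle_poly (\<lambda>z. Re (a * z ^ i) * Re (b * z ^ j))"
proof -
  have "circle_poly (\<lambda>z. Re (a * b / 2 * z ^ (i + j)) + Re (a * cnj b / 2 * z ^ (i - j)))"
    by (intro circle_poly_add circle_poly_monom)
  then obtain P where P: "\<And>z. norm z = 1 \<Longrightarrow> Re (a * b / 2 * z ^ (i + j)) + Re (a * cnj b / 2 * z ^ (i - j)) = Re (poly P z)"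
    unfolding circle_poly_def by blast
  have "Re (a * z ^ i) * Re (b * z ^ j) = Re (a * b / 2 * z ^ (i + j)) + Re (a * cnj b / 2 * z ^ (i - j))"
    if "norm z = 1" for z
  proof -
    have one: "z * cnj z = 1" using that complex_norm_square[of z] by simp
    have "z ^ i = z ^ (i - j) * z ^ j" using assms by (simp add: power_add[symmetric])
    then have "z ^ i * cnj z ^ j = z ^ (i - j) * (z * cnj z) ^ j"
      by (simp add: power_mult_distrib)
    then have *: "z ^ i * cnj z ^ j = z ^ (i - j)" by (simp add: one)
    have re: "Re u * Re v = Re (u * v / 2) + Re (u * cnj v / 2)" for u v :: complex
      by (simp add: field_simps)
    have "a * z ^ i * cnj (b * z ^ j) = a * cnj b * (z ^ i * cnj z ^ j)" by simp
    then have e: "a * z ^ i * cnj (b * z ^ j) = a * cnj b * z ^ (i - j)" by (simp only: *)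
    show ?thesis unfolding re[of "a * z ^ i"] e
      by (simp only: power_add times_divide_eq_left times_divide_eq_right mult_ac)
  qed
  with P show ?thesis unfolding circle_poly_def by (intro exI[of _ P]) auto
qed

lemma circle_poly_monom_mult: "circle_poly (\<lambda>z. Re (a * z ^ i) * Re (b * z ^ j))"
  using circle_poly_monom_mult_aux[of j i a b] circle_poly_monom_mult_aux[of i j b a]
  by (cases "j \<le> i") (simp_all add: mult.commute)

lemma circle_poly_mult:
  assumes "circle_poly f" "circle_poly g"
  shows "circle_poly (\<lambda>z. f z * g z)"
proof -
  obtain P Q where P: "\<And>z. norm z = 1 \<Longrightarrow> f z = Re (poly P z)" and Q: "\<And>z. norm z = 1 \<Longrightarrow> g z = Re (poly Q z)"
    using assms unfolding circle_poly_def by blast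
  have "circle_poly (\<lambda>z. \<Sum>i\<in>{..degree P}. \<Sum>j\<in>{..degree Q}. Re (coeff P i * z ^ i) * Re (coeff Q j * z ^ j))"
    by (intro circle_poly_sum circle_poly_monom_mult) auto
  then obtain R where R: "\<And>z. norm z = 1 \<Longrightarrow>
      (\<Sum>i\<in>{..degree P}. \<Sum>j\<in>{..degree Q}. Re (coeff P i * z ^ i) * Re (coeff Q j * z ^ j)) = Re (poly R z)"
    unfolding circle_poly_def by blast
  have eq: "f z * g z = (\<Sum>i\<in>{..degree P}. \<Sum>j\<in>{..degree Q}. Re (coeff P i * z ^ i) * Re (coeff Q j * z ^ j))"
    if "norm z = 1" for z
    unfolding P[OF that] Q[OF that] poly_altdef Re_sum sum_product ..
  show ?thesis
    unfolding circle_poly_def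
  proof (intro exI[of _ R] allI impI)
    fix z :: complex assume "norm z = 1"
    then show "f z * g z = Re (poly R z)" using eq[of z] R[of z] by (simp only:)
  qed
qed

lemma circle_poly_real_polynomial: "real_polynomial_function f \<Longrightarrow> circle_poly f"
proof (induction rule: real_polynomial_function.induct)
  case (linear f)
  interpret bounded_linear f by fact
  \<comment> \<open>A real linear form has the value Re z * f 1 + Im z * f \<i>, which is the real
    part of (f 1 - \<i> * f \<i>) * z.\<close>
  have "f z = Re ((of_real (f 1) - \<i> * of_real (f \<i>)) * z ^ 1)" for z
  proof -
    have "z = Re z *\<^sub>R 1 + Im z *\<^sub>R \<i>" by (simp add: complex_eq_iff)
    then have "f z = Re z * f 1 + Im z * f \<i>" by (metis add scaleR real_scaleR_def)
    then show ?thesis by simp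
  qed
  then have eq: "f = (\<lambda>z. Re ((of_real (f 1) - \<i> * of_real (f \<i>)) * z ^ 1))" by (rule ext)
  show ?case by (subst eq) (rule circle_poly_monom)
next
  case (const c)
  show ?case using circle_poly_monom[of "of_real c" 0] by simp
next
  case (add f g)
  show ?case by (rule circle_poly_add[OF add.IH])
next
  case (mult f g)
  show ?case by (rule circle_poly_mult[OF mult.IH])
qed

text \<open>The set where |f| is at least \<open>e\<close> is compact and avoids the circle, so 1 -
  |z|^2 has a positive minimum \<eta> on it. There a bound of |f| times ((1 - |z|^2) / \<eta>)^p
  dominates |f|.\<close>

lemma continuous_small_near_circle:
  fixes f :: "complex \<Rightarrow> real"
  assumes f: "continuous_on (cball 0 1) f" and small: "\<And>z. norm z = 1 \<Longrightarrow> \<bar>f z\<bar> < e" and "0 < p"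
  shows "\<exists>C\<ge>0. \<forall>z\<in>cball 0 1. \<bar>f z\<bar> \<le> e + C * max 0 (1 - (norm z)\<^sup>2) powr p"
proof -
  define A where "A = {z \<in> cball 0 1. e \<le> \<bar>f z\<bar>}"
  have A: "compact A"
  proof -
    have "continuous_on (cball 0 1) (\<lambda>z. \<bar>f z\<bar>)" using f by (intro continuous_intros)
    then have "closed (cball 0 1 \<inter> (\<lambda>z. \<bar>f z\<bar>) -` {e..})"
      by (rule continuous_closed_preimage) auto
    from compact_Int_closed[OF compact_cball this, of 0 1]
    have "compact (cball 0 1 \<inter> (cball 0 1 \<inter> (\<lambda>z. \<bar>f z\<bar>) -` {e..}))" .
    moreover have "A = cball 0 1 \<inter> (cball 0 1 \<inter> (\<lambda>z. \<bar>f z\<bar>) -` {e..})" by (auto simp: A_def)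
    ultimately show ?thesis by simp
  qed
  show ?thesis
  proof (cases "A = {}")
    case True
    have "\<bar>f z\<bar> \<le> e" if "z \<in> cball 0 1" for z
    proof -
      have "\<not> e \<le> \<bar>f z\<bar>" using True that by (auto simp: A_def)
      then show ?thesis by simp
    qed
    then show ?thesis by (intro exI[of _ 0]) auto
  next
    case False
    obtain z0 where z0: "z0 \<in> A" "\<And>z. z \<in> A \<Longrightarrow> norm z \<le> norm z0"
      using continuous_attains_sup[OF A False, of norm] by (auto intro: continuous_intros)
    have "norm z0 < 1"
      using z0(1) small[of z0] by (auto simp: A_def order_le_less)
    define \<eta> where "\<eta> = 1 - (norm z0)\<^sup>2"
    have "0 < \<eta>" using \<open>norm z0 < 1\<close> by (simp add: \<eta>_def abs_square_less_1)
    have "compact (f ` cball 0 1)" using f by (intro compact_continuous_image) auto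
    then obtain B where B: "\<And>z. z \<in> cball 0 1 \<Longrightarrow> \<bar>f z\<bar> \<le> B"
      by (force dest!: compact_imp_bounded simp: bounded_iff)
    have "0 \<le> B" using order_trans[OF abs_ge_zero B[of 0]] by simp
    show ?thesis
    proof (intro exI[of _ "B / \<eta> powr p"] conjI ballI)
      show "0 \<le> B / \<eta> powr p" using \<open>0 \<le> B\<close> by simp
      fix z :: complex assume z: "z \<in> cball 0 1"
      have "0 < e" using small[of 1] by (simp add: order_le_less_trans[OF abs_ge_zero])
      show "\<bar>f z\<bar> \<le> e + B / \<eta> powr p * max 0 (1 - (norm z)\<^sup>2) powr p"
      proof (cases "z \<in> A")
        case True
        then have "(norm z)\<^sup>2 \<le> (norm z0)\<^sup>2" using z0(2) by (intro power_mono) auto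
        then have "\<eta> \<le> max 0 (1 - (norm z)\<^sup>2)" unfolding \<eta>_def by linarith
        then have "\<eta> powr p \<le> max 0 (1 - (norm z)\<^sup>2) powr p"
          using \<open>0 < \<eta>\<close> \<open>0 < p\<close> by (intro powr_mono2) auto
        then have "B * 1 \<le> B * (max 0 (1 - (norm z)\<^sup>2) powr p / \<eta> powr p)"
          using \<open>0 < \<eta>\<close> \<open>0 \<le> B\<close> by (intro mult_left_mono) auto
        then show ?thesis using B[OF z] \<open>0 < e\<close> by simp
      next
        case False
        then have "\<bar>f z\<bar> \<le> e" using z by (auto simp: A_def)
        moreover have "0 \<le> B / \<eta> powr p * max 0 (1 - (norm z)\<^sup>2) powr p" using \<open>0 \<le> B\<close> by simp
        ultimately show ?thesis by linarith
      qed
    qed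
  qed
qed

text \<open>Over a late unit interval the increment of \<open>a\<close> is at most 2 e, yet it
  differs from \<open>L\<close> by at most \<open>e\<close>.\<close>

lemma limit_of_derivative_zero:
  fixes a :: "real \<Rightarrow> complex"
  assumes da: "\<And>t. 0 < t \<Longrightarrow> (a has_vector_derivative D t) (at t)"
    and a: "(a \<longlongrightarrow> l) at_top" and D: "(D \<longlongrightarrow> L) at_top"
  shows "L = 0"
proof -
  have "norm L \<le> 3 * e" if "0 < e" for e
  proof -
    have "eventually (\<lambda>t. dist (a t) l < e) at_top" "eventually (\<lambda>t. dist (D t) L < e) at_top"
      using a D that by (auto dest: tendstoD)
    then have "eventually (\<lambda>t. dist (a t) l < e \<and> dist (D t) L < e \<and> 0 < t) at_top"
      using eventually_gt_at_top[of 0] by eventually_elim auto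
    then obtain T where T: "\<And>t. T \<le> t \<Longrightarrow> dist (a t) l < e \<and> dist (D t) L < e \<and> 0 < t"
      by (auto simp: eventually_at_top_linorder)
    have dv: "((\<lambda>t. a t - t *\<^sub>R L) has_vector_derivative D t - L) (at t)" if "T \<le> t" for t
      using T[OF that] by (auto intro!: derivative_eq_intros da)
    have "norm ((a (T + 1) - (T + 1) *\<^sub>R L) - (a T - T *\<^sub>R L)) \<le> e * (T + 1) - e * T"
    proof (rule differentiable_bound_general[where f="\<lambda>t. a t - t *\<^sub>R L"])
      show "continuous_on {T..T + 1} (\<lambda>t. a t - t *\<^sub>R L)"
        by (intro continuous_at_imp_continuous_on ballI has_vector_derivative_continuous[OF dv]) auto
      show "continuous_on {T..T+1} (\<lambda>t. e * t)" by (intro continuous_intros)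
      fix u assume "T < u" "u < T + 1"
      then show "((\<lambda>t. a t - t *\<^sub>R L) has_vector_derivative D u - L) (at u)" by (intro dv) auto
      show "((\<lambda>t. e * t) has_vector_derivative e) (at u)"
        unfolding has_real_derivative_iff_has_vector_derivative[symmetric] by (auto intro!: derivative_eq_intros)
      show "norm (D u - L) \<le> e" using T[of u] \<open>T < u\<close> by (auto simp: dist_norm)
    qed simp
    moreover have "(a (T + 1) - (T + 1) *\<^sub>R L) - (a T - T *\<^sub>R L) = (a (T + 1) - l) - (a T - l) - L"
      by (simp add: algebra_simps)
    ultimately have "norm ((a (T + 1) - l) - (a T - l) - L) \<le> e" by (simp add: algebra_simps)
    then have "norm L \<le> e + norm ((a (T + 1) - l) - (a T - l))"
      using norm_triangle_ineq3[of "(a (T + 1) - l) - (a T - l)" L] by linarith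
    also have "norm ((a (T + 1) - l) - (a T - l)) \<le> e + e"
      using T[of T] T[of "T + 1"] by (rule_tac order_trans[OF norm_triangle_ineq4 add_mono]) (auto simp: dist_norm)
    finally show ?thesis by simp
  qed
  from this[of "norm L / 6"] show ?thesis by (cases "L = 0") auto
qed

section \<open>Superposition and time shift of moment systems\<close>

lemma moment_system_diff:
  assumes "moment_system \<kappa> K s B a" "moment_system \<kappa> K s B' a'"
  shows "moment_system \<kappa> K s (B + B') (\<lambda>n t. a n t - a' n t)"
  unfolding moment_system_def
proof (intro allI impI conjI)
  fix n t assume "s < t"
  then have B: "norm (a n t) \<le> B" "norm (a' n t) \<le> B'"
    and d: "(a n has_vector_derivative (- of_real (\<kappa> * (real n)\<^sup>2) * a n t + of_real (K * real n) * (a (n - 1) t - a (Suc n) t))) (at t)"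
      "(a' n has_vector_derivative (- of_real (\<kappa> * (real n)\<^sup>2) * a' n t + of_real (K * real n) * (a' (n - 1) t - a' (Suc n) t))) (at t)"
    using assms by (simp_all add: moment_system_def)
  show "norm (a n t - a' n t) \<le> B + B'" using B norm_triangle_ineq4[of "a n t" "a' n t"] by linarith
  show "((\<lambda>t. a n t - a' n t) has_vector_derivative (- of_real (\<kappa> * (real n)\<^sup>2) * (a n t - a' n t)
      + of_real (K * real n) * ((a (n - 1) t - a' (n - 1) t) - (a (Suc n) t - a' (Suc n) t)))) (at t)"
    using has_vector_derivative_diff[OF d] by (simp only: algebra_simps)
qed

text \<open>The factor \<open>g\<close> is going to be the mean of a weight \<open>G\<close>, and
  \<open>s\<close> the time at which \<open>G\<close> is known. The scaled system then has the same
  zeroth moment as the one weighted by \<open>G\<close>.\<close>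

lemma moment_system_shift:
  assumes a: "moment_system \<kappa> K 0 B a" and "0 \<le> g"
  shows "moment_system \<kappa> K s (g * B) (\<lambda>n t. of_real g * a n (t - s))"
  unfolding moment_system_def
proof (intro allI impI conjI)
  fix n t assume "s < t"
  then have B: "norm (a n (t - s)) \<le> B"
    and d: "(a n has_vector_derivative (- of_real (\<kappa> * (real n)\<^sup>2) * a n (t - s) + of_real (K * real n) * (a (n - 1) (t - s) - a (Suc n) (t - s)))) (at (t - s))"
    using a by (simp_all add: moment_system_def)
  show "norm (of_real g * a n (t - s)) \<le> g * B"
    using B \<open>0 \<le> g\<close> by (simp add: norm_mult mult_left_mono)
  have "((\<lambda>t. t - s) has_vector_derivative 1) (at t)"
    unfolding has_real_derivative_iff_has_vector_derivative[symmetric] by (auto intro!: derivative_eq_intros)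
  from vector_diff_chain_at[OF this d]
  have "((\<lambda>t. a n (t - s)) has_vector_derivative (- of_real (\<kappa> * (real n)\<^sup>2) * a n (t - s) + of_real (K * real n) * (a (n - 1) (t - s) - a (Suc n) (t - s)))) (at t)"
    by (simp add: o_def)
  from has_vector_derivative_mult_right[OF this, of "of_real g"]
  show "((\<lambda>t. of_real g * a n (t - s)) has_vector_derivative (- of_real (\<kappa> * (real n)\<^sup>2) * (of_real g * a n (t - s))
      + of_real (K * real n) * (of_real g * a (n - 1) (t - s) - of_real g * a (Suc n) (t - s)))) (at t)"
    by (simp only: distrib_left right_diff_distrib mult.left_commute minus_mult_left[symmetric] minus_mult_right[symmetric])
qed

context disc_solution
begin

lemma moment_system_wmom:
  assumes "0 \<le> s0" and G: "G \<in> borel_measurable (F s0)" "\<And>\<omega>. 0 \<le> G \<omega>" "\<And>\<omega>. G \<omega> \<le> B"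
  shows "moment_system (c\<^sup>2 / 2) K s0 (\<integral>\<omega>. G \<omega> \<partial>M) (wmom G)"
  unfolding moment_system_def
proof (intro allI impI conjI)
  fix n t assume "s0 < t"
  have G': "\<bar>G \<omega>\<bar> \<le> B" for \<omega> using G(2,3)[of \<omega>] by simp
  show "norm (wmom G n t) \<le> (\<integral>\<omega>. G \<omega> \<partial>M)"
    using \<open>s0 < t\<close> \<open>0 \<le> s0\<close> by (intro norm_wmom_le[OF measurable_F_M[OF G(1)] G(2) G']) auto
  show "(wmom G n has_vector_derivative (- of_real (c\<^sup>2 / 2 * (real n)\<^sup>2) * wmom G n t
      + of_real (K * real n) * (wmom G (n - 1) t - wmom G (Suc n) t))) (at t)"
    by (rule wmom_derivative[OF \<open>0 \<le> s0\<close> \<open>s0 < t\<close> G(1) G'])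
qed

end

subsection \<open>The invariant measure\<close>

locale disc_flow = brownian_space M F W for M :: "'a measure" and F W +
  fixes K c :: real and h :: "complex \<Rightarrow> real \<Rightarrow> 'a \<Rightarrow> complex" and \<mu> :: "complex measure"
  assumes K_pos: "0 < K" and c_nonzero: "c \<noteq> 0"
    and flow: "\<And>y. y \<in> cball 0 1 \<Longrightarrow>
      stratonovich_solution M F W (\<lambda>z. of_real K * (1 - z\<^sup>2)) (\<lambda>z. \<i> * of_real c * z) y (h y)"
    and invariant: "invariant_prob_measure M h (sphere 0 1) \<mu>"
begin

lemma disc_solution_flow: "norm y \<le> 1 \<Longrightarrow> disc_solution M F W K c y (h y)"
  by (intro disc_solution.intro linear_noise_solution.intro disc_solution_axioms.intro
      linear_noise_solution_axioms.intro brownian_space_axioms flow K_pos continuous_intros) auto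

definition \<kappa> :: real where "\<kappa> = c\<^sup>2 / 2"

lemma kappa_pos: "0 < \<kappa>"
  using c_nonzero by (simp add: \<kappa>_def)

text \<open>The starting point is an explicit argument here, so that moments from different points
  can be compared.\<close>

definition mom :: "complex \<Rightarrow> ('a \<Rightarrow> real) \<Rightarrow> nat \<Rightarrow> real \<Rightarrow> complex" where
  "mom y G n t = (\<integral>\<omega>. of_real (G \<omega>) * h y t \<omega> ^ n \<partial>M)"

lemma mom_eq: "norm y \<le> 1 \<Longrightarrow> mom y G = disc_solution.wmom M (h y) G"
  by (intro ext) (simp add: mom_def disc_solution.wmom_def[OF disc_solution_flow])

lemma h_measurable: "norm y \<le> 1 \<Longrightarrow> 0 \<le> t \<Longrightarrow> h y t \<in> borel_measurable M"
proof -
  assume "norm y \<le> 1" "0 \<le> t"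
  interpret disc_solution M F W K c y "h y" by (rule disc_solution_flow) fact
  show ?thesis using \<open>0 \<le> t\<close> by (rule h_rv)
qed

lemma h_le: "norm y \<le> 1 \<Longrightarrow> AE \<omega> in M. \<forall>t\<ge>0. norm (h y t \<omega>) \<le> 1"
proof -
  assume "norm y \<le> 1"
  interpret disc_solution M F W K c y "h y" by (rule disc_solution_flow) fact
  show ?thesis by (rule norm_h_le)
qed

text \<open>The square root of the bound in \<open>moment_system_energy\<close>. The factor 2 next
  to (2 + 2 K) is the bound for a difference of two systems that are each bounded by 1.\<close>

definition rate :: "nat \<Rightarrow> real \<Rightarrow> real" where
  "rate n t = sqrt (2 * real n) * (2 * (2 + 2 * K) / \<kappa>) * exp (- \<kappa> * (t - 1))"

lemma rate_nonneg: "0 \<le> rate n t"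
  using K_pos kappa_pos by (simp add: rate_def)

lemma rate_tendsto_0: "(rate n \<longlongrightarrow> 0) at_top"
proof -
  have "((\<lambda>t. sqrt (2 * real n) * (2 * (2 + 2 * K) / \<kappa>) * exp (- \<kappa> * (t - 1))) \<longlongrightarrow>
      sqrt (2 * real n) * (2 * (2 + 2 * K) / \<kappa>) * 0) at_top"
  proof (intro tendsto_intros filterlim_compose[OF exp_at_bot])
    have "filterlim (\<lambda>t. t - 1) at_top (at_top :: real filter)"
      using filterlim_tendsto_add_at_top[OF tendsto_const[of "-1"] filterlim_ident] by simp
    then show "filterlim (\<lambda>t. - \<kappa> * (t - 1)) at_bot at_top"
      using kappa_pos by (intro filterlim_tendsto_neg_mult_at_bot[OF tendsto_const]) auto
  qed
  then show ?thesis by (simp add: rate_def[abs_def])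
qed

text \<open>Both terms solve the moment system after time \<open>s\<close> and have the same zeroth
  moment, the mean of \<open>G\<close>; the energy estimate applies to the difference. Since
  \<open>G\<close> is arbitrary, the moments conditioned on the past at \<open>s\<close> come close
  to those from any fixed point \<open>y\<close>, with an error that depends only on the elapsed
  time \<open>t\<close>.\<close>

lemma mom_compare:
  assumes x: "norm x \<le> 1" and y: "norm y \<le> 1" and "0 \<le> s" "1 \<le> t"
    and G: "G \<in> borel_measurable (F s)" "\<And>\<omega>. 0 \<le> G \<omega>" "\<And>\<omega>. G \<omega> \<le> B"
  shows "norm (mom x G n (s + t) - of_real (\<integral>\<omega>. G \<omega> \<partial>M) * mom y (\<lambda>_. 1) n t) \<le> (\<integral>\<omega>. G \<omega> \<partial>M) * rate n t"
proof -
  define g where "g = (\<integral>\<omega>. G \<omega> \<partial>M)"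
  have "0 \<le> g" unfolding g_def using G(2) by simp
  define d where "d n u = mom x G n u - of_real g * mom y (\<lambda>_. 1) n (u - s)" for n u
  have X: "moment_system \<kappa> K s g (mom x G)"
    unfolding mom_eq[OF x] \<kappa>_def g_def by (rule disc_solution.moment_system_wmom[OF disc_solution_flow[OF x] \<open>0 \<le> s\<close> G])
  have "moment_system \<kappa> K 0 (\<integral>\<omega>. 1 \<partial>M) (mom y (\<lambda>_. 1))"
    unfolding mom_eq[OF y] \<kappa>_def by (rule disc_solution.moment_system_wmom[OF disc_solution_flow[OF y], where B=1]) auto
  then have "moment_system \<kappa> K 0 1 (mom y (\<lambda>_. 1))" by (simp add: prob_space)
  from moment_system_diff[OF X moment_system_shift[OF this \<open>0 \<le> g\<close>, of s]]
  have d: "moment_system \<kappa> K s (2 * g) d"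
    unfolding d_def[abs_def] by simp
  have d0: "d 0 u = 0" for u
    by (simp add: d_def mom_def g_def prob_space)
  show ?thesis
  proof (cases "n = 0")
    case True
    \<comment> \<open>The energy carries weights 1/n and starts at n = 1. For n = 0 the difference
      vanishes, and so does \<open>rate 0\<close>.\<close>
    have "d 0 (s + t) = 0" by (rule d0)
    then show ?thesis using True by (simp add: d_def g_def rate_def)
  next
    case False
    have "(norm (d n (s + t)))\<^sup>2 \<le> n * (2 * ((2 * g) * (2 + 2 * K) / \<kappa>)\<^sup>2 * exp (- 2 * \<kappa> * (s + t - (s + 1))))"
      using False \<open>1 \<le> t\<close> by (intro moment_system_energy[OF d d0 kappa_pos K_pos]) auto
    also have "\<dots> = (g * rate n t)\<^sup>2"
    proof -
      have "(exp (- \<kappa> * (t - 1)))\<^sup>2 = exp (- 2 * \<kappa> * (t - 1))"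
        by (simp add: power2_eq_square exp_add[symmetric])
      then show ?thesis
        by (simp add: rate_def power_mult_distrib power_divide) (simp add: power2_eq_square algebra_simps)
    qed
    finally have sq: "(norm (d n (s + t)))\<^sup>2 \<le> (g * rate n t)\<^sup>2" .
    have "0 \<le> g * rate n t" using \<open>0 \<le> g\<close> rate_nonneg by (rule mult_nonneg_nonneg)
    from power2_le_imp_le[OF sq this] show ?thesis by (simp add: d_def g_def)
  qed
qed

lemma space_mu: "space \<mu> = sphere 0 1"
proof -
  have "sets \<mu> = sets (restrict_space borel (sphere 0 1))"
    using invariant by (simp add: invariant_prob_measure_def)
  from sets_eq_imp_space_eq[OF this] show ?thesis by (simp add: space_restrict_space)
qed

lemma sets_mu: "sets \<mu> = sets (restrict_space borel (sphere 0 1))"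
  using invariant by (simp add: invariant_prob_measure_def)

sublocale mu: prob_space \<mu>
  using invariant by (simp add: invariant_prob_measure_def)

lemma measurable_mu: "f \<in> borel_measurable borel \<Longrightarrow> f \<in> borel_measurable \<mu>"
  by (simp add: measurable_cong_sets[OF sets_mu refl] measurable_restrict_space1)

lemma integrable_mu_bounded:
  fixes f :: "complex \<Rightarrow> 'b::{banach, second_countable_topology}"
  assumes "f \<in> borel_measurable borel" "\<And>z. norm z = 1 \<Longrightarrow> norm (f z) \<le> B"
  shows "integrable \<mu> f"
  using assms by (intro mu.integrable_const_bound[where B=B] AE_I2 measurable_mu) (auto simp: space_mu)

lemma integrable_flow:
  fixes f :: "complex \<Rightarrow> real"
  assumes "f \<in> borel_measurable borel" "bounded (range f)" "norm y \<le> 1" "0 \<le> t"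
  shows "integrable M (\<lambda>\<omega>. f (h y t \<omega>))"
proof -
  obtain B where B: "\<And>z. norm (f z) \<le> B" using assms(2) by (auto simp: bounded_iff)
  show ?thesis
    using B by (intro integrable_const_bound[where B=B] measurable_compose[OF h_measurable assms(1)] assms) auto
qed

text \<open>
  Invariance for both \<open>f\<close> and \<open>f + 1\<close> forces \<open>P\<^sub>t f\<close> to be integrable, since the integral of a
  non-integrable function is \<open>0\<close> by convention.
\<close>

lemma integrable_transition_op:
  fixes f :: "complex \<Rightarrow> real"
  assumes f: "f \<in> borel_measurable borel" "bounded (range f)" and "0 \<le> t"
  shows "integrable \<mu> (transition_op M h t f)"
proof (rule ccontr)
  assume ni: "\<not> integrable \<mu> (transition_op M h t f)"
  have inv: "(\<integral>x. transition_op M h t g x \<partial>\<mu>) = (\<integral>x. g x \<partial>\<mu>)"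
    if "g \<in> borel_measurable borel" "bounded (range g)" for g
    using invariant \<open>0 \<le> t\<close> that by (simp add: invariant_prob_measure_def)
  let ?g = "\<lambda>z. f z + 1"
  have g: "?g \<in> borel_measurable borel" "bounded (range ?g)"
    using f bounded_plus_comp[OF f(2), of "\<lambda>_. 1"] by auto
  have eq: "transition_op M h t ?g y = transition_op M h t f y + 1" if "y \<in> space \<mu>" for y
    using integrable_flow[OF f _ \<open>0 \<le> t\<close>, of y] that by (simp add: transition_op_def space_mu prob_space)
  have "\<not> integrable \<mu> (transition_op M h t ?g)"
  proof
    assume "integrable \<mu> (transition_op M h t ?g)"
    then have "integrable \<mu> (\<lambda>y. transition_op M h t f y + 1)"
      using eq by (subst (asm) Bochner_Integration.integrable_cong[OF refl]) auto
    then have "integrable \<mu> (\<lambda>y. (transition_op M h t f y + 1) - 1)"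
      by (intro Bochner_Integration.integrable_diff) auto
    then show False using ni by simp
  qed
  then have "(\<integral>x. ?g x \<partial>\<mu>) = 0" using inv[OF g] by (simp add: not_integrable_integral_eq)
  moreover have "(\<integral>x. f x \<partial>\<mu>) = 0" using inv[OF f] ni by (simp add: not_integrable_integral_eq)
  moreover obtain B where B: "\<And>z. norm (f z) \<le> B" using f(2) by (auto simp: bounded_iff)
  have "integrable \<mu> f" using f(1) B by (rule integrable_mu_bounded)
  then have "(\<integral>x. ?g x \<partial>\<mu>) = (\<integral>x. f x \<partial>\<mu>) + 1" by (simp add: mu.prob_space)
  ultimately show False by simp
qed

definition m :: "nat \<Rightarrow> complex" where
  "m n = (\<integral>z. z ^ n \<partial>\<mu>)"

lemma integrable_power_mu: "integrable \<mu> (\<lambda>z. z ^ n)"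
  by (rule integrable_mu_bounded[where B=1]) (auto simp: norm_power)

text \<open>Average \<open>mom_compare\<close> over \<open>y\<close> distributed by \<mu>: the bound
  does not depend on \<open>y\<close>, and invariance turns the averaged moment into
  \<open>m n\<close>. Since invariance is tested on real functions, real and imaginary parts are
  treated separately.\<close>

lemma real_mom_near:
  fixes p :: "complex \<Rightarrow> real"
  assumes p: "p = Re \<or> p = Im" and x: "norm x \<le> 1" and "0 \<le> s" "1 \<le> t"
    and G: "G \<in> borel_measurable (F s)" "\<And>\<omega>. 0 \<le> G \<omega>" "\<And>\<omega>. G \<omega> \<le> B"
  shows "\<bar>p (mom x G n (s + t)) - (\<integral>\<omega>. G \<omega> \<partial>M) * p (m n)\<bar> \<le> (\<integral>\<omega>. G \<omega> \<partial>M) * rate n t"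
proof -
  define g where "g = (\<integral>\<omega>. G \<omega> \<partial>M)"
  have p_lin: "bounded_linear p" using p bounded_linear_Re bounded_linear_Im by blast
  have p_le: "\<bar>p z\<bar> \<le> norm z" for z using p abs_Re_le_cmod abs_Im_le_cmod by auto
  have p_meas: "p \<in> borel_measurable borel" using p by auto
  have p_real: "p (of_real r * z) = r * p z" "p (z - w) = p z - p w" for r z w using p by auto
  have "0 \<le> t" using \<open>1 \<le> t\<close> by simp
  \<comment> \<open>Cut off outside the disc, because invariance is stated for functions bounded on
    the whole plane. Neither the flow nor \<mu> sees the cutoff, almost surely.\<close>
  define f where "f z = indicator (cball 0 1) z * p (z ^ n)" for z
  have f_meas: "f \<in> borel_measurable borel" proof -
    have "(\<lambda>z::complex. z ^ n) \<in> borel_measurable borel" by measurable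
    from measurable_compose[OF this p_meas] show ?thesis
      unfolding f_def by (intro borel_measurable_times borel_measurable_indicator) auto
  qed
  have f_le: "norm (f z) \<le> 1" for z
  proof (cases "norm z \<le> 1")
    case True
    then have "norm (z ^ n) \<le> 1" by (simp add: norm_power power_le_one)
    then show ?thesis using order_trans[OF p_le[of "z ^ n"]] by (simp add: f_def indicator_def)
  qed (simp add: f_def)
  have f_bd: "bounded (range f)" using f_le by (auto simp: bounded_iff)
  have tr: "transition_op M h t f y = p (mom y (\<lambda>_. 1) n t)" if y: "norm y \<le> 1" for y
  proof -
    have "integrable M (\<lambda>\<omega>. h y t \<omega> ^ n)"
    proof (rule integrable_const_bound[where B=1])
      show "AE \<omega> in M. norm (h y t \<omega> ^ n) \<le> 1"
        using h_le[OF y] by eventually_elim (use \<open>0 \<le> t\<close> in \<open>auto simp: norm_power power_le_one\<close>)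
      have [measurable]: "h y t \<in> borel_measurable M" by (rule h_measurable[OF y \<open>0 \<le> t\<close>])
      show "(\<lambda>\<omega>. h y t \<omega> ^ n) \<in> borel_measurable M" by measurable
    qed
    then have "p (mom y (\<lambda>_. 1) n t) = (\<integral>\<omega>. p (h y t \<omega> ^ n) \<partial>M)"
      unfolding mom_def by (simp add: integral_bounded_linear[OF p_lin])
    also have "\<dots> = (\<integral>\<omega>. f (h y t \<omega>) \<partial>M)"
    proof (rule integral_cong_AE)
      have hm: "h y t \<in> borel_measurable M" by (rule h_measurable[OF y \<open>0 \<le> t\<close>])
      show "(\<lambda>\<omega>. f (h y t \<omega>)) \<in> borel_measurable M" using measurable_compose[OF hm f_meas] .
      show "(\<lambda>\<omega>. p (h y t \<omega> ^ n)) \<in> borel_measurable M"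
        by (rule measurable_compose[OF borel_measurable_power[OF hm] p_meas])
      show "AE \<omega> in M. p (h y t \<omega> ^ n) = f (h y t \<omega>)"
        using h_le[OF y] by eventually_elim (use \<open>0 \<le> t\<close> in \<open>auto simp: f_def\<close>)
    qed
    finally show ?thesis by (simp add: transition_op_def)
  qed
  have int: "integrable \<mu> (transition_op M h t f)" by (rule integrable_transition_op[OF f_meas f_bd \<open>0 \<le> t\<close>])
  have "(\<integral>y. transition_op M h t f y \<partial>\<mu>) = (\<integral>z. f z \<partial>\<mu>)"
    using invariant \<open>0 \<le> t\<close> f_meas f_bd by (simp add: invariant_prob_measure_def)
  also have "\<dots> = (\<integral>z. p (z ^ n) \<partial>\<mu>)"
    by (intro Bochner_Integration.integral_cong) (auto simp: f_def space_mu)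
  also have "\<dots> = p (m n)"
    unfolding m_def by (rule integral_bounded_linear[OF p_lin integrable_power_mu])
  finally have inv: "(\<integral>y. transition_op M h t f y \<partial>\<mu>) = p (m n)" .
  let ?d = "\<lambda>y. p (mom x G n (s + t)) - g * transition_op M h t f y"
  have "p (mom x G n (s + t)) - g * p (m n) = (\<integral>y. ?d y \<partial>\<mu>)"
    using int by (simp add: inv mu.prob_space)
  then have "\<bar>p (mom x G n (s + t)) - g * p (m n)\<bar> \<le> (\<integral>y. \<bar>?d y\<bar> \<partial>\<mu>)"
    using integral_norm_bound[of \<mu> ?d] by (simp only: real_norm_def)
  also have "\<dots> \<le> (\<integral>y. g * rate n t \<partial>\<mu>)"
  proof (rule integral_mono)
    fix y assume "y \<in> space \<mu>"
    then have y: "norm y \<le> 1" by (simp add: space_mu)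
    have "?d y = p (mom x G n (s + t) - of_real g * mom y (\<lambda>_. 1) n t)"
      by (simp only: tr[OF y] p_real)
    then have "\<bar>?d y\<bar> \<le> norm (mom x G n (s + t) - of_real g * mom y (\<lambda>_. 1) n t)"
      by (simp only: p_le)
    also have "\<dots> \<le> g * rate n t"
      unfolding g_def by (rule mom_compare[OF x y assms(3-4) G])
    finally show "\<bar>?d y\<bar> \<le> g * rate n t" .
  qed (use int in auto)
  also have "\<dots> = g * rate n t" by (simp add: mu.prob_space)
  finally show ?thesis by (simp add: g_def)
qed

lemma mom_tendsto:
  assumes x: "norm x \<le> 1"
  shows "((\<lambda>t. mom x (\<lambda>_. 1) n t) \<longlongrightarrow> m n) at_top"
proof (rule metric_tendsto_imp_tendsto)
  show "((\<lambda>t. 2 * rate n t) \<longlongrightarrow> 0) at_top"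
    using tendsto_mult_left[OF rate_tendsto_0, of 2] by simp
  show "\<forall>\<^sub>F t in at_top. dist (mom x (\<lambda>_. 1) n t) (m n) \<le> dist (2 * rate n t) 0"
    using eventually_ge_at_top[of 1]
  proof eventually_elim
    case (elim t)
    have "\<bar>p (mom x (\<lambda>_. 1) n t) - p (m n)\<bar> \<le> rate n t" if "p = Re \<or> p = Im" for p
      using real_mom_near[OF that x order_refl elim, of "\<lambda>_. 1" 1 n] by (simp add: prob_space)
    from this[of Re] this[of Im] show ?case
      using cmod_le[of "mom x (\<lambda>_. 1) n t - m n"] rate_nonneg[of n t] by (simp add: dist_norm)
  qed
qed

text \<open>The moments of the flow from 0 converge to \<open>m\<close>, and by the moment equations
  so do their derivatives; such a limit of derivatives must be 0.\<close>

lemma m_stationary: "of_real (\<kappa> * (real n)\<^sup>2) * m n = of_real (K * real n) * (m (n - 1) - m (Suc n))"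
proof -
  have "moment_system \<kappa> K 0 (\<integral>\<omega>. 1 \<partial>M) (mom 0 (\<lambda>_. 1))"
    unfolding mom_eq[of 0, simplified] \<kappa>_def by (rule disc_solution.moment_system_wmom[OF disc_solution_flow, where B=1]) auto
  then have d: "(mom 0 (\<lambda>_. 1) n has_vector_derivative (- of_real (\<kappa> * (real n)\<^sup>2) * mom 0 (\<lambda>_. 1) n t
      + of_real (K * real n) * (mom 0 (\<lambda>_. 1) (n - 1) t - mom 0 (\<lambda>_. 1) (Suc n) t))) (at t)" if "0 < t" for t
    using that by (simp add: moment_system_def)
  have l: "((\<lambda>t. mom 0 (\<lambda>_. 1) k t) \<longlongrightarrow> m k) at_top" for k
    by (rule mom_tendsto) simp
  have "((\<lambda>t. - of_real (\<kappa> * (real n)\<^sup>2) * mom 0 (\<lambda>_. 1) n t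
      + of_real (K * real n) * (mom 0 (\<lambda>_. 1) (n - 1) t - mom 0 (\<lambda>_. 1) (Suc n) t))
    \<longlongrightarrow> - of_real (\<kappa> * (real n)\<^sup>2) * m n + of_real (K * real n) * (m (n - 1) - m (Suc n))) at_top"
    by (intro tendsto_add tendsto_mult tendsto_diff tendsto_const l)
  then have "- of_real (\<kappa> * (real n)\<^sup>2) * m n + of_real (K * real n) * (m (n - 1) - m (Suc n)) = 0"
    by (rule limit_of_derivative_zero[rotated 2]) (use d l in auto)
  then show ?thesis by (simp only: mult_minus_left add_eq_0_iff minus_minus)
qed

text \<open>The equation for n = 1 reads \<kappa> Re (m 1) = K (1 - Re (m 2)), which is nonnegative.
  Equality would force z^2 = 1 almost everywhere, hence Re (m 3) = Re (m 1) and Re (m 2) = 1,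
  against the equation for n = 2.\<close>

lemma Re_m_1_pos: "0 < Re (m 1)"
proof -
  have m0: "m 0 = 1" by (simp add: m_def mu.prob_space)
  have e1: "\<kappa> * Re (m 1) = K * (1 - Re (m 2))"
    using arg_cong[OF m_stationary[of 1], of Re] by (simp add: m0 numeral_2_eq_2)
  have e2: "4 * \<kappa> * Re (m 2) = 2 * K * (Re (m 1) - Re (m 3))"
    using arg_cong[OF m_stationary[of 2], of Re] by (simp add: numeral_3_eq_3 numeral_2_eq_2 power2_eq_square)
  have Re_m: "Re (m n) = (\<integral>z. Re (z ^ n) \<partial>\<mu>)" for n
    unfolding m_def by (rule integral_Re[OF integrable_power_mu, symmetric])
  have int_Re: "integrable \<mu> (\<lambda>z. Re (z ^ n))" for n
    using integrable_bounded_linear[OF bounded_linear_Re integrable_power_mu] .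
  have nn: "AE z in \<mu>. 0 \<le> 1 - Re (z\<^sup>2)"
  proof (rule AE_I2)
    fix z assume "z \<in> space \<mu>"
    then have "norm (z\<^sup>2) = 1" by (simp add: space_mu norm_power)
    then show "0 \<le> 1 - Re (z\<^sup>2)" using complex_Re_le_cmod[of "z\<^sup>2"] by simp
  qed
  have int: "(\<integral>z. 1 - Re (z\<^sup>2) \<partial>\<mu>) = 1 - Re (m 2)"
    unfolding Re_m using int_Re[of 2] by (simp add: mu.prob_space)
  have "0 \<le> 1 - Re (m 2)" unfolding int[symmetric] by (rule integral_nonneg_AE[OF nn])
  moreover have "1 - Re (m 2) \<noteq> 0"
  proof
    assume zero: "1 - Re (m 2) = 0"
    then have "AE z in \<mu>. 1 - Re (z\<^sup>2) = 0"
      using integral_nonneg_eq_0_iff_AE[OF _ nn] int_Re[of 2] int by simp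
    then have "AE z in \<mu>. Re (z ^ 3) = Re (z ^ 1)"
    proof (rule AE_mp[OF _ AE_I2], intro impI)
      fix z assume "z \<in> space \<mu>" and z2: "1 - Re (z\<^sup>2) = 0"
      then have n1: "norm (z\<^sup>2) = 1" by (simp add: space_mu norm_power)
      have "(Re (z\<^sup>2))\<^sup>2 + (Im (z\<^sup>2))\<^sup>2 = 1" using n1 cmod_power2[of "z\<^sup>2"] by simp
      then have "Im (z\<^sup>2) = 0" using z2 by simp
      then have "z\<^sup>2 = 1" using z2 by (simp add: complex_eq_iff)
      then show "Re (z ^ 3) = Re (z ^ 1)" by (simp add: power3_eq_cube power2_eq_square)
    qed
    then have "Re (m 3) = Re (m 1)"
      unfolding Re_m by (intro integral_cong_AE int_Re[THEN borel_measurable_integrable])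
    then show False using e2 zero kappa_pos by simp
  qed
  ultimately have "0 < K * (1 - Re (m 2))" using K_pos by simp
  then show ?thesis unfolding e1[symmetric] using kappa_pos by (simp add: zero_less_mult_iff)
qed

end

subsection \<open>Attraction to the circle\<close>

lemma integral_has_real_derivative_from_0:
  fixes f :: "real \<Rightarrow> real"
  assumes f: "continuous_on {0..} f" and "0 \<le> t"
  shows "((\<lambda>t. integral {0..t} f) has_real_derivative f t) (at t within {0..})"
proof -
  have "continuous_on {0..t+1} f" using f by (rule continuous_on_subset) auto
  then have "((\<lambda>u. integral {0..u} f) has_vector_derivative f t) (at t within {0..t+1})"
    using \<open>0 \<le> t\<close> by (intro integral_has_vector_derivative) auto
  moreover have "at t within {0..t+1} = at t within {0..}"
    by (rule at_within_nhd[of _ "{..<t+1}"]) auto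
  ultimately show ?thesis by (simp add: has_real_derivative_iff_has_vector_derivative)
qed

lemma abs_exp_minus_one_le:
  assumes "\<bar>y\<bar> \<le> Y" shows "\<bar>exp y - 1\<bar> \<le> exp Y - (1::real)"
proof -
  have "exp y \<le> exp Y" "exp (- Y) \<le> exp y" using assms by auto
  moreover have "2 \<le> exp Y + exp (- Y)"
    using exp_ge_add_one_self[of Y] exp_ge_add_one_self[of "-Y"] by linarith
  ultimately show ?thesis by linarith
qed

locale disc_flow_point = disc_flow +
  fixes x :: complex
  assumes x_ball: "norm x < 1"
begin

sublocale X: disc_solution M F W K c x "h x"
  by (rule disc_solution_flow) (use x_ball in simp)

definition \<rho>0 :: real where "\<rho>0 = 1 - (norm x)\<^sup>2"

lemma rho0: "0 < \<rho>0" "\<rho>0 \<le> 1"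
  using x_ball by (auto simp: \<rho>0_def abs_square_less_1)

text \<open>Normalized to start at 1 almost surely. The maximum with 0 bounds it for every \<omega>,
  as is required of a weight, although \<open>h\<close> stays in the disc only almost
  surely.\<close>

definition q :: "real \<Rightarrow> real \<Rightarrow> 'a \<Rightarrow> real" where
  "q p t \<omega> = (max 0 (1 - (norm (h x t \<omega>))\<^sup>2) / \<rho>0) powr p"

lemma q_nonneg: "0 \<le> q p t \<omega>"
  by (simp add: q_def)

lemma q_le: "0 < p \<Longrightarrow> q p t \<omega> \<le> (1 / \<rho>0) powr p"
  unfolding q_def using rho0 by (intro powr_mono2 divide_right_mono) auto

lemma q_measurable:
  assumes "0 \<le> t" shows "q p t \<in> borel_measurable (F t)"
proof -
  have [measurable]: "h x t \<in> borel_measurable (F t)"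
    by (rule adapted_measurable[OF X.h_adapted assms order_refl])
  show ?thesis unfolding q_def by measurable
qed

lemma q_rv: "0 \<le> t \<Longrightarrow> q p t \<in> borel_measurable M"
  by (rule measurable_F_M[OF q_measurable])

lemma q_integrable: "0 < p \<Longrightarrow> 0 \<le> t \<Longrightarrow> integrable M (q p t)"
  using q_nonneg q_le by (intro integrable_const_bound[where B="(1 / \<rho>0) powr p"] q_rv) auto

lemma q_path:
  "AE \<omega> in M. continuous_on {0..} (\<lambda>t. h x t \<omega>) \<and> (\<forall>t\<ge>0. norm (h x t \<omega>) \<le> 1) \<and>
    (\<forall>t\<ge>0. q p t \<omega> = exp (- 2 * K * p * integral {0..t} (\<lambda>s. Re (h x s \<omega>))))"
  using X.defect_formula X.norm_h_le X.h_cont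
proof eventually_elim
  case (elim \<omega>)
  have "q p t \<omega> = exp (- 2 * K * p * integral {0..t} (\<lambda>s. Re (h x s \<omega>)))" if "0 \<le> t" for t
  proof -
    have "1 - (norm (h x t \<omega>))\<^sup>2 = \<rho>0 * exp (- 2 * K * integral {0..t} (\<lambda>s. Re (h x s \<omega>)))"
      using elim that by (simp add: \<rho>0_def)
    then show ?thesis using rho0 by (simp add: q_def exp_powr_real mult_ac)
  qed
  then show ?case using elim by blast
qed

text \<open>Almost surely the logarithm of \<open>q p\<close> has slope - 2 K p Re h, of size at
  most 2 K p in the disc.\<close>

lemma q_ratio:
  "AE \<omega> in M. \<forall>s\<ge>0. \<forall>t\<ge>s. 0 \<le> p \<longrightarrow> \<bar>q p t \<omega> - q p s \<omega>\<bar> \<le> (exp (2 * K * p * (t - s)) - 1) * q p s \<omega>"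
  using q_path[of p]
proof eventually_elim
  case (elim \<omega>)
  let ?I = "\<lambda>t. integral {0..t} (\<lambda>s. Re (h x s \<omega>))"
  show ?case
  proof (intro allI impI)
    fix s t :: real assume st: "0 \<le> s" "s \<le> t" and "0 \<le> p"
    have c: "continuous_on {0..} (\<lambda>s. Re (h x s \<omega>))" using elim by (intro continuous_intros) auto
    have "norm (?I t - ?I s) \<le> 1 * norm (t - s)"
    proof (rule field_differentiable_bound[of "{0..}"])
      fix u :: real assume "u \<in> {0..}"
      then show "(?I has_field_derivative Re (h x u \<omega>)) (at u within {0..})"
        by (intro integral_has_real_derivative_from_0[OF c]) auto
      show "norm (Re (h x u \<omega>)) \<le> 1"
        using elim \<open>u \<in> {0..}\<close> order_trans[OF abs_Re_le_cmod, of "h x u \<omega>" 1] by auto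
    qed (use st in auto)
    then have "\<bar>?I t - ?I s\<bar> \<le> t - s" using st by simp
    then have "2 * K * p * \<bar>?I t - ?I s\<bar> \<le> 2 * K * p * (t - s)"
      using K_pos \<open>0 \<le> p\<close> by (intro mult_left_mono) auto
    moreover have "\<bar>- 2 * K * p * (?I t - ?I s)\<bar> = 2 * K * p * \<bar>?I t - ?I s\<bar>"
      using K_pos \<open>0 \<le> p\<close> by (simp add: abs_mult)
    ultimately have "\<bar>exp (- 2 * K * p * (?I t - ?I s)) - 1\<bar> \<le> exp (2 * K * p * (t - s)) - 1"
      by (intro abs_exp_minus_one_le) simp
    moreover have "q p t \<omega> - q p s \<omega> = (exp (- 2 * K * p * (?I t - ?I s)) - 1) * q p s \<omega>"
    proof -
      have "q p t \<omega> = exp (- 2 * K * p * ?I t)" "q p s \<omega> = exp (- 2 * K * p * ?I s)"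
        using elim st by auto
      moreover have "exp (- 2 * K * p * (?I t - ?I s)) * exp (- 2 * K * p * ?I s) = exp (- 2 * K * p * ?I t)"
        unfolding exp_add[symmetric] by (simp add: algebra_simps)
      ultimately show ?thesis by (simp only: left_diff_distrib mult_1)
    qed
    ultimately show "\<bar>q p t \<omega> - q p s \<omega>\<bar> \<le> (exp (2 * K * p * (t - s)) - 1) * q p s \<omega>"
      using q_nonneg[of p s \<omega>] by (simp only: abs_mult abs_of_nonneg mult_right_mono)
  qed
qed

lemma q_derivative:
  "AE \<omega> in M. \<forall>t\<ge>0. ((\<lambda>t. q p t \<omega>) has_real_derivative - 2 * K * p * Re (h x t \<omega>) * q p t \<omega>) (at t within {0..})"
  using q_path[of p]
proof eventually_elim
  case (elim \<omega>)
  let ?I = "\<lambda>t. integral {0..t} (\<lambda>s. Re (h x s \<omega>))"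
  have c: "continuous_on {0..} (\<lambda>s. Re (h x s \<omega>))" using elim by (intro continuous_intros) auto
  show ?case
  proof (intro allI impI)
    fix t :: real assume "0 \<le> t"
    have "((\<lambda>t. exp (- 2 * K * p * ?I t)) has_real_derivative exp (- 2 * K * p * ?I t) * (- 2 * K * p * Re (h x t \<omega>))) (at t within {0..})"
      using integral_has_real_derivative_from_0[OF c \<open>0 \<le> t\<close>] by (auto intro!: derivative_eq_intros)
    moreover have "exp (- 2 * K * p * ?I t) = q p t \<omega>" using elim \<open>0 \<le> t\<close> by simp
    ultimately have "((\<lambda>t. exp (- 2 * K * p * ?I t)) has_real_derivative - 2 * K * p * Re (h x t \<omega>) * q p t \<omega>) (at t within {0..})"
      by (simp only: mult.commute)
    then show "((\<lambda>t. q p t \<omega>) has_real_derivative - 2 * K * p * Re (h x t \<omega>) * q p t \<omega>) (at t within {0..})"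
      by (rule has_field_derivative_transform_within[where d=1]) (use elim \<open>0 \<le> t\<close> in auto)
  qed
qed

definition u :: "real \<Rightarrow> real \<Rightarrow> real" where
  "u p t = (\<integral>\<omega>. q p t \<omega> \<partial>M)"

lemma u_nonneg: "0 \<le> u p t"
  unfolding u_def using q_nonneg by simp

text \<open>Differentiation under the expectation; the exponential formula provides the pathwise
  derivative and, with |h| at most 1, a constant dominating the quotients.\<close>

lemma u_derivative:
  assumes "0 < p" "0 < t"
  shows "(u p has_real_derivative (\<integral>\<omega>. - 2 * K * p * Re (h x t \<omega>) * q p t \<omega> \<partial>M)) (at t)"
proof -
  let ?Q = "(1 / \<rho>0) powr p"
  have "((\<lambda>y. (u p y - u p t) / (y - t)) \<longlongrightarrow> (\<integral>\<omega>. - 2 * K * p * Re (h x t \<omega>) * q p t \<omega> \<partial>M)) (at t within {0<..})"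
    unfolding tendsto_at_iff_sequentially o_def
  proof (intro allI impI)
    fix X :: "nat \<Rightarrow> real" assume X: "\<forall>i. X i \<in> {0<..} - {t}" "X \<longlonglongrightarrow> t"
    have X': "0 < X k" "X k \<noteq> t" for k using X(1) by auto
    have "(u p (X k) - u p t) / (X k - t) = (\<integral>\<omega>. (q p (X k) \<omega> - q p t \<omega>) / (X k - t) \<partial>M)" for k
      unfolding u_def using q_integrable[OF \<open>0 < p\<close>] X'[of k] \<open>0 < t\<close> by (simp add: less_imp_le)
    moreover have "(\<lambda>k. \<integral>\<omega>. (q p (X k) \<omega> - q p t \<omega>) / (X k - t) \<partial>M) \<longlonglongrightarrow> (\<integral>\<omega>. - 2 * K * p * Re (h x t \<omega>) * q p t \<omega> \<partial>M)"
    proof (rule integral_dominated_convergence[where w="\<lambda>_. 2 * K * p * ?Q"])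
      have [measurable]: "h x t \<in> borel_measurable M" "q p t \<in> borel_measurable M" "q p (X k) \<in> borel_measurable M" for k
        using X'[of k] \<open>0 < t\<close> by (auto intro: q_rv)
      show "(\<lambda>\<omega>. - 2 * K * p * Re (h x t \<omega>) * q p t \<omega>) \<in> borel_measurable M" by measurable
      show "(\<lambda>\<omega>. (q p (X k) \<omega> - q p t \<omega>) / (X k - t)) \<in> borel_measurable M" for k by measurable
      show "AE \<omega> in M. (\<lambda>k. (q p (X k) \<omega> - q p t \<omega>) / (X k - t)) \<longlonglongrightarrow> - 2 * K * p * Re (h x t \<omega>) * q p t \<omega>"
        using q_derivative[of p]
      proof eventually_elim
        case (elim \<omega>)
        then have "((\<lambda>y. (q p y \<omega> - q p t \<omega>) / (y - t)) \<longlongrightarrow> - 2 * K * p * Re (h x t \<omega>) * q p t \<omega>) (at t within {0..})"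
          using \<open>0 < t\<close> unfolding has_field_derivative_iff by simp
        moreover have "\<forall>i. X i \<in> {0..} - {t}" using X' by (auto intro: less_imp_le)
        ultimately show ?case using X(2) unfolding tendsto_at_iff_sequentially o_def by blast
      qed
      show "AE \<omega> in M. norm ((q p (X k) \<omega> - q p t \<omega>) / (X k - t)) \<le> 2 * K * p * ?Q" for k
        using q_derivative[of p] X.norm_h_le
      proof eventually_elim
        case (elim \<omega>)
        have "norm (q p (X k) \<omega> - q p t \<omega>) \<le> (2 * K * p * ?Q) * norm (X k - t)"
        proof (rule field_differentiable_bound[of "{0..}"])
          fix s :: real assume "s \<in> {0..}"
          then show "((\<lambda>t. q p t \<omega>) has_field_derivative - 2 * K * p * Re (h x s \<omega>) * q p s \<omega>) (at s within {0..})"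
            using elim by auto
          have "\<bar>Re (h x s \<omega>)\<bar> \<le> 1"
            using elim(2) \<open>s \<in> {0..}\<close> order_trans[OF abs_Re_le_cmod, of "h x s \<omega>" 1] by auto
          then have "(2 * K * p) * (\<bar>Re (h x s \<omega>)\<bar> * q p s \<omega>) \<le> (2 * K * p) * (1 * ?Q)"
            using q_nonneg[of p s \<omega>] q_le[OF \<open>0 < p\<close>, of s \<omega>] K_pos \<open>0 < p\<close>
            by (intro mult_left_mono mult_mono) auto
          then show "norm (- 2 * K * p * Re (h x s \<omega>) * q p s \<omega>) \<le> 2 * K * p * ?Q"
            using K_pos \<open>0 < p\<close> q_nonneg[of p s \<omega>] by (simp add: abs_mult mult.assoc)
        qed (use X'[of k] \<open>0 < t\<close> in auto)
        then show ?case using X'[of k] by (simp add: pos_divide_le_eq)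
      qed
    qed simp
    ultimately show "(\<lambda>k. (u p (X k) - u p t) / (X k - t)) \<longlonglongrightarrow> (\<integral>\<omega>. - 2 * K * p * Re (h x t \<omega>) * q p t \<omega> \<partial>M)"
      by (simp only:)
  qed
  moreover have "at t within {0<..} = at t" using \<open>0 < t\<close> by (intro at_within_open) auto
  ultimately show ?thesis by (simp add: has_field_derivative_iff)
qed

text \<open>Lets the delayed value that appears in \<open>u_drift\<close> be bounded below by the
  present one, so that a delayed estimate becomes an ordinary differential inequality.\<close>

lemma u_delay:
  assumes "0 < p" "0 \<le> r" "r \<le> t"
  shows "u p t \<le> exp (2 * K * p * (t - r)) * u p r"
proof -
  have "u p t \<le> (\<integral>\<omega>. exp (2 * K * p * (t - r)) * q p r \<omega> \<partial>M)"
    unfolding u_def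
  proof (rule integral_mono_AE)
    show "AE \<omega> in M. q p t \<omega> \<le> exp (2 * K * p * (t - r)) * q p r \<omega>"
      using q_ratio[of p]
    proof eventually_elim
      case (elim \<omega>)
      then have "\<bar>q p t \<omega> - q p r \<omega>\<bar> \<le> (exp (2 * K * p * (t - r)) - 1) * q p r \<omega>" using assms by auto
      then show ?case by (simp add: algebra_simps abs_le_iff)
    qed
  qed (use q_integrable assms in auto)
  then show ?thesis by (simp add: u_def)
qed

text \<open>Replace \<open>q\<close> by its value at t - \<tau>, which is known at that time and so
  may serve as a weight. Against it Re h averages to Re (m 1) up to \<open>rate 1 \<tau>\<close>;
  the replacement itself costs exp(2 K p \<tau>) - 1 by \<open>q_ratio\<close>.\<close>

lemma u_drift:
  assumes "0 < p" "1 \<le> \<tau>" "\<tau> \<le> t"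
  shows "u p (t - \<tau>) * (Re (m 1) - rate 1 \<tau> - (exp (2 * K * p * \<tau>) - 1)) \<le> (\<integral>\<omega>. Re (h x t \<omega>) * q p t \<omega> \<partial>M)"
proof -
  let ?s = "t - \<tau>"
  have s: "0 \<le> ?s" "0 \<le> t" "?s \<le> t" using assms by auto
  have "\<bar>Re (mom x (q p ?s) 1 (?s + \<tau>)) - u p ?s * Re (m 1)\<bar> \<le> u p ?s * rate 1 \<tau>"
    unfolding u_def using x_ball s
    by (intro real_mom_near[where B="(1 / \<rho>0) powr p"] q_measurable q_nonneg q_le assms) auto
  moreover have "Re (mom x (q p ?s) 1 (?s + \<tau>)) = (\<integral>\<omega>. Re (h x t \<omega>) * q p ?s \<omega> \<partial>M)"
  proof -
    have "integrable M (\<lambda>\<omega>. complex_of_real (q p ?s \<omega>) * h x t \<omega> ^ 1)"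
      using q_nonneg q_le[OF \<open>0 < p\<close>] s by (intro X.wmom_integrable[where B="(1 / \<rho>0) powr p"] q_rv) auto
    from integral_Re[OF this] show ?thesis by (simp add: mom_def mult.commute)
  qed
  ultimately have 1: "u p ?s * Re (m 1) - u p ?s * rate 1 \<tau> \<le> (\<integral>\<omega>. Re (h x t \<omega>) * q p ?s \<omega> \<partial>M)" by simp
  have int: "integrable M (\<lambda>\<omega>. Re (h x t \<omega>) * q p r \<omega>)" if "0 \<le> r" for r
  proof (rule Bochner_Integration.integrable_bound[OF q_integrable[OF \<open>0 < p\<close> that]])
    have [measurable]: "h x t \<in> borel_measurable M" "q p r \<in> borel_measurable M"
      using s that by (auto intro: q_rv)
    show "(\<lambda>\<omega>. Re (h x t \<omega>) * q p r \<omega>) \<in> borel_measurable M" by measurable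
    show "AE \<omega> in M. norm (Re (h x t \<omega>) * q p r \<omega>) \<le> norm (q p r \<omega>)"
      using X.norm_h_le
    proof eventually_elim
      case (elim \<omega>)
      have "\<bar>Re (h x t \<omega>)\<bar> \<le> 1" using elim s order_trans[OF abs_Re_le_cmod, of "h x t \<omega>" 1] by auto
      then show ?case using mult_right_mono[of "\<bar>Re (h x t \<omega>)\<bar>" 1 "\<bar>q p r \<omega>\<bar>"] by (simp add: abs_mult)
    qed
  qed
  have "(\<integral>\<omega>. Re (h x t \<omega>) * q p ?s \<omega> - (exp (2 * K * p * \<tau>) - 1) * q p ?s \<omega> \<partial>M) \<le> (\<integral>\<omega>. Re (h x t \<omega>) * q p t \<omega> \<partial>M)"
  proof (rule integral_mono_AE)
    show "AE \<omega> in M. Re (h x t \<omega>) * q p ?s \<omega> - (exp (2 * K * p * \<tau>) - 1) * q p ?s \<omega> \<le> Re (h x t \<omega>) * q p t \<omega>"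
      using q_ratio[of p] X.norm_h_le
    proof eventually_elim
      case (elim \<omega>)
      have "\<bar>q p t \<omega> - q p ?s \<omega>\<bar> \<le> (exp (2 * K * p * (t - ?s)) - 1) * q p ?s \<omega>"
        using elim(1) s \<open>0 < p\<close> by (metis less_imp_le)
      then have A: "\<bar>q p t \<omega> - q p ?s \<omega>\<bar> \<le> (exp (2 * K * p * \<tau>) - 1) * q p ?s \<omega>" by simp
      have "\<bar>Re (h x t \<omega>)\<bar> \<le> 1" using elim s order_trans[OF abs_Re_le_cmod, of "h x t \<omega>" 1] by auto
      then have B: "\<bar>Re (h x t \<omega>) * (q p t \<omega> - q p ?s \<omega>)\<bar> \<le> \<bar>q p t \<omega> - q p ?s \<omega>\<bar>"
        unfolding abs_mult by (intro mult_left_le_one_le) auto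
      have "- (Re (h x t \<omega>) * (q p t \<omega> - q p ?s \<omega>)) \<le> (exp (2 * K * p * \<tau>) - 1) * q p ?s \<omega>"
        by (rule order_trans[OF abs_ge_minus_self order_trans[OF B A]])
      then show ?case by (simp only: right_diff_distrib minus_diff_eq diff_le_eq add.commute)
    qed
    show "integrable M (\<lambda>\<omega>. Re (h x t \<omega>) * q p ?s \<omega> - (exp (2 * K * p * \<tau>) - 1) * q p ?s \<omega>)"
      using int[OF s(1)] q_integrable[OF \<open>0 < p\<close> s(1)] by simp
  qed (rule int[OF s(2)])
  moreover have "(\<integral>\<omega>. Re (h x t \<omega>) * q p ?s \<omega> - (exp (2 * K * p * \<tau>) - 1) * q p ?s \<omega> \<partial>M)
     = (\<integral>\<omega>. Re (h x t \<omega>) * q p ?s \<omega> \<partial>M) - (exp (2 * K * p * \<tau>) - 1) * u p ?s"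
    unfolding u_def using int[OF s(1)] q_integrable[OF \<open>0 < p\<close> s(1)] by simp
  ultimately show ?thesis using 1 by (simp add: algebra_simps)
qed

text \<open>The delay \<tau> is fixed first, to bring h near stationarity; only then is the power
  \<open>p\<close> taken small in terms of \<tau>. What remains is a positive drift and exponential
  decay.\<close>

lemma u_tendsto_0: "\<exists>p>0. (u p \<longlongrightarrow> 0) at_top"
proof -
  define a where "a = Re (m 1)"
  have "0 < a" unfolding a_def by (rule Re_m_1_pos)
  have "\<forall>\<^sub>F \<tau> in at_top. rate 1 \<tau> < a / 4"
    using order_tendstoD(2)[OF rate_tendsto_0, of "a / 4"] \<open>0 < a\<close> by simp
  then have "\<forall>\<^sub>F \<tau> in at_top. rate 1 \<tau> < a / 4 \<and> 1 \<le> \<tau>"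
    using eventually_ge_at_top[of 1] by eventually_elim simp
  then obtain \<tau> where \<tau>: "rate 1 \<tau> < a / 4" "1 \<le> \<tau>" by (auto simp: eventually_at_top_linorder)
  \<comment> \<open>Chosen so that exp(2 K p \<tau>) = 1 + a/4. Together with rate 1 \<tau> < a/4
    this leaves at least a/2 of the drift.\<close>
  define p where "p = ln (1 + a / 4) / (2 * K * \<tau>)"
  have "0 < p" using \<open>0 < a\<close> K_pos \<tau>(2) by (simp add: p_def)
  have "2 * K * p * \<tau> = ln (1 + a / 4)" using K_pos \<tau>(2) by (simp add: p_def)
  then have e: "exp (2 * K * p * \<tau>) = 1 + a / 4" using \<open>0 < a\<close> by simp
  \<comment> \<open>The remaining drift a/2 times 2 K p, divided by the factor 1 + a/4 that
    \<open>u_delay\<close> costs.\<close>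
  define b where "b = 2 * K * p * (a / 2) / (1 + a / 4)"
  have "0 < b" using \<open>0 < a\<close> \<open>0 < p\<close> K_pos by (simp add: b_def add_pos_pos)
  have du: "(\<integral>\<omega>. - 2 * K * p * Re (h x t \<omega>) * q p t \<omega> \<partial>M) \<le> - b * u p t" if "\<tau> \<le> t" for t
  proof -
    let ?v = "u p (t - \<tau>)"
    have "a / 2 \<le> a - rate 1 \<tau> - (exp (2 * K * p * \<tau>) - 1)" unfolding e using \<tau>(1) by simp
    then have "?v * (a / 2) \<le> ?v * (a - rate 1 \<tau> - (exp (2 * K * p * \<tau>) - 1))"
      using u_nonneg by (intro mult_left_mono)
    also have "\<dots> \<le> (\<integral>\<omega>. Re (h x t \<omega>) * q p t \<omega> \<partial>M)"
      unfolding a_def by (rule u_drift[OF \<open>0 < p\<close> \<tau>(2) that])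
    finally have 1: "?v * (a / 2) \<le> (\<integral>\<omega>. Re (h x t \<omega>) * q p t \<omega> \<partial>M)" .
    have "u p t \<le> exp (2 * K * p * (t - (t - \<tau>))) * ?v"
      using \<open>0 < p\<close> \<tau>(2) that by (intro u_delay) auto
    then have "u p t \<le> (1 + a / 4) * ?v" using e by simp
    then have "u p t / (1 + a / 4) \<le> ?v" using \<open>0 < a\<close> by (simp add: pos_divide_le_eq mult.commute add_pos_pos)
    then have "u p t / (1 + a / 4) * (a / 2) \<le> ?v * (a / 2)" using \<open>0 < a\<close> by (intro mult_right_mono) auto
    from order_trans[OF this 1] have "2 * K * p * (u p t / (1 + a / 4) * (a / 2)) \<le> 2 * K * p * (\<integral>\<omega>. Re (h x t \<omega>) * q p t \<omega> \<partial>M)"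
      using K_pos \<open>0 < p\<close> by (intro mult_left_mono) auto
    moreover have "(\<integral>\<omega>. - 2 * K * p * Re (h x t \<omega>) * q p t \<omega> \<partial>M) = - (2 * K * p * (\<integral>\<omega>. Re (h x t \<omega>) * q p t \<omega> \<partial>M))"
      by (simp add: mult.assoc)
    moreover have "2 * K * p * (u p t / (1 + a / 4) * (a / 2)) = b * u p t"
      by (simp only: b_def times_divide_eq_left times_divide_eq_right mult_ac)
    ultimately show ?thesis by simp
  qed
  define \<psi> where "\<psi> t = exp (b * t) * u p t" for t
  have dec: "\<psi> t \<le> \<psi> \<tau>" if "\<tau> \<le> t" for t
  proof (rule DERIV_nonpos_imp_nonincreasing[of \<tau> t \<psi>, OF that])
    fix s assume s: "\<tau> \<le> s" "s \<le> t"
    let ?D = "\<integral>\<omega>. - 2 * K * p * Re (h x s \<omega>) * q p s \<omega> \<partial>M"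
    have "(u p has_real_derivative ?D) (at s)"
      using \<tau>(2) s by (intro u_derivative \<open>0 < p\<close>) auto
    then have "(\<psi> has_real_derivative exp (b * s) * b * u p s + exp (b * s) * ?D) (at s)"
      unfolding \<psi>_def[abs_def] by (auto intro!: derivative_eq_intros)
    moreover have "exp (b * s) * ?D \<le> exp (b * s) * (- b * u p s)"
      by (intro mult_left_mono du s) auto
    then have "exp (b * s) * b * u p s + exp (b * s) * ?D \<le> 0" by simp
    ultimately show "\<exists>y. (\<psi> has_real_derivative y) (at s) \<and> y \<le> 0" by blast
  qed
  have le: "u p t \<le> \<psi> \<tau> * exp (- b * t)" if "\<tau> \<le> t" for t
    using dec[OF that] by (simp add: \<psi>_def exp_minus field_simps)
  have "((\<lambda>t. \<psi> \<tau> * exp (- b * t)) \<longlongrightarrow> \<psi> \<tau> * 0) at_top"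
    using \<open>0 < b\<close>
    by (intro tendsto_intros filterlim_compose[OF exp_at_bot] filterlim_tendsto_neg_mult_at_bot[OF tendsto_const _ filterlim_ident]) auto
  then have lim: "((\<lambda>t. \<psi> \<tau> * exp (- b * t)) \<longlongrightarrow> 0) at_top" by simp
  have "(u p \<longlongrightarrow> 0) at_top"
  proof (rule tendsto_sandwich[OF _ _ tendsto_const lim])
    show "\<forall>\<^sub>F t in at_top. 0 \<le> u p t" by (simp add: u_nonneg)
    show "\<forall>\<^sub>F t in at_top. u p t \<le> \<psi> \<tau> * exp (- b * t)"
      using eventually_ge_at_top[of \<tau>] by eventually_elim (rule le)
  qed
  then show ?thesis using \<open>0 < p\<close> by blast
qed

lemma flow_polynomial_limit: "((\<lambda>t. \<integral>\<omega>. Re (poly P (h x t \<omega>)) \<partial>M) \<longlongrightarrow> (\<integral>z. Re (poly P z) \<partial>\<mu>)) at_top"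
proof -
  have lim: "((\<lambda>t. Re (\<Sum>i\<le>degree P. coeff P i * mom x (\<lambda>_. 1) i t)) \<longlongrightarrow> Re (\<Sum>i\<le>degree P. coeff P i * m i)) at_top"
    using x_ball by (intro tendsto_intros mom_tendsto) auto
  have eq: "Re (\<Sum>i\<le>degree P. coeff P i * m i) = (\<integral>z. Re (poly P z) \<partial>\<mu>)"
  proof -
    have "(\<Sum>i\<le>degree P. coeff P i * m i) = (\<integral>z. poly P z \<partial>\<mu>)"
      unfolding poly_altdef m_def using integrable_power_mu
      by (subst Bochner_Integration.integral_sum) auto
    moreover have "integrable \<mu> (\<lambda>z. poly P z)"
      unfolding poly_altdef using integrable_power_mu by (intro Bochner_Integration.integrable_sum) auto
    ultimately show ?thesis by simp
  qed
  have ev: "\<forall>\<^sub>F t in at_top. Re (\<Sum>i\<le>degree P. coeff P i * mom x (\<lambda>_. 1) i t) = (\<integral>\<omega>. Re (poly P (h x t \<omega>)) \<partial>M)"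
    using eventually_ge_at_top[of 0]
  proof eventually_elim
    case (elim t)
    have int: "integrable M (\<lambda>\<omega>. h x t \<omega> ^ i)" for i
      using X.wmom_integrable[of "\<lambda>_. 1" 1 t i] elim by simp
    have "(\<Sum>i\<le>degree P. coeff P i * mom x (\<lambda>_. 1) i t) = (\<integral>\<omega>. poly P (h x t \<omega>) \<partial>M)"
      unfolding poly_altdef mom_def using int
      by (subst Bochner_Integration.integral_sum) auto
    moreover have "integrable M (\<lambda>\<omega>. poly P (h x t \<omega>))"
      unfolding poly_altdef using int by (intro Bochner_Integration.integrable_sum) auto
    ultimately show ?case by simp
  qed
  show ?thesis using Lim_transform_eventually[OF lim ev] unfolding eq .
qed

end

subsection \<open>Convergence in distribution\<close>

context disc_flow_point
begin

lemma AE_ball: "0 \<le> t \<Longrightarrow> AE \<omega> in M. h x t \<omega> \<in> ball 0 1"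
  using X.norm_h_less[OF x_ball] by (auto elim: eventually_mono)

text \<open>By Stone-Weierstrass \<open>f\<close> is within \<open>e\<close> of the real part of a
  holomorphic polynomial on the circle. The polynomial part converges by the moments. The remainder
  is below \<open>e\<close> up to a multiple of (1 - |z|^2)^p, whose mean along the flow tends to 0.
  The indicator confines \<open>f\<close> to where it is known to be continuous.\<close>

lemma flow_integral_limit:
  fixes f :: "complex \<Rightarrow> real"
  assumes f: "continuous_on (cball 0 1) f"
  shows "((\<lambda>t. \<integral>\<omega>. indicator (ball 0 1) (h x t \<omega>) *\<^sub>R f (h x t \<omega>) \<partial>M) \<longlongrightarrow> (\<integral>z. f z \<partial>\<mu>)) at_top"
proof (rule tendstoI)
  fix e' :: real assume "0 < e'"
  \<comment> \<open>Two parts for the remainder along the flow, one for the polynomial, one for the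
    remainder under \<mu>.\<close>
  define e where "e = e' / 4"
  have "0 < e" using \<open>0 < e'\<close> by (simp add: e_def)
  have "continuous_on (sphere 0 1) f" by (rule continuous_on_subset[OF f]) auto
  then obtain g where g: "real_polynomial_function g" "\<And>z. z \<in> sphere 0 1 \<Longrightarrow> \<bar>f z - g z\<bar> < e"
    using Stone_Weierstrass_real_polynomial_function[OF compact_sphere _ \<open>0 < e\<close>] by blast
  obtain P where P: "\<And>z. norm z = 1 \<Longrightarrow> g z = Re (poly P z)"
    using circle_poly_real_polynomial[OF g(1)] unfolding circle_poly_def by blast
  define R where "R z = f z - Re (poly P z)" for z
  have R_cont: "continuous_on (cball 0 1) R"
    unfolding R_def using f by (intro continuous_intros)
  have R_sphere: "\<bar>R z\<bar> < e" if "norm z = 1" for z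
    using g(2)[of z] P[OF that] that by (simp add: R_def)
  obtain p where p: "0 < p" "(u p \<longlongrightarrow> 0) at_top" using u_tendsto_0 by blast
  obtain C where C: "0 \<le> C" "\<And>z. z \<in> cball 0 1 \<Longrightarrow> \<bar>R z\<bar> \<le> e + C * max 0 (1 - (norm z)\<^sup>2) powr p"
    using continuous_small_near_circle[OF R_cont R_sphere p(1)] by blast
  have "((\<lambda>t. C * \<rho>0 powr p * u p t) \<longlongrightarrow> C * \<rho>0 powr p * 0) at_top"
    by (intro tendsto_intros p)
  then have ev1: "\<forall>\<^sub>F t in at_top. C * \<rho>0 powr p * u p t < e"
    using \<open>0 < e\<close> by (intro order_tendstoD) auto
  have ev2: "\<forall>\<^sub>F t in at_top. dist (\<integral>\<omega>. Re (poly P (h x t \<omega>)) \<partial>M) (\<integral>z. Re (poly P z) \<partial>\<mu>) < e"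
    using flow_polynomial_limit \<open>0 < e\<close> by (rule tendstoD)
  have int_mu: "integrable \<mu> R" "integrable \<mu> (\<lambda>z. Re (poly P z))"
  proof -
    have cP: "continuous_on UNIV (\<lambda>z. Re (poly P z))" by (intro continuous_intros)
    have "compact ((\<lambda>z. Re (poly P z)) ` sphere 0 1)"
      by (intro compact_continuous_image continuous_on_subset[OF cP]) auto
    then obtain B where "\<And>z. z \<in> sphere 0 1 \<Longrightarrow> \<bar>Re (poly P z)\<bar> \<le> B"
      by (force dest!: compact_imp_bounded simp: bounded_iff)
    then show "integrable \<mu> (\<lambda>z. Re (poly P z))"
      by (intro integrable_mu_bounded[where B=B] borel_measurable_continuous_onI cP) auto
    have "R \<in> borel_measurable (restrict_space borel (sphere 0 1))"
      by (intro borel_measurable_continuous_on_restrict continuous_on_subset[OF R_cont]) auto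
    then have "R \<in> borel_measurable \<mu>" by (simp add: measurable_cong_sets[OF sets_mu refl])
    then show "integrable \<mu> R"
      using R_sphere by (intro mu.integrable_const_bound[where B=e] AE_I2) (auto simp: space_mu intro: less_imp_le)
  qed
  have mu_R: "\<bar>\<integral>z. R z \<partial>\<mu>\<bar> \<le> e"
  proof -
    have "\<bar>\<integral>z. R z \<partial>\<mu>\<bar> \<le> (\<integral>z. \<bar>R z\<bar> \<partial>\<mu>)" using integral_norm_bound[of \<mu> R] by (simp only: real_norm_def)
    also have "\<dots> \<le> (\<integral>z. e \<partial>\<mu>)"
      using R_sphere by (intro integral_mono integrable_abs int_mu) (auto simp: space_mu intro: less_imp_le)
    finally show ?thesis by (simp add: mu.prob_space)
  qed
  have mu_f: "(\<integral>z. f z \<partial>\<mu>) = (\<integral>z. R z \<partial>\<mu>) + (\<integral>z. Re (poly P z) \<partial>\<mu>)"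
  proof -
    have "(\<integral>z. f z \<partial>\<mu>) = (\<integral>z. R z + Re (poly P z) \<partial>\<mu>)" by (simp add: R_def)
    also have "\<dots> = (\<integral>z. R z \<partial>\<mu>) + (\<integral>z. Re (poly P z) \<partial>\<mu>)"
      by (rule Bochner_Integration.integral_add[OF int_mu])
    finally show ?thesis .
  qed
  show "\<forall>\<^sub>F t in at_top. dist (\<integral>\<omega>. indicator (ball 0 1) (h x t \<omega>) *\<^sub>R f (h x t \<omega>) \<partial>M) (\<integral>z. f z \<partial>\<mu>) < e'"
    using ev1 ev2 eventually_ge_at_top[of 0]
  proof eventually_elim
    case (elim t)
    have H: "h x t \<in> borel_measurable M" using elim by auto
    let ?R = "\<lambda>\<omega>. indicator (ball 0 1) (h x t \<omega>) *\<^sub>R R (h x t \<omega>)"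
    let ?P = "\<lambda>\<omega>. Re (poly P (h x t \<omega>))"
    have R_meas: "?R \<in> borel_measurable M"
    proof (rule measurable_compose[OF H])
      show "(\<lambda>z. indicator (ball 0 1) z *\<^sub>R R z) \<in> borel_measurable borel"
        by (intro borel_measurable_continuous_on_indicator continuous_on_subset[OF R_cont]) auto
    qed
    have R_le: "AE \<omega> in M. \<bar>?R \<omega>\<bar> \<le> e + C * (\<rho>0 powr p * q p t \<omega>)"
    proof (rule AE_I2)
      fix \<omega>
      have q: "\<rho>0 powr p * q p t \<omega> = max 0 (1 - (norm (h x t \<omega>))\<^sup>2) powr p"
        using rho0 by (simp add: q_def powr_divide)
      have "0 \<le> C * max 0 (1 - (norm (h x t \<omega>))\<^sup>2) powr p" using C(1) by simp
      then show "\<bar>?R \<omega>\<bar> \<le> e + C * (\<rho>0 powr p * q p t \<omega>)"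
        unfolding q using C(2)[of "h x t \<omega>"] \<open>0 < e\<close> by (auto simp: indicator_def)
    qed
    have int_q: "integrable M (\<lambda>\<omega>. e + C * (\<rho>0 powr p * q p t \<omega>))"
      using q_integrable[OF p(1) elim(3)] by auto
    have R_int: "integrable M ?R"
    proof (rule Bochner_Integration.integrable_bound[OF int_q R_meas])
      show "AE \<omega> in M. norm (?R \<omega>) \<le> norm (e + C * (\<rho>0 powr p * q p t \<omega>))"
        using R_le by eventually_elim auto
    qed
    have "\<bar>\<integral>\<omega>. ?R \<omega> \<partial>M\<bar> \<le> (\<integral>\<omega>. \<bar>?R \<omega>\<bar> \<partial>M)" using integral_norm_bound[of M ?R] by (simp only: real_norm_def)
    also have "\<dots> \<le> (\<integral>\<omega>. e + C * (\<rho>0 powr p * q p t \<omega>) \<partial>M)"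
      by (rule integral_mono_AE[OF integrable_abs[OF R_int] int_q R_le])
    also have "\<dots> = e + C * \<rho>0 powr p * u p t"
      using q_integrable[OF p(1) elim(3)] by (simp add: u_def prob_space)
    finally have R1: "\<bar>\<integral>\<omega>. ?R \<omega> \<partial>M\<bar> < 2 * e" using elim(1) by simp
    have P_int: "integrable M ?P"
    proof -
      have "integrable M (\<lambda>\<omega>. poly P (h x t \<omega>))"
        unfolding poly_altdef using X.wmom_integrable[of "\<lambda>_. 1" 1 t] elim(3)
        by (intro Bochner_Integration.integrable_sum) auto
      then show ?thesis by (rule integrable_bounded_linear[OF bounded_linear_Re])
    qed
    have "(\<integral>\<omega>. indicator (ball 0 1) (h x t \<omega>) *\<^sub>R f (h x t \<omega>) \<partial>M) = (\<integral>\<omega>. ?R \<omega> + ?P \<omega> \<partial>M)"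
    proof (rule integral_cong_AE)
      show "AE \<omega> in M. indicator (ball 0 1) (h x t \<omega>) *\<^sub>R f (h x t \<omega>) = ?R \<omega> + ?P \<omega>"
        using AE_ball[OF elim(3)] by eventually_elim (simp add: R_def)
      show "(\<lambda>\<omega>. indicator (ball 0 1) (h x t \<omega>) *\<^sub>R f (h x t \<omega>)) \<in> borel_measurable M"
      proof (rule measurable_compose[OF H])
        show "(\<lambda>z. indicator (ball 0 1) z *\<^sub>R f z) \<in> borel_measurable borel"
          by (intro borel_measurable_continuous_on_indicator continuous_on_subset[OF f]) auto
      qed
      show "(\<lambda>\<omega>. ?R \<omega> + ?P \<omega>) \<in> borel_measurable M"
        using R_int P_int by (intro borel_measurable_add borel_measurable_integrable)
    qed
    also have "\<dots> = (\<integral>\<omega>. ?R \<omega> \<partial>M) + (\<integral>\<omega>. ?P \<omega> \<partial>M)"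
      by (rule Bochner_Integration.integral_add[OF R_int P_int])
    finally have eq: "(\<integral>\<omega>. indicator (ball 0 1) (h x t \<omega>) *\<^sub>R f (h x t \<omega>) \<partial>M) = (\<integral>\<omega>. ?R \<omega> \<partial>M) + (\<integral>\<omega>. ?P \<omega> \<partial>M)" .
    show ?case
      using R1 elim(2) mu_R unfolding eq mu_f dist_real_def e_def by linarith
  qed
qed

text \<open>From a point of the open disc the law at each time gives the open disc full mass, so its
  restriction is a probability measure; integrals against it are expectations carrying the indicator
  of the open disc.\<close>

theorem flow_converges:
  "converges_in_distribution_on (cball 0 1)
     (\<lambda>t. regard_on (cball 0 1) (transition_law M h (ball 0 1) t x)) (regard_on (cball 0 1) \<mu>) at_top"
proof -
  let ?S = "cball (0::complex) 1" and ?B = "ball (0::complex) 1"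
  have id_mu: "(\<lambda>z. z) \<in> measurable \<mu> (restrict_space borel ?S)"
    by (intro measurable_restrict_space2) (auto simp: space_mu measurable_mu)
  have id_B: "(\<lambda>z. z) \<in> measurable (transition_law M h ?B t x) (restrict_space borel ?S)" for t
    unfolding transition_law_def
    by (intro measurable_restrict_space2 measurable_restrict_space1) (auto simp: space_restrict_space)
  have prob: "prob_space (transition_law M h ?B t x)" if "0 \<le> t" for t
    unfolding transition_law_def
  proof (rule prob_space_restrict_space)
    have H: "h x t \<in> borel_measurable M" using that by auto
    show "emeasure (distr M borel (h x t)) ?B = 1"
    proof -
      have "emeasure (distr M borel (h x t)) ?B = emeasure M (h x t -` ?B \<inter> space M)"
        by (rule emeasure_distr[OF H]) auto
      also have "\<dots> = emeasure M (space M)"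
        using AE_ball[OF that] H by (intro emeasure_eq_AE) auto
      finally show ?thesis by (simp add: emeasure_space_1)
    qed
  qed auto
  show ?thesis
    unfolding converges_in_distribution_on_def
  proof (intro conjI allI impI)
    show "\<forall>\<^sub>F t in at_top. prob_space (regard_on ?S (transition_law M h ?B t x)) \<and>
        sets (regard_on ?S (transition_law M h ?B t x)) = sets (restrict_space borel ?S)"
      using eventually_ge_at_top[of 0]
      by eventually_elim (simp add: regard_on_def prob_space.prob_space_distr[OF prob id_B])
    show "prob_space (regard_on ?S \<mu>)"
      unfolding regard_on_def by (rule mu.prob_space_distr[OF id_mu])
    show "sets (regard_on ?S \<mu>) = sets (restrict_space borel ?S)"
      by (simp add: regard_on_def)
  next
    fix f :: "complex \<Rightarrow> real" assume "continuous_on ?S f \<and> bounded (f ` ?S)"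
    then have f: "continuous_on ?S f" by simp
    have f_meas: "f \<in> borel_measurable (restrict_space borel ?S)"
      by (rule borel_measurable_continuous_on_restrict[OF f])
    have mu: "(\<integral>z. f z \<partial>regard_on ?S \<mu>) = (\<integral>z. f z \<partial>\<mu>)"
      unfolding regard_on_def by (rule integral_distr[OF id_mu f_meas])
    have law: "(\<integral>z. f z \<partial>regard_on ?S (transition_law M h ?B t x)) = (\<integral>\<omega>. indicator ?B (h x t \<omega>) *\<^sub>R f (h x t \<omega>) \<partial>M)"
      if "0 \<le> t" for t
    proof -
      have H: "h x t \<in> measurable M borel" using that by auto
      have "(\<integral>z. f z \<partial>regard_on ?S (transition_law M h ?B t x)) = (\<integral>z. f z \<partial>transition_law M h ?B t x)"
        unfolding regard_on_def by (rule integral_distr[OF id_B f_meas])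
      also have "\<dots> = (\<integral>z. indicator ?B z *\<^sub>R f z \<partial>distr M borel (h x t))"
        unfolding transition_law_def by (rule integral_restrict_space) auto
      also have "\<dots> = (\<integral>\<omega>. indicator ?B (h x t \<omega>) *\<^sub>R f (h x t \<omega>) \<partial>M)"
        by (intro integral_distr[OF H] borel_measurable_continuous_on_indicator continuous_on_subset[OF f]) auto
      finally show ?thesis .
    qed
    have "\<forall>\<^sub>F t in at_top. (\<integral>\<omega>. indicator ?B (h x t \<omega>) *\<^sub>R f (h x t \<omega>) \<partial>M) = (\<integral>z. f z \<partial>regard_on ?S (transition_law M h ?B t x))"
      using eventually_ge_at_top[of 0] by eventually_elim (simp only: law)
    from Lim_transform_eventually[OF flow_integral_limit[OF f] this]
    show "((\<lambda>t. \<integral>z. f z \<partial>regard_on ?S (transition_law M h ?B t x)) \<longlongrightarrow> (\<integral>z. f z \<partial>regard_on ?S \<mu>)) at_top"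
      unfolding mu .
  qed
qed

end

theorem corollary1:
  fixes K \<epsilon> :: real
    and M :: "'a measure"
    and F :: "real \<Rightarrow> 'a measure"
    and W :: "real \<Rightarrow> 'a \<Rightarrow> real"
    and h :: "complex \<Rightarrow> real \<Rightarrow> 'a \<Rightarrow> complex"
    and \<mu> :: "complex measure"
    and x :: complex
  assumes "K > 0" and "\<epsilon> > 0"
    and "filtered_prob_space M F"
    and "brownian_motion M F W"
    and "\<And>y. y \<in> cball 0 1 \<Longrightarrow>
           stratonovich_solution M F W
             (\<lambda>z. complex_of_real K * (1 - z\<^sup>2))
             (\<lambda>z. complex_of_real (sqrt 2) * \<i> * complex_of_real \<epsilon> * z) y (h y)"
    and "invariant_prob_measure M h (sphere 0 1) \<mu>"
    and "x \<in> ball 0 1"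
  shows "converges_in_distribution_on (cball 0 1)
           (\<lambda>t. regard_on (cball 0 1) (transition_law M h (ball 0 1) t x))
           (regard_on (cball 0 1) \<mu>) at_top"
proof -
  \<comment> \<open>This fixes c = sqrt 2 * \<epsilon>, so the damping constant \<kappa> = c^2/2 is
    \<epsilon>^2.\<close>
  have eq: "(\<lambda>z. complex_of_real (sqrt 2) * \<i> * complex_of_real \<epsilon> * z) = (\<lambda>z. \<i> * complex_of_real (sqrt 2 * \<epsilon>) * z)"
    by (simp add: fun_eq_iff)
  interpret prob_space M using assms(3) by (simp add: filtered_prob_space_def)
  interpret disc_flow_point M F W K "sqrt 2 * \<epsilon>" h \<mu> x
    using assms(1-4,6,7) assms(5)[unfolded eq] by unfold_locales auto
  show ?thesis by (rule flow_converges)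
qed

end
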